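(* Let $\{V_j\}_{j\in\mathbb{Z}}$ be an MRA of $L^2(\mathbb{R}^d)$ of multiplicity $L$ associated with the dilation matrix $A$, let $W_j=V_{j+1}\ominus V_j$, and let $\{f^n_l : n\ge 0,\ 1\le l\le L\}$ be the associated basic multiwavelet packets. Then: (i) for every $j\ge 0$, $\{f^n_l(\cdot-k): a^j\le n\le a^{j+1}-1,\ 1\le l\le L,\ k\in\mathbb{Z}^d\}$ is an orthonormal basis of $W_j$; (ii) for every $j\ge 0$, $\{f^n_l(\cdot-k): 0\le n\le a^j-1,\ 1\le l\le L,\ k\in\mathbb{Z}^d\}$ is an orthonormal basis of $V_j$; (iii) $\{f^n_l(\cdot-k): n\ge 0,\ 1\le l\le L,\ k\in\mathbb{Z}^d\}$ is an orthonormal basis of $L^2(\mathbb{R}^d)$.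
   Context: A dilation matrix for $\mathbb{R}^d$ is a $d\times d$ matrix $A$ with $A(\mathbb{Z}^d)\subset\mathbb{Z}^d$ all of whose eigenvalues $\lambda$ satisfy $|\lambda|>1$. Put $B=A^t$ and $a=|\det A|=|\det B|$ (an integer $\geq 2$). A set of digits $K_B$ for $B$ is a subset of $\mathbb{Z}^d$ containing exactly one element of each of the $a$ cosets of $B\mathbb{Z}^d$ in $\mathbb{Z}^d$. An MRA of $L^2(\mathbb{R}^d)$ of multiplicity $L$ associated with $A$ is a sequence $\{V_j\}_{j\in\mathbb{Z}}$ of closed subspaces of $L^2(\mathbb{R}^d)$ such that: (M1) $V_j\subset V_{j+1}$ for all $j$; (M2) $\bigcup_j V_j$ is dense in $L^2(\mathbb{R}^d)$ and $\bigcap_j V_j=\{0\}$; (M3) $f\in V_j$ if and only if $f(A\,\cdot)\in V_{j+1}$; (M4) there are $\varphi_1,\dots,\varphi_L\in V_0$ (the scaling functions) such that $\{\varphi_l(\cdot-k):1\le l\le L,\ k\in\mathbb{Z}^d\}$ is an orthonormal basis of $V_0$. $W_j=V_{j+1}\ominus V_j$ is the orthogonal complement of $V_j$ in $V_{j+1}$. Basic multiwavelet packets. Let $\{h^0_{ljk}\}_{k}\in l^2(\mathbb{Z}^d)$, $1\le l,j\le L$, be the sequences with $\varphi_l(x)=\sum_{j=1}^L\sum_{k\in\mathbb{Z}^d}h^0_{ljk}a^{1/2}\varphi_j(Ax-k)$. Fix a set of digits $K_B$ for $B$, and fix sequences $\{h^r_{ljk}\}_k\in l^2(\mathbb{Z}^d)$,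 $1\le r\le a-1$, $1\le l,j\le L$, such that, with $h^r_{lj}(\xi)=\sum_{k\in\mathbb{Z}^d}a^{-1/2}h^r_{ljk}e^{-i\langle \xi,k\rangle}$ and $H_r(\xi)=(h^r_{lj}(\xi))_{1\le l,j\le L}$ for $0\le r\le a-1$, one has $$\sum_{\mu\in K_B}H_r(\xi+2\pi B^{-1}\mu)H_s^*(\xi+2\pi B^{-1}\mu)=\delta_{rs}I_L\quad\text{for a.e. }\xi,\ 0\le r,s\le a-1,$$ where $M^*$ is the conjugate transpose (such sequences exist). Set $f^0_l=\varphi_l$, and define $f^n_l$ for all integers $n\ge0$ recursively by $$f^{s+ar}_l(x)=\sum_{j=1}^L\sum_{k\in\mathbb{Z}^d}h^s_{ljk}a^{1/2}f^r_j(Ax-k),\qquad 0\le s\le a-1,\ r\ge 0,\ 1\le l\le L$$ (series converging in $L^2$). The functions $f^n_l$, $n\ge0$, $1\le l\le L$, are the basic multiwavelet packets. *)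

theory Defs
  imports "HOL-Analysis.Analysis"
begin

section \<open>Square-integrable functions\<close>

text \<open>
  Elements of \<open>L\<^sup>2\<close> are represented by functions, not by equivalence classes; equality in \<open>L\<^sup>2\<close> is
  equality almost everywhere. For \<open>M = lborel\<close> the representatives are Borel functions, and every
  class of Lebesgue measurable functions contains one.
\<close>

definition L2 :: "'a measure \<Rightarrow> ('a \<Rightarrow> complex) set" where
  "L2 M = {f. f \<in> borel_measurable M \<and> integrable M (\<lambda>x. (cmod (f x))\<^sup>2)}"

definition L2_inner :: "'a measure \<Rightarrow> ('a \<Rightarrow> complex) \<Rightarrow> ('a \<Rightarrow> complex) \<Rightarrow> complex" where
  "L2_inner M f g = (LINT x|M. f x * cnj (g x))"

definition L2_dist :: "'a measure \<Rightarrow> ('a \<Rightarrow> complex) \<Rightarrow> ('a \<Rightarrow> complex) \<Rightarrow> real" where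
  "L2_dist M f g = sqrt (LINT x|M. (cmod (f x - g x))\<^sup>2)"

text \<open>
  Unconditional convergence of \<open>\<Sum>i\<in>I. g i\<close> to \<open>s\<close> in \<open>L\<^sup>2\<close>: the net of finite partial sums converges
  in norm. Membership of the terms and of the limit in \<open>L\<^sup>2\<close> is required explicitly, since the
  integral of a non-integrable function is 0 by convention.
\<close>

definition has_L2_sum ::
    "'a measure \<Rightarrow> ('i \<Rightarrow> 'a \<Rightarrow> complex) \<Rightarrow> 'i set \<Rightarrow> ('a \<Rightarrow> complex) \<Rightarrow> bool" where
  "has_L2_sum M g I s \<longleftrightarrow>
     (\<forall>i\<in>I. g i \<in> L2 M) \<and> s \<in> L2 M \<and>
     ((\<lambda>F. L2_dist M (\<lambda>x. \<Sum>i\<in>F. g i x) s) \<longlongrightarrow> 0) (finite_subsets_at_top I)"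

definition L2_dense :: "'a measure \<Rightarrow> ('a \<Rightarrow> complex) set \<Rightarrow> ('a \<Rightarrow> complex) set \<Rightarrow> bool" where
  "L2_dense M D V \<longleftrightarrow> D \<subseteq> V \<and> (\<forall>f\<in>V. \<forall>\<epsilon>>0. \<exists>g\<in>D. L2_dist M f g < \<epsilon>)"

text \<open>
  The closure condition, applied to constant sequences, also makes \<open>V\<close> invariant under changing a
  function on a null set, so that \<open>V\<close> is a union of \<open>L\<^sup>2\<close> classes.
\<close>

definition L2_closed_subspace :: "'a measure \<Rightarrow> ('a \<Rightarrow> complex) set \<Rightarrow> bool" where
  "L2_closed_subspace M V \<longleftrightarrow>
     V \<subseteq> L2 M \<and> (\<lambda>x. 0) \<in> V \<and>
     (\<forall>f\<in>V. \<forall>g\<in>V. (\<lambda>x. f x + g x) \<in> V) \<and>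
     (\<forall>c. \<forall>f\<in>V. (\<lambda>x. c * f x) \<in> V) \<and>
     (\<forall>u. \<forall>f\<in>L2 M. (\<forall>n::nat. u n \<in> V) \<and> (\<lambda>n. L2_dist M (u n) f) \<longlonglongrightarrow> 0 \<longrightarrow> f \<in> V)"

definition L2_span :: "('i \<Rightarrow> 'a \<Rightarrow> complex) \<Rightarrow> 'i set \<Rightarrow> ('a \<Rightarrow> complex) set" where
  "L2_span e I = {(\<lambda>x. \<Sum>i\<in>F. c i * e i x) | F c. finite F \<and> F \<subseteq> I}"

text \<open>The indexed family \<open>(e i)\<close>, \<open>i \<in> I\<close>, is an orthonormal basis of the closed subspace \<open>V\<close>.\<close>

definition orthonormal_basis ::
    "'a measure \<Rightarrow> ('i \<Rightarrow> 'a \<Rightarrow> complex) \<Rightarrow> 'i set \<Rightarrow> ('a \<Rightarrow> complex) set \<Rightarrow> bool" where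
  "orthonormal_basis M e I V \<longleftrightarrow>
     (\<forall>i\<in>I. e i \<in> V) \<and>
     (\<forall>i\<in>I. \<forall>j\<in>I. L2_inner M (e i) (e j) = (if i = j then 1 else 0)) \<and>
     L2_dense M (L2_span e I) V"

definition L2_ominus :: "'a measure \<Rightarrow> ('a \<Rightarrow> complex) set \<Rightarrow> ('a \<Rightarrow> complex) set \<Rightarrow> ('a \<Rightarrow> complex) set" where
  "L2_ominus M V U = {f \<in> V. \<forall>g\<in>U. L2_inner M f g = 0}"


section \<open>Dilation matrices and digits\<close>

definition int_lattice :: "(real ^ 'd) set" where
  "int_lattice = {k. \<forall>i. k $ i \<in> \<int>}"

definition dilation_matrix :: "real ^ 'd ^ 'd \<Rightarrow> bool" where
  "dilation_matrix A \<longleftrightarrow>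
     (*v) A ` int_lattice \<subseteq> int_lattice \<and>
     (\<forall>(z::complex) v. v \<noteq> 0 \<and> map_matrix complex_of_real A *v v = z *s v \<longrightarrow> cmod z > 1)"

text \<open>The number \<open>a = \<bar>det A\<bar>\<close>; for a dilation matrix the rounding does nothing.\<close>

definition dilation_index :: "real ^ 'd ^ 'd \<Rightarrow> nat" where
  "dilation_index A = nat \<lfloor>\<bar>det A\<bar>\<rfloor>"

lemma dilation_index_eq:
  fixes A :: "real ^ 'd ^ 'd"
  assumes "dilation_matrix A"
  shows "real (dilation_index A) = \<bar>det A\<bar>"
proof -
  have entry: "A $ i $ j \<in> \<int>" for i j
  proof -
    have "axis j 1 \<in> (int_lattice :: (real ^ 'd) set)"
      by (auto simp: int_lattice_def axis_def)
    then have "A *v axis j 1 \<in> int_lattice"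
      using assms by (auto simp: dilation_matrix_def)
    then show ?thesis
      by (auto simp: int_lattice_def matrix_vector_mult_basis column_def)
  qed
  have "det A \<in> \<int>"
    unfolding det_def by (intro Ints_sum Ints_mult Ints_prod entry Ints_of_int)
  then show ?thesis
    by (auto simp: dilation_index_def elim: Ints_cases)
qed

definition digit_set :: "real ^ 'd ^ 'd \<Rightarrow> (real ^ 'd) set \<Rightarrow> bool" where
  "digit_set B K \<longleftrightarrow>
     K \<subseteq> int_lattice \<and>
     (\<forall>k\<in>int_lattice. \<exists>!\<mu>. \<mu> \<in> K \<and> \<mu> \<in> {k + B *v m | m. m \<in> int_lattice})"


section \<open>Multiresolution analyses and basic multiwavelet packets\<close>

text \<open>
  \<open>V\<close> is an MRA associated with \<open>A\<close> of multiplicity \<open>CARD('l)\<close>, with scaling functions \<open>\<phi>\<close>.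
\<close>

definition MRA ::
    "real ^ 'd ^ 'd \<Rightarrow> (int \<Rightarrow> (real ^ 'd \<Rightarrow> complex) set) \<Rightarrow> ('l::finite \<Rightarrow> real ^ 'd \<Rightarrow> complex) \<Rightarrow> bool" where
  "MRA A V \<phi> \<longleftrightarrow>
     (\<forall>j. L2_closed_subspace lborel (V j)) \<and>
     (\<forall>j. V j \<subseteq> V (j + 1)) \<and>
     L2_dense lborel (\<Union>j. V j) (L2 lborel) \<and>
     (\<Inter>j. V j) = {f \<in> L2 lborel. AE x in lborel. f x = 0} \<and>
     (\<forall>j. \<forall>f\<in>L2 lborel. f \<in> V j \<longleftrightarrow> (\<lambda>x. f (A *v x)) \<in> V (j + 1)) \<and>
     (\<forall>l. \<phi> l \<in> V 0) \<and>
     orthonormal_basis lborel (\<lambda>(l, k) x. \<phi> l (x - k)) (UNIV \<times> int_lattice) (V 0)"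

definition wavelet_space :: "(int \<Rightarrow> (real ^ 'd \<Rightarrow> complex) set) \<Rightarrow> int \<Rightarrow> (real ^ 'd \<Rightarrow> complex) set" where
  "wavelet_space V j = L2_ominus lborel (V (j + 1)) (V j)"

text \<open>
  \<open>g(x) = \<Sum>\<^sub>j \<Sum>\<^sub>k c\<^sub>j\<^sub>k a\<^bsup>1/2\<^esup> u\<^sub>j(A x - k)\<close>, with convergence in \<open>L\<^sup>2\<close>.
\<close>

definition refines ::
    "real ^ 'd ^ 'd \<Rightarrow> ('l::finite \<Rightarrow> real ^ 'd \<Rightarrow> complex) \<Rightarrow> ('l \<Rightarrow> real ^ 'd \<Rightarrow> complex) \<Rightarrow>
     (real ^ 'd \<Rightarrow> complex) \<Rightarrow> bool" where
  "refines A c u g \<longleftrightarrow>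
     has_L2_sum lborel
       (\<lambda>(j, k) x. c j k * complex_of_real (sqrt (dilation_index A)) * u j (A *v x - k))
       (UNIV \<times> int_lattice) g"

text \<open>
  \<open>m\<close> is (a representative of) the \<open>2\<pi>\<close>-periodic function with Fourier series
  \<open>\<Sum>\<^sub>k c\<^sub>k e\<^bsup>-i\<langle>\<xi>,k\<rangle>\<^esup>\<close>, which for a square-summable \<open>c\<close> converges in \<open>L\<^sup>2\<close> of the period cube.
\<close>

definition fourier_sum :: "(real ^ 'd \<Rightarrow> complex) \<Rightarrow> (real ^ 'd \<Rightarrow> complex) \<Rightarrow> bool" where
  "fourier_sum c m \<longleftrightarrow>
     (\<forall>\<xi>. \<forall>k\<in>int_lattice. m (\<xi> + (2 * pi) *\<^sub>R k) = m \<xi>) \<and>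
     has_L2_sum (restrict_space lborel (cbox (\<chi> i. - pi) (\<chi> i. pi)))
       (\<lambda>k \<xi>. c k * exp (- \<i> * complex_of_real (\<xi> \<bullet> k))) int_lattice m"

definition conj_transpose :: "complex ^ 'n ^ 'm \<Rightarrow> complex ^ 'm ^ 'n" where
  "conj_transpose M = map_matrix cnj (transpose M)"

text \<open>
  \<open>h r l j k\<close>, for \<open>r < a\<close> and \<open>k\<close> in the lattice, is the coefficient \<open>h\<^sup>r\<^sub>l\<^sub>j\<^sub>k\<close>, and \<open>H r\<close> is (a
  representative of) the matrix function whose entries are the symbols
  \<open>\<Sum>\<^sub>k a\<^bsup>-1/2\<^esup> h\<^sup>r\<^sub>l\<^sub>j\<^sub>k e\<^bsup>-i\<langle>\<xi>,k\<rangle>\<^esup>\<close>.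
\<close>

definition packet_filters ::
    "real ^ 'd ^ 'd \<Rightarrow> (real ^ 'd) set \<Rightarrow> ('l::finite \<Rightarrow> real ^ 'd \<Rightarrow> complex) \<Rightarrow>
     (nat \<Rightarrow> 'l \<Rightarrow> 'l \<Rightarrow> real ^ 'd \<Rightarrow> complex) \<Rightarrow> (nat \<Rightarrow> real ^ 'd \<Rightarrow> complex ^ 'l ^ 'l) \<Rightarrow> bool" where
  "packet_filters A K \<phi> h H \<longleftrightarrow>
     (\<forall>r < dilation_index A. \<forall>l j. (\<lambda>k. (cmod (h r l j k))\<^sup>2) summable_on int_lattice) \<and>
     (\<forall>l. refines A (h 0 l) \<phi> (\<phi> l)) \<and>
     (\<forall>r < dilation_index A. \<forall>l j.
        fourier_sum (\<lambda>k. h r l j k / complex_of_real (sqrt (dilation_index A))) (\<lambda>\<xi>. H r \<xi> $ l $ j)) \<and>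
     (\<forall>r < dilation_index A. \<forall>s < dilation_index A. AE \<xi> in lborel.
        (\<Sum>\<mu>\<in>K. H r (\<xi> + (2 * pi) *\<^sub>R (matrix_inv (transpose A) *v \<mu>)) **
                conj_transpose (H s (\<xi> + (2 * pi) *\<^sub>R (matrix_inv (transpose A) *v \<mu>))))
        = (if r = s then mat 1 else 0))"

definition basic_multiwavelet_packets ::
    "real ^ 'd ^ 'd \<Rightarrow> ('l::finite \<Rightarrow> real ^ 'd \<Rightarrow> complex) \<Rightarrow>
     (nat \<Rightarrow> 'l \<Rightarrow> 'l \<Rightarrow> real ^ 'd \<Rightarrow> complex) \<Rightarrow> (nat \<Rightarrow> 'l \<Rightarrow> real ^ 'd \<Rightarrow> complex) \<Rightarrow> bool" where
  "basic_multiwavelet_packets A \<phi> h f \<longleftrightarrow>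
     f 0 = \<phi> \<and>
     (\<forall>s < dilation_index A. \<forall>r l. refines A (h s l) (f r) (f (s + dilation_index A * r) l))"

end

theory Submission
  imports Defs
begin

text \<open>
  On the level of coefficients, the matrix identity for the symbols says that for fixed \<open>r\<close> the
  functions \<open>f\<^bsup>s+ar\<^esup>\<^sub>l(x - m)\<close>, expanded in the orthonormal system \<open>a\<^bsup>1/2\<^esup> f\<^sup>r\<^sub>j(A x - k)\<close>, have orthonormal
  coefficient vectors. To see this, use that \<open>\<xi> \<mapsto> \<xi> + 2\<pi> B\<^bsup>-1\<^esup> \<mu>\<close> preserves integrals of periodic functions
  and average over the \<open>a\<close> digits \<open>\<mu>\<close>. The vectors are also complete: by Bessel's inequality each
  \<open>a\<^bsup>1/2\<^esup> f\<^sup>r\<^sub>j(A x - k)\<close> has energy at most 1 in their span, and summed over \<open>j\<close> and over \<open>k\<close> modulo \<open>A\<close>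
  these \<open>a L\<close> energies give the sum of the squared norms of the \<open>a L\<close> filters, which is \<open>a L\<close>. Hence
  passing from \<open>r\<close> to all \<open>s + a r\<close> turns a packet basis of \<open>V\<^sub>j\<close>, dilated to a basis of \<open>V\<^bsub>j+1\<^esub>\<close>, into
  another basis of \<open>V\<^bsub>j+1\<^esub>\<close>, and (ii) follows by induction; (i) and (iii) are consequences of (ii).
\<close>


section \<open>Square-integrable functions\<close>

text \<open>The symbol identity makes the rows of a square matrix orthonormal: its
  \<open>a L\<close> rows are the pairs of filter and component, its \<open>a L\<close> columns the
  pairs of digit and component. Completeness is the dual statement about columns, and the count of
  energies is the trace form of the fact that a square matrix with orthonormal rows is unitary. On
  the side of sequences the columns are indexed by digits of \<open>A\<close>, while the identity is
  stated over digits of its transpose, so the argument turns on both digit sets having exactly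
  \<open>a\<close> elements. Hence the volume computation \<open>digit_set_card\<close>, with the
  change of variables and the tilings before it. Bessel's inequality bounds the columns only once
  the packets are known to be orthonormal, so orthonormality precedes completeness in each passage
  to the next scale. Since functions and not classes are the elements, completeness is handled
  through finite linear combinations and distances. Statement (iii) also needs \<open>a ^ j\<close>
  to be unbounded; this is where the trivial intersection of the spaces enters.\<close>

lemma borel_measurable_cnj [measurable (raw)]:
  "f \<in> borel_measurable M \<Longrightarrow> (\<lambda>x. cnj (f x)) \<in> borel_measurable M"
  by (rule borel_measurable_continuous_on[of cnj]) (auto intro: continuous_intros)

lemma L2_integrable_norm_mult:
  assumes "f \<in> L2 M" "g \<in> L2 M"
  shows "integrable M (\<lambda>x. cmod (f x) * cmod (g x))"
proof (rule Bochner_Integration.integrable_bound)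
  show "integrable M (\<lambda>x. (cmod (f x))\<^sup>2 + (cmod (g x))\<^sup>2)"
    using assms by (auto simp: L2_def)
  show "(\<lambda>x. cmod (f x) * cmod (g x)) \<in> borel_measurable M"
    using assms by (auto simp: L2_def)
  have "cmod (f x) * cmod (g x) \<le> (cmod (f x))\<^sup>2 + (cmod (g x))\<^sup>2" for x
    using sum_squares_bound[of "cmod (f x)" "cmod (g x)"]
      mult_nonneg_nonneg[OF norm_ge_zero[of "f x"] norm_ge_zero[of "g x"]] by linarith
  then show "AE x in M. norm (cmod (f x) * cmod (g x)) \<le> norm ((cmod (f x))\<^sup>2 + (cmod (g x))\<^sup>2)"
    unfolding real_norm_def by (intro always_eventually allI order_trans[OF _ abs_ge_self]) simp
qed

lemma L2_integrable_mult:
  assumes "f \<in> L2 M" "g \<in> L2 M"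
  shows "integrable M (\<lambda>x. f x * cnj (g x))"
  by (rule Bochner_Integration.integrable_bound[OF L2_integrable_norm_mult[OF assms]])
     (use assms in \<open>auto simp: L2_def norm_mult intro!: borel_measurable_times borel_measurable_cnj\<close>)

lemma L2_zero [simp]: "(\<lambda>x. 0) \<in> L2 M"
  by (simp add: L2_def)

lemma L2_cmult: "f \<in> L2 M \<Longrightarrow> (\<lambda>x. c * f x) \<in> L2 M"
  by (auto simp: L2_def norm_mult power_mult_distrib)

lemma L2_add:
  assumes "f \<in> L2 M" "g \<in> L2 M"
  shows "(\<lambda>x. f x + g x) \<in> L2 M"
proof -
  have "integrable M (\<lambda>x. (cmod (f x + g x))\<^sup>2)"
  proof (rule Bochner_Integration.integrable_bound)
    show "integrable M (\<lambda>x. (cmod (f x))\<^sup>2 + (cmod (g x))\<^sup>2 + 2 * (cmod (f x) * cmod (g x)))"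
      using assms L2_integrable_norm_mult[OF assms] by (auto simp: L2_def)
    show "(\<lambda>x. (cmod (f x + g x))\<^sup>2) \<in> borel_measurable M"
      using assms by (auto simp: L2_def)
    have "(cmod (f x + g x))\<^sup>2 \<le> (cmod (f x))\<^sup>2 + (cmod (g x))\<^sup>2 + 2 * (cmod (f x) * cmod (g x))" for x
      using power_mono[OF norm_triangle_ineq[of "f x" "g x"] norm_ge_zero, of 2]
      by (simp only: power2_sum mult.assoc)
    then show "AE x in M. norm ((cmod (f x + g x))\<^sup>2)
        \<le> norm ((cmod (f x))\<^sup>2 + (cmod (g x))\<^sup>2 + 2 * (cmod (f x) * cmod (g x)))"
      unfolding real_norm_def by (intro always_eventually allI order_trans[OF _ abs_ge_self]) simp
  qed
  then show ?thesis using assms by (auto simp: L2_def)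
qed

lemma L2_diff: "f \<in> L2 M \<Longrightarrow> g \<in> L2 M \<Longrightarrow> (\<lambda>x. f x - g x) \<in> L2 M"
  using L2_add[of f M "\<lambda>x. -1 * g x"] L2_cmult[of g M "-1"] by simp

lemma L2_sum: "(\<And>i. i \<in> F \<Longrightarrow> g i \<in> L2 M) \<Longrightarrow> (\<lambda>x. \<Sum>i\<in>F. g i x) \<in> L2 M"
  by (induction F rule: infinite_finite_induct) (simp_all add: L2_add)

lemma L2_lincomb: "(\<And>i. i \<in> F \<Longrightarrow> e i \<in> L2 M) \<Longrightarrow> (\<lambda>x. \<Sum>i\<in>F. c i * e i x) \<in> L2 M"
  by (intro L2_sum L2_cmult) auto

lemma L2_inner_commute: "L2_inner M g f = cnj (L2_inner M f g)"
  unfolding L2_inner_def by (subst Bochner_Integration.integral_cnj[symmetric]) (simp add: mult.commute)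

lemma L2_inner_add_left:
  assumes "f \<in> L2 M" "g \<in> L2 M" "u \<in> L2 M"
  shows "L2_inner M (\<lambda>x. f x + g x) u = L2_inner M f u + L2_inner M g u"
  using L2_integrable_mult[OF assms(1,3)] L2_integrable_mult[OF assms(2,3)]
  unfolding L2_inner_def by (simp add: distrib_right)

lemma L2_inner_cmult_left: "L2_inner M (\<lambda>x. c * f x) u = c * L2_inner M f u"
  unfolding L2_inner_def by (simp add: mult.assoc)

lemma L2_inner_diff_left:
  assumes "f \<in> L2 M" "g \<in> L2 M" "u \<in> L2 M"
  shows "L2_inner M (\<lambda>x. f x - g x) u = L2_inner M f u - L2_inner M g u"
  using L2_integrable_mult[OF assms(1,3)] L2_integrable_mult[OF assms(2,3)]
  unfolding L2_inner_def by (simp add: left_diff_distrib)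

lemma L2_inner_sum_left:
  assumes "\<And>i. i \<in> F \<Longrightarrow> g i \<in> L2 M" "u \<in> L2 M"
  shows "L2_inner M (\<lambda>x. \<Sum>i\<in>F. g i x) u = (\<Sum>i\<in>F. L2_inner M (g i) u)"
  using L2_integrable_mult[OF assms] unfolding L2_inner_def
  by (simp add: sum_distrib_right)

lemma L2_inner_lincomb_left:
  assumes "\<And>i. i \<in> F \<Longrightarrow> e i \<in> L2 M" "u \<in> L2 M"
  shows "L2_inner M (\<lambda>x. \<Sum>i\<in>F. c i * e i x) u = (\<Sum>i\<in>F. c i * L2_inner M (e i) u)"
  using assms by (subst L2_inner_sum_left) (auto simp: L2_cmult L2_inner_cmult_left)

lemma L2_inner_add_right:
  assumes "f \<in> L2 M" "g \<in> L2 M" "u \<in> L2 M"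
  shows "L2_inner M u (\<lambda>x. f x + g x) = L2_inner M u f + L2_inner M u g"
  by (subst (1 2 3) L2_inner_commute) (simp add: L2_inner_add_left assms)

lemma L2_inner_diff_right:
  assumes "f \<in> L2 M" "g \<in> L2 M" "u \<in> L2 M"
  shows "L2_inner M u (\<lambda>x. f x - g x) = L2_inner M u f - L2_inner M u g"
  by (subst (1 2 3) L2_inner_commute) (simp add: L2_inner_diff_left assms)

lemma L2_inner_lincomb_right:
  assumes "\<And>i. i \<in> F \<Longrightarrow> e i \<in> L2 M" "u \<in> L2 M"
  shows "L2_inner M u (\<lambda>x. \<Sum>i\<in>F. c i * e i x) = (\<Sum>i\<in>F. cnj (c i) * L2_inner M u (e i))"
proof -
  have "L2_inner M u (\<lambda>x. \<Sum>i\<in>F. c i * e i x) = cnj (\<Sum>i\<in>F. c i * L2_inner M (e i) u)"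
    using assms by (subst L2_inner_commute) (simp add: L2_inner_lincomb_left)
  also have "\<dots> = (\<Sum>i\<in>F. cnj (c i) * L2_inner M u (e i))"
    by (simp add: L2_inner_commute[of M u])
  finally show ?thesis .
qed

definition L2_norm :: "'a measure \<Rightarrow> ('a \<Rightarrow> complex) \<Rightarrow> real" where
  "L2_norm M f = sqrt (LINT x|M. (cmod (f x))\<^sup>2)"

lemma L2_dist_norm: "L2_dist M f g = L2_norm M (\<lambda>x. f x - g x)"
  by (simp add: L2_dist_def L2_norm_def)

lemma L2_norm_nonneg [simp]: "0 \<le> L2_norm M f"
  by (simp add: L2_norm_def)

lemma L2_dist_nonneg [simp]: "0 \<le> L2_dist M f g"
  by (simp add: L2_dist_norm)

lemma L2_inner_self: "L2_inner M f f = complex_of_real ((L2_norm M f)\<^sup>2)"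
  by (simp add: L2_inner_def L2_norm_def complex_norm_square[symmetric] flip: of_real_power)

lemma L2_norm_sq: "(L2_norm M f)\<^sup>2 = Re (L2_inner M f f)"
  by (simp add: L2_inner_self)

lemma L2_norm_cmult: "L2_norm M (\<lambda>x. c * f x) = cmod c * L2_norm M f"
  by (simp add: L2_norm_def norm_mult power_mult_distrib real_sqrt_mult)

lemma L2_dist_commute: "L2_dist M f g = L2_dist M g f"
  by (simp add: L2_dist_def norm_minus_commute)

lemma L2_norm_diff_sq:
  assumes "f \<in> L2 M" "g \<in> L2 M"
  shows "(L2_norm M (\<lambda>x. f x - g x))\<^sup>2 = (L2_norm M f)\<^sup>2 - 2 * Re (L2_inner M f g) + (L2_norm M g)\<^sup>2"
  using assms L2_inner_commute[of M g f]
  by (simp add: L2_norm_sq L2_inner_diff_left L2_inner_diff_right L2_diff)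

lemma L2_Cauchy_Schwarz:
  assumes "f \<in> L2 M" "g \<in> L2 M"
  shows "cmod (L2_inner M f g) \<le> L2_norm M f * L2_norm M g"
proof (cases "L2_norm M g = 0")
  case False
  define z where "z = L2_inner M f g"
  define G where "G = L2_norm M g"
  \<comment> \<open>\<open>t * g\<close> is the orthogonal projection of \<open>f\<close> onto the
    line of \<open>g\<close>; that the squared norm of the remainder is nonnegative is the
    inequality.\<close>
  define t where "t = z / complex_of_real (G\<^sup>2)"
  have G: "G > 0" using False L2_norm_nonneg[of M g] unfolding G_def by linarith
  have "0 \<le> (L2_norm M (\<lambda>x. f x - t * g x))\<^sup>2" by simp
  also have "\<dots> = (L2_norm M f)\<^sup>2 - 2 * Re (cnj t * z) + (cmod t)\<^sup>2 * G\<^sup>2"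
    using assms L2_inner_lincomb_right[of "{()}" "\<lambda>_. g" M f "\<lambda>_. t"]
    by (simp add: L2_norm_diff_sq L2_cmult L2_norm_cmult power_mult_distrib z_def G_def)
  also have "cnj t * z = complex_of_real ((cmod z)\<^sup>2 / G\<^sup>2)"
    by (simp add: t_def mult.commute complex_norm_square del: of_real_power)
  also have "(cmod t)\<^sup>2 * G\<^sup>2 = (cmod z)\<^sup>2 / G\<^sup>2"
    using G by (simp add: t_def norm_divide norm_mult power2_eq_square)
  finally have "(cmod z)\<^sup>2 / G\<^sup>2 \<le> (L2_norm M f)\<^sup>2" by simp
  then have "(cmod z)\<^sup>2 \<le> (L2_norm M f * G)\<^sup>2"
    using G by (simp add: field_simps power_mult_distrib)
  then show ?thesis
    using G by (simp add: z_def G_def power2_le_iff_abs_le abs_le_square_iff[symmetric])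
next
  case True
  \<comment> \<open>On representatives the inner product is only semidefinite: norm 0 means that
    \<open>g\<close> vanishes almost everywhere, and so does the integrand.\<close>
  have "integrable M (\<lambda>x. (cmod (g x))\<^sup>2)" using assms by (simp add: L2_def)
  then have "AE x in M. (cmod (g x))\<^sup>2 = 0"
    using True by (subst integral_nonneg_eq_0_iff_AE[symmetric]) (auto simp: L2_norm_def)
  then have "L2_inner M f g = 0"
    unfolding L2_inner_def by (intro integral_eq_zero_AE) auto
  then show ?thesis by simp
qed

lemma L2_norm_triangle:
  assumes "f \<in> L2 M" "g \<in> L2 M"
  shows "L2_norm M (\<lambda>x. f x + g x) \<le> L2_norm M f + L2_norm M g"
proof (rule power2_le_imp_le)
  have "(L2_norm M (\<lambda>x. f x + g x))\<^sup>2 = (L2_norm M f)\<^sup>2 + 2 * Re (L2_inner M f g) + (L2_norm M g)\<^sup>2"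
    using assms L2_inner_commute[of M g f]
    by (simp add: L2_norm_sq L2_inner_add_left L2_inner_add_right L2_add)
  also have "Re (L2_inner M f g) \<le> L2_norm M f * L2_norm M g"
    using L2_Cauchy_Schwarz[OF assms] complex_Re_le_cmod order_trans by blast
  finally show "(L2_norm M (\<lambda>x. f x + g x))\<^sup>2 \<le> (L2_norm M f + L2_norm M g)\<^sup>2"
    by (simp add: power2_sum)
qed simp

lemma L2_dist_triangle:
  assumes "f \<in> L2 M" "g \<in> L2 M" "h \<in> L2 M"
  shows "L2_dist M f h \<le> L2_dist M f g + L2_dist M g h"
  using L2_norm_triangle[OF L2_diff[OF assms(1,2)] L2_diff[OF assms(2,3)]]
  by (simp add: L2_dist_norm)

lemma L2_norm_sum:
  assumes "\<And>i. i \<in> F \<Longrightarrow> g i \<in> L2 M"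
  shows "L2_norm M (\<lambda>x. \<Sum>i\<in>F. g i x) \<le> (\<Sum>i\<in>F. L2_norm M (g i))"
  using assms
proof (induction F rule: infinite_finite_induct)
  case (insert i F)
  have "L2_norm M (\<lambda>x. \<Sum>i\<in>insert i F. g i x) \<le> L2_norm M (g i) + L2_norm M (\<lambda>x. \<Sum>i\<in>F. g i x)"
    using insert by (simp add: L2_norm_triangle L2_sum)
  then show ?case using insert by auto
qed (auto simp: L2_norm_def)

text \<open>By Cauchy-Schwarz the inner product with a fixed \<open>u\<close> is continuous, so it
  passes through the limit along the net of finite partial sums.\<close>

lemma has_L2_sum_inner:
  assumes "has_L2_sum M g I s" "u \<in> L2 M"
  shows "((\<lambda>i. L2_inner M (g i) u) has_sum L2_inner M s u) I"
proof -
  let ?N = "finite_subsets_at_top I"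
  have mem: "\<And>i. i \<in> I \<Longrightarrow> g i \<in> L2 M" and s: "s \<in> L2 M"
    and lim: "((\<lambda>F. L2_dist M (\<lambda>x. \<Sum>i\<in>F. g i x) s) \<longlongrightarrow> 0) ?N"
    using assms by (auto simp: has_L2_sum_def)
  have "eventually (\<lambda>F. norm ((\<Sum>i\<in>F. L2_inner M (g i) u) - L2_inner M s u)
      \<le> L2_dist M (\<lambda>x. \<Sum>i\<in>F. g i x) s * L2_norm M u) ?N"
  proof (rule eventually_finite_subsets_at_top_weakI)
    fix F assume F: "finite F" "F \<subseteq> I"
    have "(\<Sum>i\<in>F. L2_inner M (g i) u) - L2_inner M s u = L2_inner M (\<lambda>x. (\<Sum>i\<in>F. g i x) - s x) u"
      using F mem s assms(2) by (subst L2_inner_diff_left) (auto simp: L2_inner_sum_left L2_sum subset_iff)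
    then show "norm ((\<Sum>i\<in>F. L2_inner M (g i) u) - L2_inner M s u)
        \<le> L2_dist M (\<lambda>x. \<Sum>i\<in>F. g i x) s * L2_norm M u"
      using F mem s assms(2)
      by (auto simp: L2_dist_norm subset_iff intro!: L2_Cauchy_Schwarz L2_diff L2_sum)
  qed
  moreover have "((\<lambda>F. L2_dist M (\<lambda>x. \<Sum>i\<in>F. g i x) s * L2_norm M u) \<longlongrightarrow> 0) ?N"
    using tendsto_mult_right[OF lim, of "L2_norm M u"] by simp
  ultimately have "((\<lambda>F. (\<Sum>i\<in>F. L2_inner M (g i) u) - L2_inner M s u) \<longlongrightarrow> 0) ?N"
    by (rule Lim_null_comparison)
  then show ?thesis
    by (simp add: has_sum_def LIM_zero_cancel)
qed

text \<open>The constant \<open>\<kappa>\<close> accommodates the exponentials, which are not normalized.\<close>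

lemma has_L2_sum_coeff:
  assumes sum: "has_L2_sum M (\<lambda>i x. c i * e i x) I s" and u: "u \<in> L2 M"
    and orth: "\<And>i. i \<in> I \<Longrightarrow> L2_inner M (e i) u = (if i = j then \<kappa> else 0)"
  shows "L2_inner M s u = (if j \<in> I then \<kappa> * c j else 0)"
proof -
  have "((\<lambda>i. c i * L2_inner M (e i) u) has_sum L2_inner M s u) I"
    using has_L2_sum_inner[OF sum u] by (simp add: L2_inner_cmult_left)
  moreover have "((\<lambda>i. c i * L2_inner M (e i) u) has_sum (if j \<in> I then \<kappa> * c j else 0)) I"
  proof (rule has_sum_finite_neutralI[of "I \<inter> {j}"])
    show "c x * L2_inner M (e x) u = 0" if "x \<in> I - I \<inter> {j}" for x
      using that orth by auto
    show "(if j \<in> I then \<kappa> * c j else 0) = (\<Sum>x\<in>I \<inter> {j}. c x * L2_inner M (e x) u)"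
      using orth by auto
  qed auto
  ultimately show ?thesis by (rule has_sum_unique)
qed

section \<open>Closed subspaces and finite spans\<close>

lemma L2_closed_subspaceD:
  assumes "L2_closed_subspace M V"
  shows "V \<subseteq> L2 M" "(\<lambda>x. 0) \<in> V" "\<And>f g. f \<in> V \<Longrightarrow> g \<in> V \<Longrightarrow> (\<lambda>x. f x + g x) \<in> V"
    "\<And>c f. f \<in> V \<Longrightarrow> (\<lambda>x. c * f x) \<in> V"
    "\<And>u f. f \<in> L2 M \<Longrightarrow> (\<And>n::nat. u n \<in> V) \<Longrightarrow> (\<lambda>n. L2_dist M (u n) f) \<longlonglongrightarrow> 0 \<Longrightarrow> f \<in> V"
  using assms unfolding L2_closed_subspace_def by blast+

lemma L2_closed_subspace_lincomb:
  assumes "L2_closed_subspace M V" "\<And>i. i \<in> F \<Longrightarrow> e i \<in> V"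
  shows "(\<lambda>x. \<Sum>i\<in>F. c i * e i x) \<in> V"
  using assms(2)
proof (induction F rule: infinite_finite_induct)
  case (insert i F)
  then show ?case
    using L2_closed_subspaceD(3,4)[OF assms(1)] by simp
qed (simp_all add: L2_closed_subspaceD(2)[OF assms(1)])

text \<open>Closedness is defined by sequences; picking approximants with error below
  \<open>1 / Suc n\<close> turns it into an epsilon criterion, which also suits limits of
  nets.\<close>

lemma L2_closed_subspace_approx:
  assumes V: "L2_closed_subspace M V" and f: "f \<in> L2 M"
    and approx: "\<And>\<epsilon>. \<epsilon> > 0 \<Longrightarrow> \<exists>g\<in>V. L2_dist M f g < \<epsilon>"
  shows "f \<in> V"
proof -
  have "\<exists>u. \<forall>n::nat. u n \<in> V \<and> L2_dist M f (u n) < 1 / real (Suc n)"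
    using approx by (intro choice allI) (auto simp: Bex_def)
  then obtain u where u: "\<And>n. u n \<in> V" "\<And>n. L2_dist M (u n) f < 1 / real (Suc n)"
    by (auto simp: L2_dist_commute)
  have "(\<lambda>n. L2_dist M (u n) f) \<longlonglongrightarrow> 0"
  proof (rule Lim_null_comparison)
    show "eventually (\<lambda>n. norm (L2_dist M (u n) f) \<le> inverse (real (Suc n))) sequentially"
      using u(2) by (auto intro!: always_eventually less_imp_le simp: inverse_eq_divide)
  qed (rule LIMSEQ_inverse_real_of_nat)
  then show ?thesis using L2_closed_subspaceD(5)[OF V f] u by blast
qed

lemma L2_spanI: "finite F \<Longrightarrow> F \<subseteq> I \<Longrightarrow> (\<lambda>x. \<Sum>i\<in>F. c i * e i x) \<in> L2_span e I"
  unfolding L2_span_def by blast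

lemma L2_span_lincomb:
  assumes "finite G" "\<And>i. i \<in> G \<Longrightarrow> u i \<in> L2_span e I"
  shows "(\<lambda>x. \<Sum>i\<in>G. b i * u i x) \<in> L2_span e I"
  using assms
proof (induction G)
  case empty
  show ?case by (auto simp: L2_span_def intro!: exI[of _ "{}"])
next
  case (insert i G)
  from insert obtain F c where F: "finite F" "F \<subseteq> I" and eq: "(\<lambda>x. \<Sum>i\<in>G. b i * u i x) = (\<lambda>x. \<Sum>i\<in>F. c i * e i x)"
    by (auto simp: L2_span_def)
  from insert.prems[of i] obtain F' c' where F': "finite F'" "F' \<subseteq> I" and eq': "u i = (\<lambda>x. \<Sum>i\<in>F'. c' i * e i x)"
    by (auto simp: L2_span_def)
  \<comment> \<open>\<open>c\<close> and \<open>c'\<close> are arbitrary off \<open>F\<close> and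
    \<open>F'\<close>, so both are cut off by 0 before they are added on the union.\<close>
  define d where "d k = b i * (if k \<in> F' then c' k else 0) + (if k \<in> F then c k else 0)" for k
  have "(\<Sum>k\<in>F \<union> F'. d k * e k x) = b i * u i x + (\<Sum>i\<in>G. b i * u i x)" for x
  proof -
    have "(\<Sum>k\<in>F \<union> F'. (if k \<in> F' then c' k else 0) * e k x) = (\<Sum>k\<in>F'. c' k * e k x)"
      "(\<Sum>k\<in>F \<union> F'. (if k \<in> F then c k else 0) * e k x) = (\<Sum>k\<in>F. c k * e k x)"
      using F F' by (auto intro!: sum.mono_neutral_cong_right)
    then show ?thesis
      using fun_cong[OF eq, of x] fun_cong[OF eq', of x]
      by (simp add: d_def distrib_right sum.distrib mult.assoc flip: sum_distrib_left)
  qed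
  then have "(\<lambda>x. \<Sum>j\<in>insert i G. b j * u j x) = (\<lambda>x. \<Sum>k\<in>F \<union> F'. d k * e k x)"
    using insert.hyps by auto
  then show ?case
    using F F' unfolding L2_span_def by blast
qed

lemma L2_span_mono: "I \<subseteq> J \<Longrightarrow> L2_span e I \<subseteq> L2_span e J"
  by (auto simp: L2_span_def)

lemma L2_span_subset:
  assumes "L2_closed_subspace M V" "\<And>i. i \<in> I \<Longrightarrow> e i \<in> V"
  shows "L2_span e I \<subseteq> V"
proof
  fix u assume "u \<in> L2_span e I"
  then obtain F c where "F \<subseteq> I" "u = (\<lambda>x. \<Sum>i\<in>F. c i * e i x)"
    by (auto simp: L2_span_def)
  then show "u \<in> V"
    using L2_closed_subspace_lincomb[OF assms(1), of F e c] assms(2) by auto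
qed

text \<open>Serves to pass from one basis to another. An element of \<open>V\<close> is nearly a
  finite combination of the \<open>e i\<close>, and replacing each generator by an approximation
  costs at most the sum of the \<open>cmod (c i)\<close> times the common error.\<close>

lemma L2_dense_span_trans:
  assumes dense: "L2_dense M (L2_span e I) V" and V: "L2_closed_subspace M V"
    and g: "\<And>i. i \<in> J \<Longrightarrow> g i \<in> V"
    and e: "\<And>i. i \<in> I \<Longrightarrow> e i \<in> V"
    and approx: "\<And>i \<epsilon>. i \<in> I \<Longrightarrow> \<epsilon> > 0 \<Longrightarrow> \<exists>u\<in>L2_span g J. L2_dist M (e i) u < \<epsilon>"
  shows "L2_dense M (L2_span g J) V"
  unfolding L2_dense_def
proof (intro conjI ballI allI impI)
  show sub: "L2_span g J \<subseteq> V" by (rule L2_span_subset[OF V g])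
  note VL = L2_closed_subspaceD(1)[OF V]
  fix f and \<epsilon> :: real assume f: "f \<in> V" and \<epsilon>: "\<epsilon> > 0"
  from dense f \<epsilon> have "\<exists>u\<in>L2_span e I. L2_dist M f u < \<epsilon> / 2"
    unfolding L2_dense_def by (meson half_gt_zero)
  then obtain F c where F: "finite F" "F \<subseteq> I"
    and d1: "L2_dist M f (\<lambda>x. \<Sum>i\<in>F. c i * e i x) < \<epsilon> / 2"
    by (auto simp: L2_span_def)
  \<comment> \<open>Half of the tolerance is spent on the first approximation; the summand 1 keeps
    the denominator positive when all coefficients vanish.\<close>
  define \<delta> where "\<delta> = \<epsilon> / (2 * (1 + (\<Sum>i\<in>F. cmod (c i))))"
  have S: "0 \<le> (\<Sum>i\<in>F. cmod (c i))" by (simp add: sum_nonneg)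
  then have \<delta>: "\<delta> > 0" using \<epsilon> by (simp add: \<delta>_def)
  have "\<forall>i\<in>F. \<exists>u. u \<in> L2_span g J \<and> L2_dist M (e i) u < \<delta>"
    using approx[OF _ \<delta>] F by blast
  from bchoice[OF this] obtain u where u: "\<And>i. i \<in> F \<Longrightarrow> u i \<in> L2_span g J" "\<And>i. i \<in> F \<Longrightarrow> L2_dist M (e i) (u i) < \<delta>"
    by blast
  have uL: "\<And>i. i \<in> F \<Longrightarrow> u i \<in> L2 M" and eL: "\<And>i. i \<in> F \<Longrightarrow> e i \<in> L2 M"
    using u(1) sub VL e F by blast+
  have "L2_dist M (\<lambda>x. \<Sum>i\<in>F. c i * e i x) (\<lambda>x. \<Sum>i\<in>F. c i * u i x)
      = L2_norm M (\<lambda>x. \<Sum>i\<in>F. c i * (e i x - u i x))"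
    by (simp add: L2_dist_norm right_diff_distrib sum_subtractf)
  also have "\<dots> \<le> (\<Sum>i\<in>F. cmod (c i) * L2_dist M (e i) (u i))"
    using L2_norm_sum[of F "\<lambda>i x. c i * (e i x - u i x)" M] uL eL
    by (simp add: L2_norm_cmult L2_dist_norm L2_cmult L2_diff)
  also have "\<dots> \<le> (\<Sum>i\<in>F. cmod (c i) * \<delta>)"
    by (intro sum_mono mult_left_mono) (use u(2) less_imp_le in auto)
  also have "\<dots> = (\<Sum>i\<in>F. cmod (c i)) * \<delta>" by (simp add: sum_distrib_right)
  also have "\<dots> \<le> (1 + (\<Sum>i\<in>F. cmod (c i))) * \<delta>" using \<delta> by (simp add: mult_right_mono)
  also have "\<dots> = \<epsilon> / 2" using S by (simp add: \<delta>_def add_nonneg_eq_0_iff divide_simps)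
  finally have d2: "L2_dist M (\<lambda>x. \<Sum>i\<in>F. c i * e i x) (\<lambda>x. \<Sum>i\<in>F. c i * u i x) \<le> \<epsilon> / 2" .
  have "L2_dist M f (\<lambda>x. \<Sum>i\<in>F. c i * u i x) < \<epsilon>"
    using L2_dist_triangle[of f M, OF _ L2_lincomb L2_lincomb, of F e F u c c] d1 d2 f VL uL eL
    by (fastforce simp: subset_iff)
  then show "\<exists>u\<in>L2_span g J. L2_dist M f u < \<epsilon>"
    using L2_span_lincomb[of F u g J c] F(1) u(1) by blast
qed

text \<open>Pythagoras, used in both directions: nonnegativity of the left side gives Bessel's
  inequality, and energies close to the full squared norm give approximation by the span. The
  conjugates appear because the energies are later computed with the orthonormal system in the first
  argument.\<close>

lemma orthonormal_projection_dist:
  assumes F: "finite F" and g: "\<And>i. i \<in> F \<Longrightarrow> g i \<in> L2 M" and u: "u \<in> L2 M"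
    and orth: "\<And>i j. i \<in> F \<Longrightarrow> j \<in> F \<Longrightarrow> L2_inner M (g i) (g j) = (if i = j then 1 else 0)"
  shows "(L2_dist M u (\<lambda>x. \<Sum>i\<in>F. cnj (L2_inner M (g i) u) * g i x))\<^sup>2
    = (L2_norm M u)\<^sup>2 - (\<Sum>i\<in>F. (cmod (L2_inner M (g i) u))\<^sup>2)"
proof -
  define p where "p = (\<lambda>x. \<Sum>i\<in>F. cnj (L2_inner M (g i) u) * g i x)"
  define S where "S = (\<Sum>i\<in>F. (cmod (L2_inner M (g i) u))\<^sup>2)"
  have p: "p \<in> L2 M" unfolding p_def by (intro L2_lincomb g)
  have pu: "L2_inner M p u = complex_of_real S"
    unfolding p_def S_def using g u
    by (subst L2_inner_lincomb_left) (auto simp: complex_norm_square mult.commute simp del: of_real_power)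
  have gp: "L2_inner M (g i) p = L2_inner M (g i) u" if "i \<in> F" for i
    unfolding p_def using that F g orth by (simp add: L2_inner_lincomb_right if_distrib[of "(*) _"] cong: if_cong)
  have pp: "L2_inner M p p = complex_of_real S"
  proof -
    have "L2_inner M p p = (\<Sum>i\<in>F. cnj (L2_inner M (g i) u) * L2_inner M (g i) p)"
      by (subst (1) p_def) (use g p in \<open>simp add: L2_inner_lincomb_left\<close>)
    also have "\<dots> = (\<Sum>i\<in>F. cnj (L2_inner M (g i) u) * L2_inner M (g i) u)"
      using gp by simp
    also have "\<dots> = L2_inner M p u" unfolding p_def using g u by (simp add: L2_inner_lincomb_left)
    finally show ?thesis using pu by simp
  qed
  have "(L2_dist M u p)\<^sup>2 = (L2_norm M u)\<^sup>2 - S"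
    using L2_norm_diff_sq[OF u p] pu pp L2_inner_commute[of M u p]
    by (simp add: L2_dist_norm L2_norm_sq)
  then show ?thesis by (simp add: p_def S_def)
qed

lemma Bessel_finite:
  assumes "finite F" "\<And>i. i \<in> F \<Longrightarrow> g i \<in> L2 M" "u \<in> L2 M"
    "\<And>i j. i \<in> F \<Longrightarrow> j \<in> F \<Longrightarrow> L2_inner M (g i) (g j) = (if i = j then 1 else 0)"
  shows "(\<Sum>i\<in>F. (cmod (L2_inner M (g i) u))\<^sup>2) \<le> (L2_norm M u)\<^sup>2"
proof -
  have "0 \<le> (L2_norm M u)\<^sup>2 - (\<Sum>i\<in>F. (cmod (L2_inner M (g i) u))\<^sup>2)"
    by (subst orthonormal_projection_dist[OF assms, symmetric]) auto
  then show ?thesis by simp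
qed


section \<open>Linear change of variables and tilings\<close>

lemma measure_shear_cbox:
  fixes a b :: "real ^ 'd"
  assumes "m \<noteq> n"
  defines "h \<equiv> \<lambda>x::real^'d. \<chi> i. if i = m then x $ m + x $ n else x $ i"
  shows "measure lebesgue (h ` cbox a b) = measure lebesgue (cbox a b)"
proof (cases "cbox a b = {}")
  case False
  \<comment> \<open>Moves the lower bound in coordinate \<open>n\<close> to 0, where
    \<open>measure_shear_interval\<close> applies; by linearity of \<open>h\<close> the image only
    moves by \<open>h w\<close>.\<close>
  define w :: "real ^ 'd" where "w = (\<chi> i. if i = n then - a $ n else 0)"
  have box: "cbox (w + a) (w + b) = (+) w ` cbox a b"
    by (rule cbox_translation)
  have "h ` cbox (w + a) (w + b) = (+) (h w) ` (h ` cbox a b)"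
    unfolding box image_image h_def by (intro image_cong refl) (auto simp: vec_eq_iff)
  then have "measure lebesgue (h ` cbox a b) = measure lebesgue (h ` cbox (w + a) (w + b))"
    by (simp only: measure_translation)
  also have "\<dots> = measure lebesgue (cbox (w + a) (w + b))"
    unfolding h_def
  proof (rule measure_shear_interval)
    show "cbox (w + a) (w + b) \<noteq> {}" using False by (simp add: box)
  qed (use assms in \<open>auto simp: w_def\<close>)
  also have "\<dots> = measure lebesgue (cbox a b)"
    unfolding box by (rule measure_translation)
  finally show ?thesis .
qed simp

lemma det_matrix_shear:
  fixes m n :: "'d::finite"
  assumes "m \<noteq> n"
  shows "det (matrix (\<lambda>x::real^'d. \<chi> i. if i = m then x $ m + x $ n else x $ i)) = 1"
proof -
  have "matrix (\<lambda>x::real^'d. \<chi> i. if i = m then x $ m + x $ n else x $ i)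
      = (\<chi> k. if k = m then row m (mat 1) + 1 *s row n (mat 1) else row k (mat 1))"
    by (auto simp: matrix_def vec_eq_iff row_def mat_def axis_def)
  then show ?thesis
    by (simp only: det_row_operation[OF assms] det_I)
qed

lemma measure_swap_cbox:
  fixes a b :: "real ^ 'd" and m n :: 'd
  defines "h \<equiv> \<lambda>x::real^'d. \<chi> i. x $ Transposition.transpose m n i"
  shows "measure lebesgue (h ` cbox a b) = measure lebesgue (cbox a b)"
proof (cases "cbox a b = {}")
  case False
  have hh: "h (h x) = x" for x by (simp add: h_def vec_eq_iff)
  have "h ` cbox a b = cbox (h a) (h b)"
  proof (intro set_eqI iffI)
    show "x \<in> cbox (h a) (h b)" if "x \<in> h ` cbox a b" for x
      using that by (auto simp: mem_box_cart h_def)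
    show "x \<in> h ` cbox a b" if "x \<in> cbox (h a) (h b)" for x
    proof
      show "x = h (h x)" by (simp add: hh)
      show "h x \<in> cbox a b"
        unfolding mem_box_cart
      proof
        fix i
        show "a $ i \<le> h x $ i \<and> h x $ i \<le> b $ i"
          using that[unfolded mem_box_cart, rule_format, of "Transposition.transpose m n i"]
          by (simp add: h_def)
      qed
    qed
  qed
  moreover have "cbox (h a) (h b) \<noteq> {}" using False calculation by auto
  moreover have "(\<Prod>i\<in>UNIV. h b $ i - h a $ i) = (\<Prod>i\<in>UNIV. b $ i - a $ i)"
    unfolding h_def
    using prod.permute[OF permutes_swap_id[of m UNIV n], of "\<lambda>i. b $ i - a $ i"] by (simp add: o_def)
  ultimately show ?thesis
    using False by (simp add: content_cbox_cart)
qed simp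

lemma abs_det_matrix_swap:
  fixes m n :: "'d::finite"
  shows "\<bar>det (matrix (\<lambda>x::real^'d. \<chi> i. x $ Transposition.transpose m n i))\<bar> = 1"
proof -
  have "matrix (\<lambda>x::real^'d. \<chi> i. x $ Transposition.transpose m n i)
      = (\<chi> i. (mat 1 :: real^'d^'d) $ Transposition.transpose m n i)"
    by (auto simp: matrix_def vec_eq_iff mat_def axis_def)
  then show ?thesis
    by (simp add: det_permute_rows permutes_swap_id sign_swap_id abs_mult)
qed

text \<open>The library states this for a well-ordered index type only.\<close>

lemma measure_linear_image_cart:
  fixes f :: "real ^ 'd \<Rightarrow> real ^ 'd"
  assumes "linear f" "S \<in> lmeasurable"
  shows "f ` S \<in> lmeasurable \<and> measure lebesgue (f ` S) = \<bar>det (matrix f)\<bar> * measure lebesgue S"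
proof -
  have "\<forall>S \<in> lmeasurable. f ` S \<in> lmeasurable \<and> measure lebesgue (f ` S) = \<bar>det (matrix f)\<bar> * measure lebesgue S"
    using assms(1)
  proof (rule induct_linear_elementary; intro ballI)
    fix f g :: "real ^ 'd \<Rightarrow> real ^ 'd" and S :: "(real ^ 'd) set"
    assume lin: "linear f" "linear g" and S: "S \<in> lmeasurable"
      and f: "\<forall>S \<in> lmeasurable. f ` S \<in> lmeasurable \<and> measure lebesgue (f ` S) = \<bar>det (matrix f)\<bar> * measure lebesgue S"
      and g: "\<forall>S \<in> lmeasurable. g ` S \<in> lmeasurable \<and> measure lebesgue (g ` S) = \<bar>det (matrix g)\<bar> * measure lebesgue S"
    have "(f \<circ> g) ` S = f ` (g ` S)" by auto
    then show "(f \<circ> g) ` S \<in> lmeasurable \<and>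
        measure lebesgue ((f \<circ> g) ` S) = \<bar>det (matrix (f \<circ> g))\<bar> * measure lebesgue S"
      using f g S by (simp add: matrix_compose lin det_mul abs_mult)
  next
    fix f :: "real ^ 'd \<Rightarrow> real ^ 'd" and i and S :: "(real ^ 'd) set"
    assume lin: "linear f" and 0: "\<And>x. f x $ i = 0"
    \<comment> \<open>A coordinate that is always 0 makes \<open>f\<close> miss this axis vector.
      Thus \<open>f\<close> is singular, and both sides of the volume formula are 0.\<close>
    have "axis i 1 \<notin> range f" 
    proof
      assume "axis i 1 \<in> range f"
      then obtain x where "axis i 1 = f x" by auto
      then have "axis i (1::real) $ i = 0" using 0[of x] by simp
      then show False by simp
    qed
    then have "\<not> inj f" using lin linear_injective_imp_surjective by blast
    moreover have "negligible (f ` S)" using negligible_linear_singular_image[OF lin \<open>\<not> inj f\<close>] .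
    ultimately show "f ` S \<in> lmeasurable \<and> measure lebesgue (f ` S) = \<bar>det (matrix f)\<bar> * measure lebesgue S"
      using det_nz_iff_inj[OF lin] by (simp add: negligible_iff_measure)
  next
    fix c :: "'d \<Rightarrow> real" and S :: "(real ^ 'd) set"
    assume "S \<in> lmeasurable"
    moreover have "det (matrix (\<lambda>x. \<chi> i. c i * x $ i)) = prod c UNIV"
      by (subst det_diagonal) (auto simp: matrix_def axis_def)
    ultimately show "(\<lambda>x. \<chi> i. c i * x $ i) ` S \<in> lmeasurable \<and>
        measure lebesgue ((\<lambda>x. \<chi> i. c i * x $ i) ` S) = \<bar>det (matrix (\<lambda>x. \<chi> i. c i * x $ i))\<bar> * measure lebesgue S"
      by (simp add: measurable_stretch measure_stretch)
  next
    fix m n :: 'd and S :: "(real ^ 'd) set"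
    assume "S \<in> lmeasurable"
    moreover have "linear (\<lambda>x::real^'d. \<chi> i. x $ Transposition.transpose m n i)"
      by (rule linearI) (simp_all add: vec_eq_iff)
    ultimately show "(\<lambda>x. \<chi> i. x $ Transposition.transpose m n i) ` S \<in> lmeasurable \<and>
        measure lebesgue ((\<lambda>x. \<chi> i. x $ Transposition.transpose m n i) ` S)
        = \<bar>det (matrix (\<lambda>x::real^'d. \<chi> i. x $ Transposition.transpose m n i))\<bar> * measure lebesgue S"
      using measure_linear_sufficient[of "\<lambda>x::real^'d. \<chi> i. x $ Transposition.transpose m n i" S 1]
      by (simp add: abs_det_matrix_swap measure_swap_cbox)
  next
    fix m n :: 'd and S :: "(real ^ 'd) set"
    assume "m \<noteq> n" "S \<in> lmeasurable"
    moreover have "linear (\<lambda>x::real^'d. \<chi> i. if i = m then x $ m + x $ n else x $ i)"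
      by (rule linearI) (simp_all add: vec_eq_iff distrib_left)
    ultimately show "(\<lambda>x. \<chi> i. if i = m then x $ m + x $ n else x $ i) ` S \<in> lmeasurable \<and>
        measure lebesgue ((\<lambda>x. \<chi> i. if i = m then x $ m + x $ n else x $ i) ` S)
        = \<bar>det (matrix (\<lambda>x::real^'d. \<chi> i. if i = m then x $ m + x $ n else x $ i))\<bar> * measure lebesgue S"
      using measure_linear_sufficient[of "\<lambda>x::real^'d. \<chi> i. if i = m then x $ m + x $ n else x $ i" S 1]
      by (simp add: det_matrix_shear measure_shear_cbox)
  qed
  then show ?thesis using assms(2) by blast
qed

lemma matrix_inv_left_right:
  assumes "det (A :: real ^ 'd ^ 'd) \<noteq> 0"
  shows "A ** matrix_inv A = mat 1" "matrix_inv A ** A = mat 1"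
proof -
  have "\<exists>A'. A ** A' = mat 1 \<and> A' ** A = mat 1"
    using assms by (simp add: invertible_det_nz flip: invertible_def)
  from someI_ex[OF this] show "A ** matrix_inv A = mat 1" "matrix_inv A ** A = mat 1"
    by (simp_all add: matrix_inv_def)
qed

lemma matrix_inv_vec:
  fixes A :: "real ^ 'd ^ 'd"
  assumes "det A \<noteq> 0"
  shows "A *v (matrix_inv A *v x) = x" "matrix_inv A *v (A *v x) = x"
  using assms by (simp_all add: matrix_vector_mul_assoc matrix_inv_left_right)

lemma det_matrix_inv:
  fixes A :: "real ^ 'd ^ 'd"
  assumes "det A \<noteq> 0"
  shows "det (matrix_inv A) = inverse (det A)"
proof -
  have "det A * det (matrix_inv A) = 1"
    using assms by (simp add: matrix_inv_left_right flip: det_mul)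
  then show ?thesis using assms by (simp add: field_simps)
qed

lemma borel_measurable_matrix_vector_mult [measurable (raw)]:
  fixes A :: "real ^ 'd ^ 'd"
  assumes "f \<in> borel_measurable M"
  shows "(\<lambda>x. A *v f x) \<in> borel_measurable M"
  by (rule borel_measurable_continuous_on[OF _ assms])
     (simp add: linear_continuous_on matrix_vector_mul_linear linear_linear)

text \<open>Lebesgue measure is determined on boxes. The preimage of a box under \<open>A\<close> is
  its image under the inverse matrix, whose volume is smaller by the factor
  \<open>\<bar>det A\<bar>\<close>, and the density restores this factor.\<close>

lemma lborel_eq_density_distr_matrix:
  fixes A :: "real ^ 'd ^ 'd"
  assumes "det A \<noteq> 0"
  shows "lborel = density (distr lborel borel (\<lambda>x. A *v x)) (\<lambda>_. ennreal \<bar>det A\<bar>)"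
proof (rule lborel_eqI)
  fix l u :: "real ^ 'd"
  assume "\<And>b. b \<in> Basis \<Longrightarrow> l \<bullet> b \<le> u \<bullet> b"
  then have vol: "emeasure lborel (box l u) = ennreal (\<Prod>b\<in>Basis. (u - l) \<bullet> b)"
    by (simp add: emeasure_lborel_box_eq)
  have meas: "(\<lambda>x. A *v x) \<in> borel_measurable borel" by measurable
  have pre: "(\<lambda>x. A *v x) -` box l u = (\<lambda>x. matrix_inv A *v x) ` box l u"
  proof (intro set_eqI iffI)
    fix x assume "x \<in> (\<lambda>x. A *v x) -` box l u"
    then show "x \<in> (\<lambda>x. matrix_inv A *v x) ` box l u"
      using matrix_inv_vec(2)[OF assms, of x] by (intro image_eqI[of _ _ "A *v x"]) auto
  qed (auto simp: matrix_inv_vec[OF assms])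
  have im: "(\<lambda>x. matrix_inv A *v x) ` box l u \<in> lmeasurable"
    "measure lebesgue ((\<lambda>x. matrix_inv A *v x) ` box l u) = \<bar>inverse (det A)\<bar> * measure lebesgue (box l u)"
    using measure_linear_image_cart[of "\<lambda>x. matrix_inv A *v x" "box l u"]
    by (simp_all add: matrix_vector_mul_linear det_matrix_inv assms)
  have borel: "(\<lambda>x. matrix_inv A *v x) ` box l u \<in> sets borel"
    unfolding pre[symmetric] using measurable_sets[OF meas, of "box l u"] by simp
  have "emeasure lborel ((\<lambda>x. matrix_inv A *v x) ` box l u)
      = ennreal (\<bar>inverse (det A)\<bar> * measure lebesgue (box l u))"
    using im borel emeasure_eq_measure2[OF im(1)] by simp
  moreover have "emeasure lborel (box l u) = ennreal (measure lebesgue (box l u))"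
    using emeasure_eq_measure2[of "box l u" lebesgue] by simp
  ultimately have "ennreal \<bar>det A\<bar> * emeasure lborel ((\<lambda>x. matrix_inv A *v x) ` box l u) = emeasure lborel (box l u)"
    using assms by (simp add: ennreal_mult[symmetric] abs_mult[symmetric] flip: mult.assoc)
  moreover have "emeasure (density (distr lborel borel (\<lambda>x. A *v x)) (\<lambda>_. ennreal \<bar>det A\<bar>)) (box l u)
      = ennreal \<bar>det A\<bar> * emeasure lborel ((\<lambda>x. matrix_inv A *v x) ` box l u)"
    using meas by (subst emeasure_density) (simp_all add: nn_integral_cmult emeasure_distr pre)
  ultimately show "emeasure (density (distr lborel borel (\<lambda>x. A *v x)) (\<lambda>_. ennreal \<bar>det A\<bar>)) (box l u)
      = ennreal (\<Prod>b\<in>Basis. (u - l) \<bullet> b)"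
    using vol by simp
qed simp

lemma nn_integral_lborel_matrix:
  fixes A :: "real ^ 'd ^ 'd"
  assumes "det A \<noteq> 0" and [measurable]: "g \<in> borel_measurable borel"
  shows "(\<integral>\<^sup>+x. g x \<partial>lborel) = ennreal \<bar>det A\<bar> * (\<integral>\<^sup>+x. g (A *v x) \<partial>lborel)"
  by (subst lborel_eq_density_distr_matrix[OF assms(1)])
     (simp add: nn_integral_density nn_integral_distr nn_integral_cmult)

lemma integral_lborel_matrix:
  fixes A :: "real ^ 'd ^ 'd" and g :: "real ^ 'd \<Rightarrow> 'b::{banach, second_countable_topology}"
  assumes "det A \<noteq> 0" and [measurable]: "g \<in> borel_measurable borel"
  shows "(LINT x|lborel. g x) = \<bar>det A\<bar> *\<^sub>R (LINT x|lborel. g (A *v x))"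
  by (subst lborel_eq_density_distr_matrix[OF assms(1)])
     (simp add: integral_density integral_distr)

lemma integrable_lborel_matrix_iff:
  fixes A :: "real ^ 'd ^ 'd" and g :: "real ^ 'd \<Rightarrow> 'b::{banach, second_countable_topology}"
  assumes "det A \<noteq> 0" and [measurable]: "g \<in> borel_measurable borel"
  shows "integrable lborel (\<lambda>x. g (A *v x)) \<longleftrightarrow> integrable lborel g"
proof -
  have "integrable lborel (\<lambda>x. \<bar>det A\<bar> *\<^sub>R g (A *v x)) \<longleftrightarrow> integrable lborel (\<lambda>x. g (A *v x))"
    using assms(1) integrable_scaleR_right[of "1 / \<bar>det A\<bar>" lborel "\<lambda>x. \<bar>det A\<bar> *\<^sub>R g (A *v x)"]
    by auto
  then show ?thesis
    by (subst (2) lborel_eq_density_distr_matrix[OF assms(1)])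
       (simp add: integrable_density integrable_distr_eq)
qed

lemma nn_integral_lborel_translation:
  fixes g :: "'a::euclidean_space \<Rightarrow> ennreal"
  assumes [measurable]: "g \<in> borel_measurable borel"
  shows "(\<integral>\<^sup>+x. g (x + c) \<partial>lborel) = (\<integral>\<^sup>+x. g x \<partial>lborel)"
  by (subst (2) lborel_distr_plus[of c, symmetric]) (simp add: nn_integral_distr add.commute)

lemma integral_lborel_translation:
  fixes g :: "'a::euclidean_space \<Rightarrow> 'b::{banach, second_countable_topology}"
  assumes [measurable]: "g \<in> borel_measurable borel"
  shows "(LINT x|lborel. g (x + c)) = (LINT x|lborel. g x)"
  by (subst (2) lborel_distr_plus[of c, symmetric]) (simp add: integral_distr add.commute)

lemma integrable_lborel_translation:
  fixes g :: "'a::euclidean_space \<Rightarrow> 'b::{banach, second_countable_topology}"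
  assumes [measurable]: "g \<in> borel_measurable borel" and "integrable lborel g"
  shows "integrable lborel (\<lambda>x. g (x + c))"
  using assms(2) by (subst (asm) lborel_distr_plus[of c, symmetric]) (simp add: integrable_distr_eq add.commute)

section \<open>Tilings by countably many translates\<close>

lemma nn_integral_count_space_indicator_unique:
  fixes c :: ennreal
  assumes "\<exists>!k. k \<in> \<Lambda> \<and> P k"
  shows "(\<integral>\<^sup>+k. c * indicator {k. P k} k \<partial>count_space \<Lambda>) = c"
proof -
  from assms obtain k0 where mem: "k0 \<in> \<Lambda> \<and> P k0" and uniq: "\<forall>k. k \<in> \<Lambda> \<and> P k \<longrightarrow> k = k0"
    by (rule ex1E)
  from mem have k0: "k0 \<in> \<Lambda>" "P k0" by simp_all
  have "(\<integral>\<^sup>+k. c * indicator {k. P k} k \<partial>count_space \<Lambda>) = (\<Sum>k\<in>{k0}. c * indicator {k. P k} k)"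
  proof (rule nn_integral_count_space')
    fix k assume "k \<in> \<Lambda>" "k \<notin> {k0}"
    with uniq[rule_format, of k] have "\<not> P k" by auto
    then show "c * indicator {k. P k} k = 0" by simp
  qed (use k0 in simp_all)
  then show ?thesis using k0 by simp
qed

text \<open>Insert the tile indicators, which add up to 1 at every point, exchange sum and integral,
  and translate each tile back to \<open>Q\<close>. Nonnegative integrands make the exchange
  unconditional.\<close>

lemma nn_integral_tiling:
  fixes Q :: "'a::euclidean_space set" and g :: "'a \<Rightarrow> ennreal"
  assumes \<Lambda>: "countable \<Lambda>" and Q[measurable]: "Q \<in> sets borel"
    and tile: "\<And>x. \<exists>!k. k \<in> \<Lambda> \<and> x - k \<in> Q"
    and g[measurable]: "g \<in> borel_measurable borel"
  shows "(\<integral>\<^sup>+x. g x \<partial>lborel) = (\<integral>\<^sup>+x. (\<integral>\<^sup>+k. g (x + k) \<partial>count_space \<Lambda>) * indicator Q x \<partial>lborel)"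
proof -
  have "(\<integral>\<^sup>+x. g x \<partial>lborel) = (\<integral>\<^sup>+x. (\<integral>\<^sup>+k. g x * indicator {k. x - k \<in> Q} k \<partial>count_space \<Lambda>) \<partial>lborel)"
    by (simp only: nn_integral_count_space_indicator_unique[OF tile])
  also have "\<dots> = (\<integral>\<^sup>+x. (\<integral>\<^sup>+k. g x * indicator Q (x - k) \<partial>count_space \<Lambda>) \<partial>lborel)"
    by (intro nn_integral_cong) (auto simp: indicator_def)
  also have "\<dots> = (\<integral>\<^sup>+k. (\<integral>\<^sup>+x. g x * indicator Q (x - k) \<partial>lborel) \<partial>count_space \<Lambda>)"
    by (rule nn_integral_count_space_nn_integral[OF \<Lambda>]) measurable
  also have "\<dots> = (\<integral>\<^sup>+k. (\<integral>\<^sup>+x. g (x + k) * indicator Q x \<partial>lborel) \<partial>count_space \<Lambda>)"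
  proof (rule nn_integral_cong)
    fix k
    have [measurable]: "(\<lambda>x. g x * indicator Q (x - k)) \<in> borel_measurable borel" by measurable
    show "(\<integral>\<^sup>+x. g x * indicator Q (x - k) \<partial>lborel) = (\<integral>\<^sup>+x. g (x + k) * indicator Q x \<partial>lborel)"
      using nn_integral_lborel_translation[of "\<lambda>x. g x * indicator Q (x - k)" k] by simp
  qed
  also have "\<dots> = (\<integral>\<^sup>+x. (\<integral>\<^sup>+k. g (x + k) * indicator Q x \<partial>count_space \<Lambda>) \<partial>lborel)"
    by (rule nn_integral_count_space_nn_integral[OF \<Lambda>, symmetric]) measurable
  also have "\<dots> = (\<integral>\<^sup>+x. (\<integral>\<^sup>+k. g (x + k) \<partial>count_space \<Lambda>) * indicator Q x \<partial>lborel)"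
    by (intro nn_integral_cong nn_integral_multc) simp
  finally show ?thesis .
qed

section \<open>The integer lattice, half-open cubes and the number of digits\<close>

lemma int_lattice_0 [simp]: "0 \<in> int_lattice"
  and int_lattice_add: "k \<in> int_lattice \<Longrightarrow> m \<in> int_lattice \<Longrightarrow> k + m \<in> int_lattice"
  and int_lattice_diff: "k \<in> int_lattice \<Longrightarrow> m \<in> int_lattice \<Longrightarrow> k - m \<in> int_lattice"
  and int_lattice_uminus: "k \<in> int_lattice \<Longrightarrow> - k \<in> int_lattice"
  by (simp_all add: int_lattice_def)

lemma countable_int_lattice: "countable (int_lattice :: (real ^ 'd) set)"
proof (rule countable_subset)
  show "int_lattice \<subseteq> range (\<lambda>m :: int ^ 'd. \<chi> i. real_of_int (m $ i))"
  proof
    fix k :: "real ^ 'd" assume "k \<in> int_lattice"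
    then have "k = (\<chi> i. real_of_int ((\<chi> i. \<lfloor>k $ i\<rfloor>) $ i))"
      by (simp add: int_lattice_def vec_eq_iff)
    then show "k \<in> range (\<lambda>m :: int ^ 'd. \<chi> i. real_of_int (m $ i))" by (rule range_eqI)
  qed
qed simp

lemma int_lattice_inner: "k \<in> int_lattice \<Longrightarrow> m \<in> int_lattice \<Longrightarrow> k \<bullet> m \<in> \<int>"
  by (auto simp: int_lattice_def inner_vec_def)

text \<open>The columns of a matrix are the images of the unit vectors. Unlike invariance of the
  lattice, integrality of the entries visibly survives transposition.\<close>

lemma int_lattice_matrix_iff:
  fixes A :: "real ^ 'd ^ 'd"
  shows "(*v) A ` int_lattice \<subseteq> int_lattice \<longleftrightarrow> (\<forall>i j. A $ i $ j \<in> \<int>)"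
proof
  assume A: "(*v) A ` int_lattice \<subseteq> int_lattice"
  show "\<forall>i j. A $ i $ j \<in> \<int>"
  proof (intro allI)
    fix i j
    have "axis j 1 \<in> (int_lattice :: (real ^ 'd) set)"
      by (auto simp: int_lattice_def axis_def)
    then have "A *v axis j 1 \<in> int_lattice" using A by auto
    then show "A $ i $ j \<in> \<int>"
      by (auto simp: int_lattice_def matrix_vector_mult_basis column_def)
  qed
qed (auto simp: int_lattice_def matrix_vector_mult_def intro!: Ints_sum Ints_mult)

lemma int_lattice_transpose:
  fixes A :: "real ^ 'd ^ 'd"
  assumes "(*v) A ` int_lattice \<subseteq> int_lattice"
  shows "(*v) (transpose A) ` int_lattice \<subseteq> int_lattice"
  using assms by (auto simp: int_lattice_matrix_iff transpose_def)

text \<open>Half-open, so that the translates by \<open>p\<close> times the lattice partition space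
  without an exceptional set; \<open>half_open_cube_AE\<close> leads back to the closed cube in
  \<open>fourier_sum\<close>.\<close>

definition half_open_cube :: "real \<Rightarrow> real \<Rightarrow> (real ^ 'd) set" where
  "half_open_cube a p = {x. \<forall>i. a \<le> x $ i \<and> x $ i < a + p}"

lemma half_open_cube_borel [measurable]: "half_open_cube a p \<in> sets borel"
proof -
  have "half_open_cube a p = (\<Inter>i. {x :: real ^ 'd. x $ i \<ge> a} \<inter> {x. x $ i < a + p})"
    by (auto simp: half_open_cube_def)
  also have "\<dots> \<in> sets borel"
    by (intro sets.countable_INT'' sets.Int borel_closed borel_open
        closed_halfspace_component_ge_cart open_halfspace_component_lt_cart) auto
  finally show ?thesis .
qed

lemma half_open_cube_AE:
  "AE x in lborel. x \<in> half_open_cube a p \<longleftrightarrow> x \<in> cbox (\<chi> i. a) (\<chi> i. a + p)"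
proof -
  have "AE x :: real ^ 'd in lborel. \<forall>i\<in>UNIV. x $ i \<noteq> a + p"
  proof (rule AE_finite_allI)
    fix i :: 'd
    have "AE x :: real ^ 'd in lborel. x \<bullet> axis i 1 \<noteq> a + p"
      by (rule AE_lborel_inner_neq) simp
    then show "AE x :: real ^ 'd in lborel. x $ i \<noteq> a + p" by (simp add: inner_axis)
  qed simp
  then show ?thesis
  proof eventually_elim
    case (elim x)
    then show ?case by (force simp: half_open_cube_def mem_box_cart less_le)
  qed
qed

lemma half_open_cube_emeasure:
  "emeasure lborel (half_open_cube a p :: (real ^ 'd) set) = emeasure lborel (cbox (\<chi> i. a) (\<chi> i. a + p) :: (real ^ 'd) set)"
  by (rule emeasure_eq_AE[OF half_open_cube_AE]) simp_all

lemma half_open_cube_emeasure_bounds: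
  assumes "p > 0"
  shows "emeasure lborel (half_open_cube a p :: (real ^ 'd) set) \<noteq> 0"
    "emeasure lborel (half_open_cube a p :: (real ^ 'd) set) \<noteq> \<infinity>"
proof -
  have "box (\<chi> i. a) (\<chi> i. a + p) \<noteq> ({} :: (real ^ 'd) set)"
    using assms by (auto simp: interval_ne_empty_cart)
  then have "measure lborel (cbox (\<chi> i. a) (\<chi> i. a + p) :: (real ^ 'd) set) \<noteq> 0"
    by (simp add: content_eq_0_interior interior_cbox)
  then show "emeasure lborel (half_open_cube a p :: (real ^ 'd) set) \<noteq> 0"
    unfolding half_open_cube_emeasure by (metis enn2real_0 measure_def)
  show "emeasure lborel (half_open_cube a p :: (real ^ 'd) set) \<noteq> \<infinity>"
    unfolding half_open_cube_emeasure using emeasure_lborel_cbox_finite by (simp add: less_top)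
qed

lemma half_open_cube_tile:
  fixes x :: "real ^ 'd"
  assumes p: "p > 0"
  shows "\<exists>!k. k \<in> (*\<^sub>R) p ` int_lattice \<and> x - k \<in> half_open_cube a p"
proof (rule ex1I)
  \<comment> \<open>The only candidate: in each coordinate, the number of whole periods between the
    lower corner and \<open>x\<close>.\<close>
  define m :: "real ^ 'd" where "m = (\<chi> i. real_of_int \<lfloor>(x $ i - a) / p\<rfloor>)"
  have *: "y = real_of_int \<lfloor>(t - a) / p\<rfloor> \<longleftrightarrow> a \<le> t - p * y \<and> t - p * y < a + p"
    if "y \<in> \<int>" for y t :: real
  proof -
    from that obtain z where z: "y = real_of_int z" by (auto elim: Ints_cases)
    have "y = real_of_int \<lfloor>(t - a) / p\<rfloor> \<longleftrightarrow> \<lfloor>(t - a) / p\<rfloor> = z" using z by auto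
    also have "\<dots> \<longleftrightarrow> real_of_int z \<le> (t - a) / p \<and> (t - a) / p < real_of_int z + 1"
      by (rule floor_eq_iff)
    also have "\<dots> \<longleftrightarrow> a \<le> t - p * y \<and> t - p * y < a + p"
      using p by (simp add: z field_simps)
    finally show ?thesis .
  qed
  have "m \<in> int_lattice" by (simp add: m_def int_lattice_def)
  moreover have "x - p *\<^sub>R m \<in> half_open_cube a p"
    using *[of "m $ i" "x $ i" for i] by (simp add: half_open_cube_def m_def)
  ultimately show "p *\<^sub>R m \<in> (*\<^sub>R) p ` int_lattice \<and> x - p *\<^sub>R m \<in> half_open_cube a p"
    by (intro conjI imageI)
  fix k assume "k \<in> (*\<^sub>R) p ` int_lattice \<and> x - k \<in> half_open_cube a p"
  then obtain m' where m': "m' \<in> int_lattice" "k = p *\<^sub>R m'" "x - p *\<^sub>R m' \<in> half_open_cube a p" by auto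
  have "m' $ i = m $ i" for i
    using *[of "m' $ i" "x $ i"] m' by (simp add: half_open_cube_def m_def int_lattice_def)
  then show "k = p *\<^sub>R m" by (simp add: m'(2) vec_eq_iff)
qed

lemma half_open_cube_tile_add:
  fixes x :: "real ^ 'd"
  assumes "p > 0"
  shows "\<exists>!k. k \<in> (*\<^sub>R) p ` int_lattice \<and> x + k \<in> half_open_cube a p"
proof -
  have neg: "- k \<in> (*\<^sub>R) p ` int_lattice" if "k \<in> (*\<^sub>R) p ` int_lattice" for k :: "real ^ 'd"
  proof -
    from that obtain m where "m \<in> int_lattice" "k = p *\<^sub>R m" by auto
    then have "- k = p *\<^sub>R (- m)" "- m \<in> int_lattice" by (simp_all add: int_lattice_uminus)
    then show ?thesis by blast
  qed
  obtain k where k: "k \<in> (*\<^sub>R) p ` int_lattice \<and> x - k \<in> half_open_cube a p"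
    and uniq: "\<forall>k'. k' \<in> (*\<^sub>R) p ` int_lattice \<and> x - k' \<in> half_open_cube a p \<longrightarrow> k' = k"
    using half_open_cube_tile[OF assms, of x a] by (rule ex1E)
  show ?thesis
  proof (rule ex1I[of _ "- k"])
    show "- k \<in> (*\<^sub>R) p ` int_lattice \<and> x + - k \<in> half_open_cube a p"
      using k neg by simp
    fix k' assume k': "k' \<in> (*\<^sub>R) p ` int_lattice \<and> x + k' \<in> half_open_cube a p"
    have "- k' = k"
      by (rule uniq[rule_format]) (use k' neg in simp)
    then have "- (- k') = - k" by (rule arg_cong)
    then show "k' = - k" by (simp only: minus_minus)
  qed
qed

lemma countable_scaled_int_lattice: "countable ((*\<^sub>R) p ` (int_lattice :: (real ^ 'd) set))"
  by (intro countable_image countable_int_lattice)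

text \<open>
  Count the lattice points of the dilated unit cube by volume: every translate of \<open>B Q\<close> contains
  exactly one lattice point per digit.
\<close>

lemma digit_set_card:
  fixes B :: "real ^ 'd ^ 'd"
  assumes B: "(*v) B ` int_lattice \<subseteq> int_lattice" and det: "det B \<noteq> 0" and K: "digit_set B K"
  shows "finite K" "real (card K) = \<bar>det B\<bar>"
proof -
  define Q :: "(real ^ 'd) set" where "Q = half_open_cube 0 1"
  define R where "R = matrix_inv B"
  have Q[measurable]: "Q \<in> sets borel" by (simp add: Q_def)
  have detR: "det R = inverse (det B)" "det R \<noteq> 0"
    using det by (simp_all add: R_def det_matrix_inv)
  have RB: "R *v (B *v y) = y" for y using det by (simp add: R_def matrix_inv_vec)
  have tile: "\<exists>!m. m \<in> int_lattice \<and> y - m \<in> Q" for y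
    using half_open_cube_tile[of 1 y 0] by (simp add: Q_def)
  have Kl: "K \<subseteq> int_lattice" using K unfolding digit_set_def by (rule conjunct1)
  have Kex1: "\<exists>!\<mu>. \<mu> \<in> K \<and> \<mu> \<in> {k + B *v m | m. m \<in> int_lattice}" if "k \<in> int_lattice" for k
    using conjunct2[OF K[unfolded digit_set_def]] that by (rule bspec)
  have K1: "\<exists>\<mu>\<in>K. \<exists>m\<in>int_lattice. \<mu> = k + B *v m" if "k \<in> int_lattice" for k
    using ex1_implies_ex[OF Kex1[OF that]] by blast
  have K2: "\<mu> = \<mu>'" if "\<mu> \<in> K" "\<mu>' \<in> K" "\<mu>' = \<mu> + B *v m" "m \<in> int_lattice" for \<mu> \<mu>' m
  proof -
    have mem: "\<mu> \<in> int_lattice" using that Kl by auto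
    have "\<mu> = \<mu> + B *v 0" by simp
    then have in1: "\<mu> \<in> {\<mu> + B *v m | m. m \<in> int_lattice}" using int_lattice_0 by blast
    have in2: "\<mu>' \<in> {\<mu> + B *v m | m. m \<in> int_lattice}" using that by blast
    show ?thesis
      using the1_equality[OF Kex1[OF mem] conjI[OF that(1) in1]]
        the1_equality[OF Kex1[OF mem] conjI[OF that(2) in2]] by (rule trans[OF sym])
  qed
  \<comment> \<open>The lattice point that belongs to a digit \<open>\<mu>\<close> is
    \<open>\<mu> - B *v m \<mu>\<close>, where \<open>m \<mu>\<close> is the tile containing
    \<open>R *v (x + \<mu>)\<close>. Extended cardinalities are compared because \<open>K\<close> is
    not yet known to be finite.\<close>
  have count: "emeasure (count_space int_lattice) {k \<in> int_lattice. R *v (x + k) \<in> Q}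
      = emeasure (count_space UNIV) K" for x
  proof -
    define m where "m \<mu> = (THE m. m \<in> int_lattice \<and> R *v (x + \<mu>) - m \<in> Q)" for \<mu>
    have m: "m \<mu> \<in> int_lattice" "R *v (x + \<mu>) - m \<mu> \<in> Q" for \<mu>
      using theI'[OF tile[of "R *v (x + \<mu>)"]] by (simp_all add: m_def)
    have m_unique: "m \<mu> = m'" if "m' \<in> int_lattice" "R *v (x + \<mu>) - m' \<in> Q" for \<mu> m'
      unfolding m_def by (rule the1_equality[OF tile conjI[OF that]])
    have "bij_betw (\<lambda>\<mu>. \<mu> - B *v m \<mu>) K {k \<in> int_lattice. R *v (x + k) \<in> Q}"
    proof (intro bij_betw_imageI inj_onI subset_antisym subsetI)
      fix \<mu> \<mu>' assume "\<mu> \<in> K" "\<mu>' \<in> K" "\<mu> - B *v m \<mu> = \<mu>' - B *v m \<mu>'"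
      then have "\<mu>' = \<mu> + B *v (m \<mu>' - m \<mu>)"
        by (simp add: matrix_vector_mult_diff_distrib algebra_simps)
      with \<open>\<mu> \<in> K\<close> \<open>\<mu>' \<in> K\<close> show "\<mu> = \<mu>'" using K2 m(1) int_lattice_diff by blast
    next
      fix k assume "k \<in> (\<lambda>\<mu>. \<mu> - B *v m \<mu>) ` K"
      then obtain \<mu> where \<mu>: "\<mu> \<in> K" "k = \<mu> - B *v m \<mu>" by auto
      have "k \<in> int_lattice" using \<mu> Kl B m(1) by (auto intro!: int_lattice_diff)
      moreover have "R *v (x + k) = R *v (x + \<mu>) - m \<mu>"
        by (simp add: \<mu>(2) matrix_vector_mult_diff_distrib matrix_vector_right_distrib RB)
      ultimately show "k \<in> {k \<in> int_lattice. R *v (x + k) \<in> Q}" using m(2) by simp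
    next
      fix k assume k: "k \<in> {k \<in> int_lattice. R *v (x + k) \<in> Q}"
      then obtain \<mu> n where \<mu>: "\<mu> \<in> K" "n \<in> int_lattice" "\<mu> = k + B *v n" using K1 by blast
      have "R *v (x + \<mu>) - n = R *v (x + k)"
        by (simp add: \<mu>(3) matrix_vector_right_distrib RB)
      then have "m \<mu> = n" using k \<mu>(2) by (intro m_unique) simp_all
      then have "k = \<mu> - B *v m \<mu>" using \<mu>(3) by simp
      then show "k \<in> (\<lambda>\<mu>. \<mu> - B *v m \<mu>) ` K" using \<mu>(1) by blast
    qed
    from bij_betw_same_card[OF this] bij_betw_finite[OF this] show ?thesis
      by (simp add: emeasure_count_space)
  qed
  \<comment> \<open>The volume of \<open>Q\<close> is computed again by transporting it with
    \<open>R\<close> and folding the dilated cube back into \<open>Q\<close>, where every point is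
    covered once per digit. Since the volume is positive and finite, it cancels.\<close>
  have "emeasure lborel Q = (\<integral>\<^sup>+x. indicator Q x \<partial>lborel)" by simp
  also have "\<dots> = ennreal \<bar>det R\<bar> * (\<integral>\<^sup>+x. indicator Q (R *v x) \<partial>lborel)"
    by (rule nn_integral_lborel_matrix[OF detR(2)]) simp
  also have "(\<integral>\<^sup>+x. indicator Q (R *v x) \<partial>lborel)
      = (\<integral>\<^sup>+x. (\<integral>\<^sup>+k. indicator Q (R *v (x + k)) \<partial>count_space int_lattice) * indicator Q x \<partial>lborel)"
    by (rule nn_integral_tiling[OF countable_int_lattice Q tile]) simp
  also have "\<dots> = (\<integral>\<^sup>+x. emeasure (count_space UNIV) K * indicator Q x \<partial>lborel)"
  proof (rule nn_integral_cong)
    fix x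
    have "(\<integral>\<^sup>+k. indicator Q (R *v (x + k)) \<partial>count_space int_lattice)
        = (\<integral>\<^sup>+k. indicator {k \<in> int_lattice. R *v (x + k) \<in> Q} k \<partial>count_space int_lattice)"
      by (rule nn_integral_cong) (simp add: indicator_def)
    also have "\<dots> = emeasure (count_space int_lattice) {k \<in> int_lattice. R *v (x + k) \<in> Q}"
      by (rule nn_integral_indicator) auto
    finally show "(\<integral>\<^sup>+k. indicator Q (R *v (x + k)) \<partial>count_space int_lattice) * indicator Q x
        = emeasure (count_space UNIV) K * indicator Q x"
      by (simp only: count)
  qed
  also have "\<dots> = emeasure (count_space UNIV) K * emeasure lborel Q"
    by (rule nn_integral_cmult_indicator) simp
  finally have eq: "emeasure lborel Q = ennreal \<bar>det R\<bar> * (emeasure (count_space UNIV) K * emeasure lborel Q)" .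
  have Q0: "emeasure lborel Q \<noteq> 0" "emeasure lborel Q \<noteq> \<infinity>"
    using half_open_cube_emeasure_bounds[of 1 0] by (simp_all add: Q_def)
  show fin: "finite K"
  proof (rule ccontr)
    assume "infinite K"
    then have "emeasure (count_space UNIV) K = \<infinity>" by (simp add: emeasure_count_space)
    with eq Q0 detR(2) show False by (simp add: ennreal_top_mult ennreal_mult_eq_top_iff)
  qed
  obtain q where q: "emeasure lborel Q = ennreal q" "q > 0"
    using Q0 by (cases "emeasure lborel Q") (auto simp: less_le)
  have "ennreal q = ennreal (\<bar>det R\<bar> * (real (card K) * q))"
    using eq fin q by (simp add: emeasure_count_space ennreal_mult ennreal_of_nat_eq_real_of_nat)
  then have "q = \<bar>det R\<bar> * (real (card K) * q)"
    using q(2) by (simp add: ennreal_inj)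
  then have "1 = \<bar>det R\<bar> * real (card K)" using q(2) by simp
  then show "real (card K) = \<bar>det B\<bar>" using det by (simp add: detR(1) field_simps)
qed

text \<open>Shift the cube instead of the function and fold it back: periodicity takes
  \<open>g x\<close> out of the lattice sum, and exactly one translate of each point lies in the
  shifted cube.\<close>

lemma nn_integral_periodic_shift:
  fixes g :: "real ^ 'd \<Rightarrow> ennreal"
  assumes g[measurable]: "g \<in> borel_measurable borel" and p: "p > 0"
    and per: "\<And>x k. k \<in> int_lattice \<Longrightarrow> g (x + p *\<^sub>R k) = g x"
  shows "(\<integral>\<^sup>+x. g (x + c) * indicator (half_open_cube a p) x \<partial>lborel)
    = (\<integral>\<^sup>+x. g x * indicator (half_open_cube a p) x \<partial>lborel)"
proof -
  let ?Q = "half_open_cube a p :: (real ^ 'd) set" and ?L = "(*\<^sub>R) p ` (int_lattice :: (real ^ 'd) set)"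
  have "(\<integral>\<^sup>+x. g (x + c) * indicator ?Q x \<partial>lborel) = (\<integral>\<^sup>+x. g x * indicator ?Q (x - c) \<partial>lborel)"
    using nn_integral_lborel_translation[of "\<lambda>x. g x * indicator ?Q (x - c)" c] by simp
  also have "\<dots> = (\<integral>\<^sup>+x. (\<integral>\<^sup>+k. g (x + k) * indicator ?Q (x + k - c) \<partial>count_space ?L) * indicator ?Q x \<partial>lborel)"
    by (rule nn_integral_tiling[OF countable_scaled_int_lattice half_open_cube_borel half_open_cube_tile[OF p]]) simp
  also have "\<dots> = (\<integral>\<^sup>+x. g x * indicator ?Q x \<partial>lborel)"
  proof (rule nn_integral_cong)
    fix x :: "real ^ 'd"
    have "(\<integral>\<^sup>+k. g (x + k) * indicator ?Q (x + k - c) \<partial>count_space ?L)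
        = (\<integral>\<^sup>+k. g x * indicator {k. (x - c) + k \<in> ?Q} k \<partial>count_space ?L)"
    proof (rule nn_integral_cong)
      fix k assume "k \<in> space (count_space ?L)"
      then have eq: "g (x + k) = g x" "x + k - c = (x - c) + k" using per by auto
      show "g (x + k) * indicator ?Q (x + k - c) = g x * indicator {k. (x - c) + k \<in> ?Q} k"
        unfolding eq by (simp add: indicator_def)
    qed
    also have "\<dots> = g x"
      by (rule nn_integral_count_space_indicator_unique[OF half_open_cube_tile_add[OF p]])
    finally show "(\<integral>\<^sup>+k. g (x + k) * indicator ?Q (x + k - c) \<partial>count_space ?L) * indicator ?Q x
        = g x * indicator ?Q x" by simp
  qed
  finally show ?thesis .
qed

lemma set_integrable_periodic_shift:
  fixes F :: "real ^ 'd \<Rightarrow> 'b::{banach, second_countable_topology}"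
  assumes F[measurable]: "F \<in> borel_measurable borel" and p: "p > 0"
    and per: "\<And>x k. k \<in> int_lattice \<Longrightarrow> F (x + p *\<^sub>R k) = F x"
    and int: "set_integrable lborel (half_open_cube a p) F"
  shows "set_integrable lborel (half_open_cube a p) (\<lambda>x. F (x + c))"
proof -
  let ?Q = "half_open_cube a p :: (real ^ 'd) set"
  have eq: "(\<integral>\<^sup>+x. ennreal (norm (indicator ?Q x *\<^sub>R G x)) \<partial>lborel) = (\<integral>\<^sup>+x. ennreal (norm (G x)) * indicator ?Q x \<partial>lborel)"
    for G :: "real ^ 'd \<Rightarrow> 'b"
    by (intro nn_integral_cong) (auto simp: indicator_def)
  have "(\<integral>\<^sup>+x. ennreal (norm (F (x + c))) * indicator ?Q x \<partial>lborel)
      = (\<integral>\<^sup>+x. ennreal (norm (F x)) * indicator ?Q x \<partial>lborel)"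
    by (rule nn_integral_periodic_shift[OF _ p]) (simp_all add: per)
  then show ?thesis
    using int unfolding set_integrable_def integrable_iff_bounded eq by simp
qed

text \<open>The folding argument works for nonnegative functions, so it is applied to the positive
  and the negative part; the complex case then follows by real and imaginary parts.\<close>

lemma set_integral_periodic_shift_real:
  fixes F :: "real ^ 'd \<Rightarrow> real"
  assumes F[measurable]: "F \<in> borel_measurable borel" and p: "p > 0"
    and per: "\<And>x k. k \<in> int_lattice \<Longrightarrow> F (x + p *\<^sub>R k) = F x"
    and int: "set_integrable lborel (half_open_cube a p) F"
  shows "(LINT x:half_open_cube a p|lborel. F (x + c)) = (LINT x:half_open_cube a p|lborel. F x)"
proof -
  let ?Q = "half_open_cube a p :: (real ^ 'd) set"
  have eq: "(LINT x:?Q|lborel. G x) = enn2real (\<integral>\<^sup>+x. ennreal (G x) * indicator ?Q x \<partial>lborel)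
      - enn2real (\<integral>\<^sup>+x. ennreal (- G x) * indicator ?Q x \<partial>lborel)"
    if "set_integrable lborel ?Q G" for G :: "real ^ 'd \<Rightarrow> real"
  proof -
    have "(\<integral>\<^sup>+x. ennreal (indicator ?Q x *\<^sub>R G x) \<partial>lborel) = (\<integral>\<^sup>+x. ennreal (G x) * indicator ?Q x \<partial>lborel)"
      "(\<integral>\<^sup>+x. ennreal (- (indicator ?Q x *\<^sub>R G x)) \<partial>lborel) = (\<integral>\<^sup>+x. ennreal (- G x) * indicator ?Q x \<partial>lborel)"
      by (intro nn_integral_cong; simp add: indicator_def)+
    then show ?thesis
      using that unfolding set_integrable_def set_lebesgue_integral_def
      by (simp only: real_lebesgue_integral_def)
  qed
  have "(\<integral>\<^sup>+x. ennreal (F (x + c)) * indicator ?Q x \<partial>lborel) = (\<integral>\<^sup>+x. ennreal (F x) * indicator ?Q x \<partial>lborel)"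
    "(\<integral>\<^sup>+x. ennreal (- F (x + c)) * indicator ?Q x \<partial>lborel) = (\<integral>\<^sup>+x. ennreal (- F x) * indicator ?Q x \<partial>lborel)"
    by (rule nn_integral_periodic_shift[OF _ p]; simp add: per)+
  then show ?thesis
    by (simp only: eq[OF int] eq[OF set_integrable_periodic_shift[OF F p per int]])
qed

lemma set_integral_periodic_shift:
  fixes F :: "real ^ 'd \<Rightarrow> complex"
  assumes F[measurable]: "F \<in> borel_measurable borel" and p: "p > 0"
    and per: "\<And>x k. k \<in> int_lattice \<Longrightarrow> F (x + p *\<^sub>R k) = F x"
    and int: "set_integrable lborel (half_open_cube a p) F"
  shows "(LINT x:half_open_cube a p|lborel. F (x + c)) = (LINT x:half_open_cube a p|lborel. F x)"
proof -
  let ?Q = "half_open_cube a p :: (real ^ 'd) set"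
  have ReIm: "Re (LINT x:?Q|lborel. G x) = (LINT x:?Q|lborel. Re (G x))"
    "Im (LINT x:?Q|lborel. G x) = (LINT x:?Q|lborel. Im (G x))"
    "set_integrable lborel ?Q (\<lambda>x. Re (G x))" "set_integrable lborel ?Q (\<lambda>x. Im (G x))"
    if "set_integrable lborel ?Q G" for G :: "real ^ 'd \<Rightarrow> complex"
    using integral_Re[of lborel "\<lambda>x. indicator ?Q x *\<^sub>R G x"] integral_Im[of lborel "\<lambda>x. indicator ?Q x *\<^sub>R G x"]
      integrable_Re[of lborel "\<lambda>x. indicator ?Q x *\<^sub>R G x"] integrable_Im[of lborel "\<lambda>x. indicator ?Q x *\<^sub>R G x"] that
    unfolding set_integrable_def set_lebesgue_integral_def by simp_all
  note int' = set_integrable_periodic_shift[OF F p per int, of c]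
  show ?thesis
  proof (rule complex_eqI)
    show "Re (LINT x:?Q|lborel. F (x + c)) = Re (LINT x:?Q|lborel. F x)"
    proof -
      have "Re (LINT x:?Q|lborel. F (x + c)) = (LINT x:?Q|lborel. Re (F (x + c)))"
        by (rule ReIm(1)[OF int'])
      also have "\<dots> = (LINT x:?Q|lborel. Re (F x))"
        by (rule set_integral_periodic_shift_real[OF _ p _ ReIm(3)[OF int]]) (simp_all add: per)
      also have "\<dots> = Re (LINT x:?Q|lborel. F x)"
        by (rule ReIm(1)[OF int, symmetric])
      finally show ?thesis .
    qed
    show "Im (LINT x:?Q|lborel. F (x + c)) = Im (LINT x:?Q|lborel. F x)"
    proof -
      have "Im (LINT x:?Q|lborel. F (x + c)) = (LINT x:?Q|lborel. Im (F (x + c)))"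
        by (rule ReIm(2)[OF int'])
      also have "\<dots> = (LINT x:?Q|lborel. Im (F x))"
        by (rule set_integral_periodic_shift_real[OF _ p _ ReIm(4)[OF int]]) (simp_all add: per)
      also have "\<dots> = Im (LINT x:?Q|lborel. F x)"
        by (rule ReIm(2)[OF int, symmetric])
      finally show ?thesis .
    qed
  qed
qed

text \<open>\<open>fourier_sum\<close> provides measurability on one period cube only. Periodicity
  spreads it to the countably many translates that cover the space, as the shifts by digits leave
  the cube.\<close>

lemma borel_measurable_periodic:
  fixes F :: "real ^ 'd \<Rightarrow> complex"
  assumes F: "F \<in> borel_measurable (restrict_space lborel (cbox (\<chi> i. a) (\<chi> i. a + p)))" and p: "p > 0"
    and per: "\<And>x k. k \<in> int_lattice \<Longrightarrow> F (x + p *\<^sub>R k) = F x"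
  shows "F \<in> borel_measurable borel"
proof -
  let ?Q = "half_open_cube a p :: (real ^ 'd) set" and ?L = "(*\<^sub>R) p ` (int_lattice :: (real ^ 'd) set)"
  let ?c = "cbox (\<chi> i. a) (\<chi> i. a + p) :: (real ^ 'd) set"
  define G where "G y = indicator ?c y *\<^sub>R F y" for y
  have [measurable]: "G \<in> borel_measurable borel"
    using F unfolding G_def by (subst (asm) borel_measurable_restrict_space_iff) auto
  show ?thesis
  proof (rule measurable_piecewise_restrict[where C = "(\<lambda>k. {x. x - k \<in> ?Q}) ` ?L"])
    show "countable ((\<lambda>k. {x. x - k \<in> ?Q}) ` ?L)"
      by (intro countable_image countable_scaled_int_lattice)
    show "space borel \<subseteq> \<Union> ((\<lambda>k. {x. x - k \<in> ?Q}) ` ?L)"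
      using ex1_implies_ex[OF half_open_cube_tile[OF p]] by (auto simp: image_iff)
    fix \<Omega> assume "\<Omega> \<in> (\<lambda>k. {x. x - k \<in> ?Q}) ` ?L"
    then obtain m where m: "m \<in> int_lattice" "\<Omega> = {x. x - p *\<^sub>R m \<in> ?Q}" by auto
    have "(\<lambda>x. x - p *\<^sub>R m) -` ?Q \<inter> space borel \<in> sets borel"
      by (rule measurable_sets[where A = borel]) measurable
    then show "\<Omega> \<inter> space borel \<in> sets borel" by (simp add: m(2) vimage_def)
    have "F x = G (x - p *\<^sub>R m)" if "x \<in> \<Omega>" for x
    proof -
      have "x - p *\<^sub>R m \<in> ?c"
        using that by (force simp: m(2) half_open_cube_def mem_box_cart less_imp_le)
      then show ?thesis using per[OF m(1), of "x - p *\<^sub>R m"] by (simp add: G_def)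
    qed
    then show "F \<in> borel_measurable (restrict_space borel \<Omega>)"
      by (subst measurable_cong[where g = "\<lambda>x. G (x - p *\<^sub>R m)"])
         (auto simp: space_restrict_space intro!: measurable_restrict_space1)
  qed
qed


section \<open>Fourier series on the torus\<close>

text \<open>The measure is not normalized, so its total mass accompanies the orthogonality and
  Parseval formulas below.\<close>

definition torus :: "(real ^ 'd) measure" where
  "torus = restrict_space lborel (cbox (\<chi> i. - pi) (\<chi> i. pi))"

definition lattice_periodic :: "(real ^ 'd \<Rightarrow> 'b) \<Rightarrow> bool" where
  "lattice_periodic F \<longleftrightarrow> (\<forall>\<xi>. \<forall>k\<in>int_lattice. F (\<xi> + (2 * pi) *\<^sub>R k) = F \<xi>)"

lemma finite_measure_torus: "finite_measure (torus :: (real ^ 'd) measure)"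
proof
  show "emeasure torus (space (torus :: (real ^ 'd) measure)) \<noteq> \<infinity>"
    using emeasure_lborel_cbox_finite[of "(\<chi> i. - pi) :: real ^ 'd" "\<chi> i. pi"]
    by (simp add: torus_def space_restrict_space emeasure_restrict_space less_top)
qed

lemma measure_torus_pos: "measure torus (space (torus :: (real ^ 'd) measure)) > 0"
proof -
  have "box (\<chi> i. - pi) (\<chi> i. pi) \<noteq> ({} :: (real ^ 'd) set)"
    by (auto simp: interval_ne_empty_cart)
  then have "measure lborel (cbox (\<chi> i. - pi) (\<chi> i. pi) :: (real ^ 'd) set) \<noteq> 0"
    by (simp add: content_eq_0_interior interior_cbox)
  then have "measure lborel (cbox (\<chi> i. - pi) (\<chi> i. pi) :: (real ^ 'd) set) > 0"
    using measure_nonneg less_le by metis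
  then show ?thesis
    by (simp add: torus_def space_restrict_space measure_restrict_space)
qed

lemma borel_measurable_torusI: "F \<in> borel_measurable borel \<Longrightarrow> F \<in> borel_measurable torus"
  unfolding torus_def by (rule measurable_restrict_space1) simp

lemma AE_torusI:
  assumes "AE \<xi> in lborel. P \<xi>"
  shows "AE \<xi> in torus. P \<xi>"
  unfolding torus_def using assms by (subst AE_restrict_space_iff) auto

lemma torus_half_open:
  fixes F :: "real ^ 'd \<Rightarrow> complex"
  assumes F: "F \<in> borel_measurable borel"
  shows "integrable torus F \<longleftrightarrow> set_integrable lborel (half_open_cube (- pi) (2 * pi)) F"
    "(LINT \<xi>|torus. F \<xi>) = (LINT \<xi>:half_open_cube (- pi) (2 * pi)|lborel. F \<xi>)"
proof -
  let ?c = "cbox (\<chi> i. - pi) (\<chi> i. pi) :: (real ^ 'd) set" and ?Q = "half_open_cube (- pi) (2 * pi) :: (real ^ 'd) set"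
  have m: "(\<lambda>\<xi>. indicator ?c \<xi> *\<^sub>R F \<xi>) \<in> borel_measurable lborel" "(\<lambda>\<xi>. indicator ?Q \<xi> *\<^sub>R F \<xi>) \<in> borel_measurable lborel"
    using F by measurable
  have "- pi + 2 * pi = pi" by simp
  then have "AE \<xi> in lborel. \<xi> \<in> ?Q \<longleftrightarrow> \<xi> \<in> ?c"
    using half_open_cube_AE[of "- pi" "2 * pi"] by simp
  then have ae: "AE \<xi> in lborel. indicator ?c \<xi> *\<^sub>R F \<xi> = indicator ?Q \<xi> *\<^sub>R F \<xi>"
    by eventually_elim (simp add: indicator_def)
  show "integrable torus F \<longleftrightarrow> set_integrable lborel ?Q F"
    unfolding torus_def set_integrable_def using integrable_cong_AE[OF m ae]
    by (subst integrable_restrict_space) simp_all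
  show "(LINT \<xi>|torus. F \<xi>) = (LINT \<xi>:?Q|lborel. F \<xi>)"
    unfolding torus_def set_lebesgue_integral_def using integral_cong_AE[OF m ae]
    by (subst integral_restrict_space) simp_all
qed

lemma torus_measurable_periodic:
  fixes F :: "real ^ 'd \<Rightarrow> complex"
  assumes F: "F \<in> borel_measurable torus" and per: "lattice_periodic F"
  shows "F \<in> borel_measurable borel"
proof (rule borel_measurable_periodic[of F "- pi" "2 * pi"])
  have "- pi + 2 * pi = pi" by simp
  then show "F \<in> borel_measurable (restrict_space lborel (cbox (\<chi> i. - pi) (\<chi> i. - pi + 2 * pi)))"
    using F by (simp only: torus_def)
qed (use per in \<open>simp_all add: lattice_periodic_def\<close>)

lemma torus_shift:
  fixes F :: "real ^ 'd \<Rightarrow> complex"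
  assumes int: "integrable torus F" and per: "lattice_periodic F"
  shows "integrable torus (\<lambda>\<xi>. F (\<xi> + c))" "(LINT \<xi>|torus. F (\<xi> + c)) = (LINT \<xi>|torus. F \<xi>)"
proof -
  have [measurable]: "F \<in> borel_measurable borel"
    using torus_measurable_periodic[OF _ per] int by simp
  have mc: "(\<lambda>\<xi>. F (\<xi> + c)) \<in> borel_measurable borel" by measurable
  have per': "\<And>x k. k \<in> int_lattice \<Longrightarrow> F (x + (2 * pi) *\<^sub>R k) = F x"
    using per by (simp add: lattice_periodic_def)
  have int': "set_integrable lborel (half_open_cube (- pi) (2 * pi)) F"
    using int torus_half_open(1)[of F] by simp
  show "integrable torus (\<lambda>\<xi>. F (\<xi> + c))"
    unfolding torus_half_open(1)[OF mc]
    by (rule set_integrable_periodic_shift[OF _ _ per' int']) simp_all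
  have "(LINT \<xi>|torus. F (\<xi> + c)) = (LINT \<xi>:half_open_cube (- pi) (2 * pi)|lborel. F (\<xi> + c))"
    by (rule torus_half_open(2)[OF mc])
  also have "\<dots> = (LINT \<xi>:half_open_cube (- pi) (2 * pi)|lborel. F \<xi>)"
    by (rule set_integral_periodic_shift[OF _ _ per' int']) simp_all
  also have "\<dots> = (LINT \<xi>|torus. F \<xi>)"
    by (rule torus_half_open(2)[symmetric]) simp
  finally show "(LINT \<xi>|torus. F (\<xi> + c)) = (LINT \<xi>|torus. F \<xi>)" .
qed

definition fourier_exp :: "real ^ 'd \<Rightarrow> real ^ 'd \<Rightarrow> complex" where
  "fourier_exp k \<xi> = exp (- \<i> * complex_of_real (\<xi> \<bullet> k))"

lemma fourier_exp_add: "fourier_exp (k + m) \<xi> = fourier_exp k \<xi> * fourier_exp m \<xi>"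
  by (simp add: fourier_exp_def inner_add_right exp_add[symmetric] algebra_simps)

lemma fourier_exp_shift: "fourier_exp k (\<xi> + c) = fourier_exp k \<xi> * fourier_exp k c"
  by (simp add: fourier_exp_def inner_add_left exp_add[symmetric] algebra_simps)

lemma cnj_fourier_exp: "cnj (fourier_exp k \<xi>) = fourier_exp (- k) \<xi>"
  by (simp add: fourier_exp_def exp_cnj)

lemma fourier_exp_0 [simp]: "fourier_exp 0 \<xi> = 1"
  by (simp add: fourier_exp_def)

lemma norm_fourier_exp [simp]: "cmod (fourier_exp k \<xi>) = 1"
  by (simp add: fourier_exp_def)

lemma fourier_exp_integer: "x \<bullet> k \<in> \<int> \<Longrightarrow> fourier_exp k ((2 * pi) *\<^sub>R x) = 1"
proof -
  assume "x \<bullet> k \<in> \<int>"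
  then have "- (x \<bullet> k) \<in> \<int>" by simp
  then show ?thesis
    using exp_integer_2pi[of "- (x \<bullet> k)"] by (simp add: fourier_exp_def mult_ac)
qed

lemma lattice_periodic_fourier_exp: "k \<in> int_lattice \<Longrightarrow> lattice_periodic (fourier_exp k)"
  by (simp add: lattice_periodic_def fourier_exp_shift fourier_exp_integer int_lattice_inner)

lemma fourier_exp_measurable [measurable]: "fourier_exp k \<in> borel_measurable borel"
  unfolding fourier_exp_def[abs_def] by measurable

lemma fourier_exp_integrable: "integrable torus (fourier_exp k)"
  by (rule finite_measure.integrable_const_bound[OF finite_measure_torus, of _ 1])
     (simp_all add: borel_measurable_torusI)

lemma integral_fourier_exp:
  fixes k :: "real ^ 'd"
  assumes "k \<in> int_lattice"
  shows "(LINT \<xi>|torus. fourier_exp k \<xi>) = (if k = 0 then complex_of_real (measure torus (space (torus :: (real ^ 'd) measure))) else 0)"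
    (is "?I = _")
proof (cases "k = 0")
  case False
  then obtain i where i: "k $ i \<noteq> 0" by (auto simp: vec_eq_iff)
  \<comment> \<open>Chosen with \<open>c \<bullet> k = pi\<close>: the shift by \<open>c\<close>
    preserves the integral but multiplies the exponential by -1.\<close>
  define c :: "real ^ 'd" where "c = axis i (pi / (k $ i))"
  have "c \<bullet> k = pi" using i by (simp add: c_def inner_axis' )
  then have c: "fourier_exp k c = - 1"
    using exp_minus[of "\<i> * complex_of_real pi"] by (simp add: fourier_exp_def)
  have "(LINT \<xi>|torus. fourier_exp k (\<xi> + c)) = ?I"
    by (rule torus_shift(2)[OF fourier_exp_integrable lattice_periodic_fourier_exp[OF assms]])
  then have "- ?I = ?I" by (simp add: fourier_exp_shift c)
  then have "?I = 0" by simp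
  then show ?thesis using False by simp
qed (simp add: scaleR_conv_of_real)

lemma fourier_exp_L2: "fourier_exp k \<in> L2 torus"
proof -
  interpret finite_measure "torus :: (real ^ 'd) measure" by (rule finite_measure_torus)
  show ?thesis by (simp add: L2_def borel_measurable_torusI)
qed

lemma fourier_exp_mult_L2:
  assumes "F \<in> L2 torus"
  shows "(\<lambda>\<xi>. fourier_exp k \<xi> * F \<xi>) \<in> L2 torus"
  using assms borel_measurable_torusI[OF fourier_exp_measurable, of k]
  by (auto simp: L2_def norm_mult)

lemma fourier_exp_orthogonal:
  fixes k m :: "real ^ 'd"
  assumes "k \<in> int_lattice" "m \<in> int_lattice"
  shows "L2_inner torus (fourier_exp k) (fourier_exp m)
    = (if k = m then complex_of_real (measure torus (space (torus :: (real ^ 'd) measure))) else 0)"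
proof -
  have "L2_inner torus (fourier_exp k) (fourier_exp m) = (LINT \<xi>|torus. fourier_exp (k - m) \<xi>)"
    unfolding L2_inner_def cnj_fourier_exp fourier_exp_add[symmetric] by simp
  then show ?thesis using integral_fourier_exp[of "k - m"] assms by (simp add: int_lattice_diff)
qed

lemma fourier_sumD:
  assumes "fourier_sum c m"
  shows "lattice_periodic m" "m \<in> L2 torus" "has_L2_sum torus (\<lambda>k \<xi>. c k * fourier_exp k \<xi>) int_lattice m"
  using assms by (simp_all add: fourier_sum_def lattice_periodic_def torus_def fourier_exp_def[abs_def] has_L2_sum_def)

text \<open>Multiplying \<open>G\<close> by \<open>fourier_exp (- n)\<close> shifts its coefficients
  by \<open>n\<close>. Only \<open>F\<close> is expanded; the coefficients of \<open>G\<close> are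
  read off by orthogonality, and convergence of the series comes from continuity of the inner
  product.\<close>

lemma fourier_sum_shifted_Parseval:
  fixes n :: "real ^ 'd"
  assumes c: "fourier_sum c F" and d: "fourier_sum d G" and n: "n \<in> int_lattice"
  shows "((\<lambda>k. c k * cnj (d (k + n)) * complex_of_real (measure torus (space (torus :: (real ^ 'd) measure))))
    has_sum (LINT \<xi>|torus. F \<xi> * cnj (G \<xi>) * fourier_exp n \<xi>)) int_lattice"
proof -
  let ?\<kappa> = "complex_of_real (measure torus (space (torus :: (real ^ 'd) measure)))"
  define u where "u = (\<lambda>\<xi>. fourier_exp (- n) \<xi> * G \<xi>)"
  have u: "u \<in> L2 torus" unfolding u_def by (rule fourier_exp_mult_L2[OF fourier_sumD(2)[OF d]])
  have cu: "cnj (u \<xi>) = fourier_exp n \<xi> * cnj (G \<xi>)" for \<xi>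
    by (simp add: u_def cnj_fourier_exp)
  have Fu: "L2_inner torus F u = (LINT \<xi>|torus. F \<xi> * cnj (G \<xi>) * fourier_exp n \<xi>)"
    by (simp add: L2_inner_def cu mult_ac)
  have "L2_inner torus (\<lambda>\<xi>. c k * fourier_exp k \<xi>) u = c k * cnj (d (k + n)) * ?\<kappa>" if "k \<in> int_lattice" for k
  proof -
    have kn: "k + n \<in> int_lattice" using that n by (rule int_lattice_add)
    have "L2_inner torus (fourier_exp k) u = L2_inner torus (fourier_exp (k + n)) G"
      by (simp add: L2_inner_def cu fourier_exp_add mult_ac)
    also have "\<dots> = cnj (L2_inner torus G (fourier_exp (k + n)))"
      by (rule L2_inner_commute)
    also have "L2_inner torus G (fourier_exp (k + n)) = ?\<kappa> * d (k + n)"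
      using has_L2_sum_coeff[OF fourier_sumD(3)[OF d] fourier_exp_L2, of "k + n" "k + n" ?\<kappa>] kn
      by (simp add: fourier_exp_orthogonal)
    finally show ?thesis by (simp add: L2_inner_cmult_left)
  qed
  then show ?thesis
    using has_L2_sum_inner[OF fourier_sumD(3)[OF c] u] unfolding Fu
    by (subst (asm) has_sum_cong) auto
qed

section \<open>Dilation matrices: from the symbol identity to coefficient sequences\<close>

locale dilation =
  fixes A :: "real ^ 'd ^ 'd"
  assumes dilation: "dilation_matrix A"
begin

lemma lattice_A: "k \<in> int_lattice \<Longrightarrow> A *v k \<in> int_lattice"
  using dilation by (auto simp: dilation_matrix_def)

text \<open>A kernel vector, regarded as a complex vector, would be an eigenvector with eigenvalue
  0, whose modulus is not above 1.\<close>

lemma det_A: "det A \<noteq> 0"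
proof
  assume "det A = 0"
  then obtain x where x: "x \<noteq> 0" "A *v x = 0"
    using invertible_det_nz[of A] matrix_left_invertible_ker[of A] invertible_left_inverse[of A] by auto
  define v :: "complex ^ 'd" where "v = (\<chi> i. complex_of_real (x $ i))"
  have "v \<noteq> 0" using x(1) by (auto simp: v_def vec_eq_iff)
  moreover have "map_matrix complex_of_real A *v v = 0 *s v"
  proof -
    have "(\<Sum>j\<in>UNIV. complex_of_real (A $ i $ j) * complex_of_real (x $ j)) = 0" for i
    proof -
      have "(\<Sum>j\<in>UNIV. A $ i $ j * x $ j) = 0"
        using x(2) by (simp add: vec_eq_iff matrix_vector_mult_def)
      then show ?thesis by (simp flip: of_real_mult of_real_sum)
    qed
    then show ?thesis by (simp add: vec_eq_iff matrix_vector_mult_def v_def map_matrix_def)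
  qed
  ultimately have "cmod 0 > 1" using dilation unfolding dilation_matrix_def by blast
  then show False by simp
qed

lemma index_A: "real (dilation_index A) = \<bar>det A\<bar>"
  by (rule dilation_index_eq[OF dilation])

lemma index_pos: "dilation_index A > 0"
  using index_A det_A by (metis abs_eq_0 gr0I of_nat_0)

lemma A_inj: "A *v x = A *v y \<longleftrightarrow> x = y"
  using matrix_inv_vec(2)[OF det_A] by metis

lemma digit_set_A: "digit_set A K \<Longrightarrow> finite K \<and> card K = dilation_index A"
  using digit_set_card[of A K] lattice_A det_A index_A by (metis image_subsetI of_nat_eq_iff)

lemma digit_set_transpose: "digit_set (transpose A) K \<Longrightarrow> finite K \<and> card K = dilation_index A"
  using digit_set_card[of "transpose A" K] int_lattice_transpose[of A] lattice_A det_A index_A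
  by (metis det_transpose image_subsetI of_nat_eq_iff)

text \<open>Moving \<open>A\<close> to the other side of the inner product cancels the inverse of
  its transpose and leaves the integer \<open>\<mu> \<bullet> n\<close>. Frequencies in the image of
  \<open>A\<close> therefore do not see the digit shifts.\<close>

lemma fourier_exp_digit:
  assumes "\<mu> \<in> int_lattice" "n \<in> int_lattice"
  shows "fourier_exp (A *v n) (\<xi> + (2 * pi) *\<^sub>R (matrix_inv (transpose A) *v \<mu>)) = fourier_exp (A *v n) \<xi>"
proof -
  have "(matrix_inv (transpose A) *v \<mu>) \<bullet> (A *v n) = (transpose A *v (matrix_inv (transpose A) *v \<mu>)) \<bullet> n"
    by (simp add: dot_lmul_matrix[symmetric])
  also have "\<dots> = \<mu> \<bullet> n" using det_A by (simp only: matrix_inv_vec(1) det_transpose not_False_eq_True)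
  finally have "(matrix_inv (transpose A) *v \<mu>) \<bullet> (A *v n) \<in> \<int>"
    using assms int_lattice_inner by auto
  then show ?thesis by (simp add: fourier_exp_shift fourier_exp_integer)
qed

text \<open>
  Averaging over the digits turns the matrix identity for the symbols into the orthonormality of the
  \<open>A\<close>-shifted coefficient sequences.
\<close>

lemma packet_filters_orthonormal:
  fixes \<phi> :: "'l::finite \<Rightarrow> real ^ 'd \<Rightarrow> complex"
  assumes K: "digit_set (transpose A) K" and pf: "packet_filters A K \<phi> h H"
    and r: "r < dilation_index A" and s: "s < dilation_index A" and n: "n \<in> int_lattice"
  obtains S where "\<And>j. ((\<lambda>k. h r l j k * cnj (h s l' j (k + A *v n))) has_sum S j) int_lattice"
    "(\<Sum>j\<in>UNIV. S j) = (if r = s \<and> l = l' \<and> n = 0 then 1 else 0)"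
proof -
  define a where "a = dilation_index A"
  define \<kappa> where "\<kappa> = complex_of_real (measure torus (space (torus :: (real ^ 'd) measure)))"
  have \<kappa>: "\<kappa> \<noteq> 0" using measure_torus_pos[where 'd = 'd] by (simp add: \<kappa>_def)
  have a0: "complex_of_real (sqrt (real a)) \<noteq> 0" "complex_of_nat a \<noteq> 0"
    using index_pos by (simp_all add: a_def)
  have aa: "complex_of_real (sqrt (real a)) * complex_of_real (sqrt (real a)) = complex_of_nat a"
    by (simp flip: of_real_mult)
  have Kc: "finite K" "card K = a" using digit_set_transpose[OF K] by (simp_all add: a_def)
  have Kl: "K \<subseteq> int_lattice" using K unfolding digit_set_def by (rule conjunct1)
  have fs: "fourier_sum (\<lambda>k. h r l j k / complex_of_real (sqrt (real a))) (\<lambda>\<xi>. H r \<xi> $ l $ j)" 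
    if "r < a" for r l j
    using pf that unfolding packet_filters_def a_def by blast
  note fsr = fs[OF r[folded a_def]] and fss = fs[OF s[folded a_def]]
  define I where "I j = (LINT \<xi>|torus. H r \<xi> $ l $ j * cnj (H s \<xi> $ l' $ j) * fourier_exp (A *v n) \<xi>)" for j
  \<comment> \<open>Undoes two normalizations: each of the two symbols carries
    \<open>1 / sqrt a\<close>, and the exponentials have squared norm
    \<open>\<kappa>\<close>.\<close>
  define S where "S j = I j * complex_of_nat a / \<kappa>" for j
  have 1: "((\<lambda>k. h r l j k * cnj (h s l' j (k + A *v n))) has_sum S j) int_lattice" for j
  proof -
    have "((\<lambda>k. (h r l j k / complex_of_real (sqrt (real a))) * cnj (h s l' j (k + A *v n) / complex_of_real (sqrt (real a))) * \<kappa>)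
        has_sum I j) int_lattice"
      using fourier_sum_shifted_Parseval[OF fsr[of l j] fss[of l' j] lattice_A[OF n]]
      by (simp add: I_def \<kappa>_def)
    from has_sum_cmult_left[OF this, of "complex_of_nat a / \<kappa>"]
    have "((\<lambda>k. (h r l j k / complex_of_real (sqrt (real a))) * cnj (h s l' j (k + A *v n) / complex_of_real (sqrt (real a))) * \<kappa> * (complex_of_nat a / \<kappa>))
        has_sum S j) int_lattice"
      by (simp add: S_def)
    moreover have "(x / complex_of_real (sqrt (real a))) * cnj (y / complex_of_real (sqrt (real a))) * \<kappa> * (complex_of_nat a / \<kappa>) = x * cnj y" for x y
      using \<kappa> a0 by (simp add: aa[symmetric] divide_simps)
    ultimately show ?thesis by simp
  qed
  define E where "E = fourier_exp (A *v n)"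
  \<comment> \<open>The entry \<open>(l, l')\<close> of \<open>H r ** conj_transpose (H s)\<close>.
    The identity controls this product and not the single summands, so only the sum of the
    \<open>S j\<close> can be evaluated.\<close>
  define G where "G = (\<lambda>\<xi>. \<Sum>j\<in>UNIV. H r \<xi> $ l $ j * cnj (H s \<xi> $ l' $ j))"
  define c where "c \<mu> = (2 * pi) *\<^sub>R (matrix_inv (transpose A) *v \<mu>)" for \<mu>
  have intj: "integrable torus (\<lambda>\<xi>. H r \<xi> $ l $ j * cnj (H s \<xi> $ l' $ j) * E \<xi>)" for j
  proof -
    have "integrable torus (\<lambda>\<xi>. H r \<xi> $ l $ j * cnj (fourier_exp (- (A *v n)) \<xi> * H s \<xi> $ l' $ j))"
      by (intro L2_integrable_mult fourier_exp_mult_L2 fourier_sumD(2)[OF fsr] fourier_sumD(2)[OF fss])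
    then show ?thesis by (simp add: cnj_fourier_exp E_def mult_ac)
  qed
  have GE: "G \<xi> * E \<xi> = (\<Sum>j\<in>UNIV. H r \<xi> $ l $ j * cnj (H s \<xi> $ l' $ j) * E \<xi>)" for \<xi>
    by (simp add: G_def sum_distrib_right)
  have int: "integrable torus (\<lambda>\<xi>. G \<xi> * E \<xi>)"
    unfolding GE by (intro Bochner_Integration.integrable_sum intj)
  have per: "lattice_periodic (\<lambda>\<xi>. G \<xi> * E \<xi>)"
    using fourier_sumD(1)[OF fsr] fourier_sumD(1)[OF fss] lattice_periodic_fourier_exp[OF lattice_A[OF n]]
    unfolding lattice_periodic_def G_def E_def by simp
  have sumI: "(\<Sum>j\<in>UNIV. I j) = (LINT \<xi>|torus. G \<xi> * E \<xi>)"
    unfolding GE I_def E_def[symmetric] by (rule Bochner_Integration.integral_sum[symmetric]) (rule intj)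
  have shift: "integrable torus (\<lambda>\<xi>. G (\<xi> + c \<mu>) * E \<xi>)"
    "(LINT \<xi>|torus. G (\<xi> + c \<mu>) * E \<xi>) = (LINT \<xi>|torus. G \<xi> * E \<xi>)" if "\<mu> \<in> K" for \<mu>
  proof -
    have "E (\<xi> + c \<mu>) = E \<xi>" for \<xi>
      unfolding E_def c_def using that Kl n by (intro fourier_exp_digit) auto
    then show "integrable torus (\<lambda>\<xi>. G (\<xi> + c \<mu>) * E \<xi>)"
      "(LINT \<xi>|torus. G (\<xi> + c \<mu>) * E \<xi>) = (LINT \<xi>|torus. G \<xi> * E \<xi>)"
      using torus_shift[OF int per, of "c \<mu>"] by simp_all
  qed
  \<comment> \<open>Every digit contributes the same integral, because \<open>E\<close> is unchanged
    by \<open>c \<mu>\<close>; the \<open>a\<close> copies are then merged under one integral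
    sign.\<close>
  have "complex_of_nat a * (\<Sum>j\<in>UNIV. I j) = (\<Sum>\<mu>\<in>K. (LINT \<xi>|torus. G (\<xi> + c \<mu>) * E \<xi>))"
    by (simp add: shift(2) sumI Kc)
  also have "\<dots> = (LINT \<xi>|torus. (\<Sum>\<mu>\<in>K. G (\<xi> + c \<mu>) * E \<xi>))"
    by (rule Bochner_Integration.integral_sum[symmetric]) (rule shift(1))
  also have "\<dots> = (LINT \<xi>|torus. (if r = s \<and> l = l' then 1 else 0) * E \<xi>)"
  proof (rule integral_cong_AE)
    have "AE \<xi> in lborel. (\<Sum>\<mu>\<in>K. H r (\<xi> + c \<mu>) ** conj_transpose (H s (\<xi> + c \<mu>))) = (if r = s then mat 1 else 0)"
      using pf r s unfolding packet_filters_def c_def by blast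
    then have "AE \<xi> in torus. (\<Sum>\<mu>\<in>K. H r (\<xi> + c \<mu>) ** conj_transpose (H s (\<xi> + c \<mu>))) = (if r = s then mat 1 else 0)"
      by (rule AE_torusI)
    then show "AE \<xi> in torus. (\<Sum>\<mu>\<in>K. G (\<xi> + c \<mu>) * E \<xi>) = (if r = s \<and> l = l' then 1 else 0) * E \<xi>"
    proof eventually_elim
      case (elim \<xi>)
      have "(H r \<eta> ** conj_transpose (H s \<eta>)) $ l $ l' = G \<eta>" for \<eta>
        by (simp add: G_def matrix_matrix_mult_def conj_transpose_def map_matrix_def transpose_def)
      then have "(\<Sum>\<mu>\<in>K. G (\<xi> + c \<mu>)) = (\<Sum>\<mu>\<in>K. H r (\<xi> + c \<mu>) ** conj_transpose (H s (\<xi> + c \<mu>))) $ l $ l'"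
        by (simp add: sum_component)
      also have "\<dots> = (if r = s \<and> l = l' then 1 else 0)"
        unfolding elim by (simp add: mat_def)
      finally show ?case by (simp add: sum_distrib_right[symmetric])
    qed
    show "(\<lambda>\<xi>. \<Sum>\<mu>\<in>K. G (\<xi> + c \<mu>) * E \<xi>) \<in> borel_measurable torus"
      by (intro borel_measurable_sum borel_measurable_integrable shift(1))
    show "(\<lambda>\<xi>. (if r = s \<and> l = l' then 1 else 0) * E \<xi>) \<in> borel_measurable torus"
      by (rule borel_measurable_torusI) (simp add: E_def)
  qed
  also have "\<dots> = (if r = s \<and> l = l' \<and> n = 0 then \<kappa> else 0)"
    using integral_fourier_exp[OF lattice_A[OF n]] A_inj[of n 0]
    by (simp add: E_def \<kappa>_def)
  finally have eq: "complex_of_nat a * (\<Sum>j\<in>UNIV. I j) = (if r = s \<and> l = l' \<and> n = 0 then \<kappa> else 0)" .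
  have "(\<Sum>j\<in>UNIV. S j) = (complex_of_nat a * (\<Sum>j\<in>UNIV. I j)) / \<kappa>"
    by (simp add: S_def sum_distrib_left sum_divide_distrib mult.commute)
  then have 2: "(\<Sum>j\<in>UNIV. S j) = (if r = s \<and> l = l' \<and> n = 0 then 1 else 0)"
    unfolding eq using \<kappa> by simp
  show ?thesis by (rule that[OF 1 2])
qed

end

section \<open>Orthonormal bases and orthogonal complements\<close>

lemma orthonormal_basisD:
  assumes "orthonormal_basis M e I V"
  shows "\<And>i. i \<in> I \<Longrightarrow> e i \<in> V"
    "\<And>i j. i \<in> I \<Longrightarrow> j \<in> I \<Longrightarrow> L2_inner M (e i) (e j) = (if i = j then 1 else 0)"
    "L2_dense M (L2_span e I) V"
  using assms by (simp_all add: orthonormal_basis_def)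

lemma L2_denseD:
  assumes "L2_dense M D V" "f \<in> V" "\<epsilon> > 0"
  obtains g where "g \<in> D" "L2_dist M f g < \<epsilon>"
  using assms unfolding L2_dense_def by blast

lemma L2_closed_subspace_has_L2_sum:
  assumes V: "L2_closed_subspace M V" and sum: "has_L2_sum M g I s" and g: "\<And>i. i \<in> I \<Longrightarrow> g i \<in> V"
  shows "s \<in> V"
proof (rule L2_closed_subspace_approx[OF V])
  show "s \<in> L2 M" using sum by (simp add: has_L2_sum_def)
  fix \<epsilon> :: real assume \<epsilon>: "\<epsilon> > 0"
  have "((\<lambda>F. L2_dist M (\<lambda>x. \<Sum>i\<in>F. g i x) s) \<longlongrightarrow> 0) (finite_subsets_at_top I)"
    using sum by (simp add: has_L2_sum_def)
  then have "eventually (\<lambda>F. L2_dist M (\<lambda>x. \<Sum>i\<in>F. g i x) s < \<epsilon>) (finite_subsets_at_top I)"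
    using \<epsilon> by (rule order_tendstoD)
  then obtain F where F: "finite F" "F \<subseteq> I" "L2_dist M (\<lambda>x. \<Sum>i\<in>F. g i x) s < \<epsilon>"
    unfolding eventually_finite_subsets_at_top by blast
  have "(\<lambda>x. \<Sum>i\<in>F. 1 * g i x) \<in> V"
    by (rule L2_closed_subspace_lincomb[OF V]) (use F g in auto)
  then show "\<exists>u\<in>V. L2_dist M s u < \<epsilon>"
    using F by (intro bexI[of _ "\<lambda>x. \<Sum>i\<in>F. g i x"]) (simp_all add: L2_dist_commute)
qed

text \<open>The \<open>e i\<close> outside \<open>I\<close> are orthogonal to the span of the others
  and hence to \<open>U\<close>. For density, take a combination over \<open>J\<close> that
  approximates an element orthogonal to \<open>U\<close> and drop its part in \<open>U\<close>; this
  cannot increase the distance.\<close>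

lemma orthonormal_basis_complement:
  assumes V: "L2_closed_subspace M V" and U: "L2_closed_subspace M U"
    and J: "orthonormal_basis M e J V" and I: "orthonormal_basis M e I U" and IJ: "I \<subseteq> J"
  shows "orthonormal_basis M e (J - I) (L2_ominus M V U)"
proof -
  note VL = L2_closed_subspaceD(1)[OF V] and UL = L2_closed_subspaceD(1)[OF U]
  have eL: "e i \<in> L2 M" if "i \<in> J" for i using orthonormal_basisD(1)[OF J that] VL by blast
  have perp: "L2_inner M (e i) g = 0" if i: "i \<in> J - I" and g: "g \<in> U" for i g
  proof (rule ccontr)
    assume "L2_inner M (e i) g \<noteq> 0"
    then have pos: "cmod (L2_inner M (e i) g) > 0" by simp
    \<comment> \<open>The number to be refuted serves as tolerance: \<open>e i\<close> is a unit
      vector orthogonal to \<open>u\<close>, so by Cauchy-Schwarz this number is at most the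
      distance from \<open>g\<close> to \<open>u\<close>.\<close>
    obtain u where u: "u \<in> L2_span e I" "L2_dist M g u < cmod (L2_inner M (e i) g)"
      by (rule L2_denseD[OF orthonormal_basisD(3)[OF I] g pos])
    from u obtain F c where F: "finite F" "F \<subseteq> I" and ueq: "u = (\<lambda>x. \<Sum>i\<in>F. c i * e i x)"
      by (auto simp: L2_span_def)
    have uL: "u \<in> L2 M" unfolding ueq using F IJ eL by (intro L2_lincomb) auto
    have gL: "g \<in> L2 M" and iL: "e i \<in> L2 M" using g UL i eL by auto
    have "L2_inner M (e i) u = (\<Sum>k\<in>F. cnj (c k) * L2_inner M (e i) (e k))"
      unfolding ueq using F IJ eL i by (intro L2_inner_lincomb_right) auto
    also have "\<dots> = 0"
    proof (intro sum.neutral ballI)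
      fix k assume "k \<in> F"
      then have "k \<in> I" "k \<in> J" using F IJ by auto
      then show "cnj (c k) * L2_inner M (e i) (e k) = 0"
        using i orthonormal_basisD(2)[OF J, of i k] by (cases "i = k") auto
    qed
    finally have "L2_inner M (e i) g = L2_inner M (e i) (\<lambda>x. g x - u x)"
      using uL gL iL by (simp add: L2_inner_diff_right)
    then have "cmod (L2_inner M (e i) g) \<le> L2_norm M (e i) * L2_dist M g u"
      unfolding L2_dist_norm using L2_Cauchy_Schwarz[OF iL L2_diff[OF gL uL]] by simp
    also have "L2_norm M (e i) = 1"
    proof -
      have "(L2_norm M (e i))\<^sup>2 = 1" using orthonormal_basisD(2)[OF J, of i i] i by (simp add: L2_norm_sq)
      then show ?thesis using power2_eq_imp_eq[of "L2_norm M (e i)" 1] by simp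
    qed
    finally show False using u(2) by simp
  qed
  have W: "(\<lambda>x. \<Sum>i\<in>F. c i * e i x) \<in> L2_ominus M V U" if F: "F \<subseteq> J - I" for F c
  proof -
    have "(\<lambda>x. \<Sum>i\<in>F. c i * e i x) \<in> V"
      by (rule L2_closed_subspace_lincomb[OF V]) (use F orthonormal_basisD(1)[OF J] in auto)
    moreover have "L2_inner M (\<lambda>x. \<Sum>i\<in>F. c i * e i x) g = 0" if "g \<in> U" for g
    proof -
      have "L2_inner M (\<lambda>x. \<Sum>i\<in>F. c i * e i x) g = (\<Sum>i\<in>F. c i * L2_inner M (e i) g)"
        by (rule L2_inner_lincomb_left) (use F eL that UL in auto)
      also have "\<dots> = 0" using perp F that by (intro sum.neutral ballI) auto
      finally show ?thesis .
    qed
    ultimately show ?thesis by (simp add: L2_ominus_def)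
  qed
  show ?thesis
    unfolding orthonormal_basis_def L2_dense_def
  proof (intro conjI ballI allI impI)
    fix i assume "i \<in> J - I"
    then show "e i \<in> L2_ominus M V U"
      using perp orthonormal_basisD(1)[OF J, of i] by (simp add: L2_ominus_def)
  next
    fix i j assume "i \<in> J - I" "j \<in> J - I"
    then show "L2_inner M (e i) (e j) = (if i = j then 1 else 0)"
      by (intro orthonormal_basisD(2)[OF J]) auto
  next
    show "L2_span e (J - I) \<subseteq> L2_ominus M V U"
      using W by (auto simp: L2_span_def)
  next
    fix w and \<epsilon> :: real assume w: "w \<in> L2_ominus M V U" and \<epsilon>: "\<epsilon> > 0"
    have wV: "w \<in> V" and wU: "\<And>g. g \<in> U \<Longrightarrow> L2_inner M w g = 0" using w by (auto simp: L2_ominus_def)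
    obtain u where u: "u \<in> L2_span e J" "L2_dist M w u < \<epsilon>"
      by (rule L2_denseD[OF orthonormal_basisD(3)[OF J] wV \<epsilon>])
    from u obtain F c where F: "finite F" "F \<subseteq> J" and ueq: "u = (\<lambda>x. \<Sum>i\<in>F. c i * e i x)"
      by (auto simp: L2_span_def)
    define u1 u2 where "u1 = (\<lambda>x. \<Sum>i\<in>F \<inter> I. c i * e i x)" and "u2 = (\<lambda>x. \<Sum>i\<in>F - I. c i * e i x)"
    have u12: "u x = u2 x + u1 x" for x
      unfolding ueq u1_def u2_def using sum.Int_Diff[OF F(1), of "\<lambda>i. c i * e i x" I] by (simp add: add.commute)
    have u1: "u1 \<in> U"
      unfolding u1_def by (rule L2_closed_subspace_lincomb[OF U]) (use orthonormal_basisD(1)[OF I] in auto)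
    have u2: "u2 \<in> L2_ominus M V U" unfolding u2_def using F by (intro W) auto
    have L: "w \<in> L2 M" "u1 \<in> L2 M" "u2 \<in> L2 M"
      using wV VL u1 UL u2 by (auto simp: L2_ominus_def)
    \<comment> \<open>Pythagoras: \<open>w - u2\<close> is orthogonal to \<open>U\<close> and
      \<open>u1\<close> lies in \<open>U\<close>, so \<open>w - u\<close> has at least the norm of
      \<open>w - u2\<close>.\<close>
    have "L2_inner M (\<lambda>x. w x - u2 x) u1 = 0"
      using L wU[OF u1] u2 u1 by (simp add: L2_inner_diff_left L2_ominus_def)
    then have "(L2_norm M (\<lambda>x. (w x - u2 x) - u1 x))\<^sup>2 = (L2_norm M (\<lambda>x. w x - u2 x))\<^sup>2 + (L2_norm M u1)\<^sup>2"
      using L by (simp add: L2_norm_diff_sq L2_diff)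
    then have "(L2_norm M (\<lambda>x. w x - u2 x))\<^sup>2 \<le> (L2_norm M (\<lambda>x. (w x - u2 x) - u1 x))\<^sup>2" by simp
    then have "L2_dist M w u2 \<le> L2_dist M w u"
      unfolding L2_dist_norm u12 by (simp add: diff_diff_eq abs_le_square_iff[symmetric])
    moreover have "u2 \<in> L2_span e (J - I)" using F unfolding u2_def L2_span_def by blast
    ultimately show "\<exists>g\<in>L2_span e (J - I). L2_dist M w g < \<epsilon>"
      using u(2) by (intro bexI[of _ u2]) auto
  qed
qed

section \<open>Translations and dilations of square-integrable functions\<close>

lemma L2_lborel_translation:
  fixes g :: "real ^ 'd \<Rightarrow> complex"
  assumes "g \<in> L2 lborel"
  shows "(\<lambda>x. g (x - c)) \<in> L2 lborel"
proof -
  have [measurable]: "g \<in> borel_measurable borel" using assms by (simp add: L2_def)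
  have "integrable lborel (\<lambda>x. (cmod (g (x + (- c))))\<^sup>2)"
    by (rule integrable_lborel_translation) (use assms in \<open>simp_all add: L2_def\<close>)
  then show ?thesis by (simp add: L2_def)
qed

lemma L2_dist_lborel_translation:
  fixes g g' :: "real ^ 'd \<Rightarrow> complex"
  assumes "g \<in> L2 lborel" "g' \<in> L2 lborel"
  shows "L2_dist lborel (\<lambda>x. g (x - c)) (\<lambda>x. g' (x - c)) = L2_dist lborel g g'"
proof -
  have [measurable]: "g \<in> borel_measurable borel" "g' \<in> borel_measurable borel"
    using assms by (simp_all add: L2_def)
  show ?thesis
    using integral_lborel_translation[of "\<lambda>x. (cmod (g x - g' x))\<^sup>2" "- c"] by (simp add: L2_dist_def)
qed

lemma has_L2_sum_translation:
  fixes g :: "'i \<Rightarrow> real ^ 'd \<Rightarrow> complex"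
  assumes "has_L2_sum lborel g I s"
  shows "has_L2_sum lborel (\<lambda>i x. g i (x - c)) I (\<lambda>x. s (x - c))"
proof -
  have g: "\<And>i. i \<in> I \<Longrightarrow> g i \<in> L2 lborel" and s: "s \<in> L2 lborel"
    and lim: "((\<lambda>F. L2_dist lborel (\<lambda>x. \<Sum>i\<in>F. g i x) s) \<longlongrightarrow> 0) (finite_subsets_at_top I)"
    using assms by (auto simp: has_L2_sum_def)
  have "((\<lambda>F. L2_dist lborel (\<lambda>x. \<Sum>i\<in>F. g i (x - c)) (\<lambda>x. s (x - c))) \<longlongrightarrow> 0) (finite_subsets_at_top I)"
  proof (rule Lim_transform_eventually[OF lim], rule eventually_finite_subsets_at_top_weakI)
    fix F assume "finite F" "F \<subseteq> I"
    then show "L2_dist lborel (\<lambda>x. \<Sum>i\<in>F. g i x) s = L2_dist lborel (\<lambda>x. \<Sum>i\<in>F. g i (x - c)) (\<lambda>x. s (x - c))"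
      using g s by (intro L2_dist_lborel_translation[symmetric] L2_sum) auto
  qed
  then show ?thesis using g s by (simp add: has_L2_sum_def L2_lborel_translation)
qed

lemma L2_lborel_matrix:
  fixes g :: "real ^ 'd \<Rightarrow> complex"
  assumes "det A \<noteq> 0" "g \<in> L2 lborel"
  shows "(\<lambda>x. g (A *v x)) \<in> L2 lborel"
proof -
  have [measurable]: "g \<in> borel_measurable borel" using assms by (simp add: L2_def)
  show ?thesis
    using integrable_lborel_matrix_iff[OF assms(1), of "\<lambda>x. (cmod (g x))\<^sup>2"] assms by (simp add: L2_def)
qed

lemma L2_inner_lborel_matrix:
  fixes g g' :: "real ^ 'd \<Rightarrow> complex"
  assumes "det A \<noteq> 0" "g \<in> L2 lborel" "g' \<in> L2 lborel"
  shows "L2_inner lborel g g' = complex_of_real \<bar>det A\<bar> * L2_inner lborel (\<lambda>x. g (A *v x)) (\<lambda>x. g' (A *v x))"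
proof -
  have [measurable]: "g \<in> borel_measurable borel" "g' \<in> borel_measurable borel"
    using assms by (simp_all add: L2_def)
  show ?thesis
    using integral_lborel_matrix[OF assms(1), of "\<lambda>x. g x * cnj (g' x)"]
    by (simp add: L2_inner_def scaleR_conv_of_real)
qed

lemma L2_dist_lborel_matrix:
  fixes g g' :: "real ^ 'd \<Rightarrow> complex"
  assumes "det A \<noteq> 0" "g \<in> L2 lborel" "g' \<in> L2 lborel"
  shows "L2_dist lborel g g' = sqrt \<bar>det A\<bar> * L2_dist lborel (\<lambda>x. g (A *v x)) (\<lambda>x. g' (A *v x))"
proof -
  have [measurable]: "g \<in> borel_measurable borel" "g' \<in> borel_measurable borel"
    using assms by (simp_all add: L2_def)
  show ?thesis
    using integral_lborel_matrix[OF assms(1), of "\<lambda>x. (cmod (g x - g' x))\<^sup>2"]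
    by (simp add: L2_dist_def real_sqrt_mult)
qed

section \<open>Digits of the dilation matrix itself\<close>

context dilation
begin

text \<open>The energy count runs over a digit set, while the column of interest belongs to an
  arbitrary lattice point \<open>k\<close>. Representatives of the cosets are therefore chosen with
  \<open>k\<close> forced for its own coset; \<open>rep\<close> acts on cosets as sets, so equal
  cosets share their representative.\<close>

lemma digit_set_containing:
  assumes k: "k \<in> int_lattice"
  obtains D where "digit_set A D" "k \<in> D"
proof -
  define C where "C x = {x + A *v m | m. m \<in> int_lattice}" for x
  have self: "x \<in> C x" for x
  proof -
    have "x = x + A *v 0" by simp
    then show ?thesis unfolding C_def using int_lattice_0 by blast
  qed
  have sub: "C y \<subseteq> C x" if "y \<in> C x" for x y
  proof
    from that obtain m where m: "m \<in> int_lattice" "y = x + A *v m" by (auto simp: C_def)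
    fix z assume "z \<in> C y"
    then obtain n where n: "n \<in> int_lattice" "z = y + A *v n" by (auto simp: C_def)
    then have "z = x + A *v (m + n)" by (simp add: m(2) matrix_vector_right_distrib)
    then show "z \<in> C x" unfolding C_def using int_lattice_add[OF m(1) n(1)] by blast
  qed
  have sym: "x \<in> C y" if "y \<in> C x" for x y
  proof -
    from that obtain m where m: "m \<in> int_lattice" "y = x + A *v m" by (auto simp: C_def)
    then have "x = y + A *v (- m)" by (simp add: linear_neg[OF matrix_vector_mul_linear])
    then show ?thesis unfolding C_def using int_lattice_uminus[OF m(1)] by blast
  qed
  have Ceq: "C y = C x" if "y \<in> C x" for x y
    using sub[OF that] sub[OF sym[OF that]] by (rule subset_antisym)
  define rep where "rep S = (if k \<in> S then k else (SOME y. y \<in> S))" for S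
  have rep: "rep (C x) \<in> C x" for x
    using self[of x] by (auto simp: rep_def intro: someI)
  define D where "D = (\<lambda>x. rep (C x)) ` int_lattice"
  have CL: "C x \<subseteq> int_lattice" if "x \<in> int_lattice" for x
    using that lattice_A int_lattice_add by (auto simp: C_def)
  have "digit_set A D"
    unfolding digit_set_def C_def[symmetric]
  proof (intro conjI ballI)
    show "D \<subseteq> int_lattice" unfolding D_def using rep CL by blast
    fix x :: "real ^ 'd" assume x: "x \<in> int_lattice"
    show "\<exists>!\<mu>. \<mu> \<in> D \<and> \<mu> \<in> C x"
    proof (rule ex1I)
      show "rep (C x) \<in> D \<and> rep (C x) \<in> C x" using x rep by (simp add: D_def)
      fix \<mu> assume "\<mu> \<in> D \<and> \<mu> \<in> C x"
      then obtain y where y: "\<mu> = rep (C y)" "rep (C y) \<in> C x" by (auto simp: D_def)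
      have "C y = C x" using Ceq[OF y(2)] Ceq[OF rep[of y]] by simp
      then show "\<mu> = rep (C x)" using y(1) by simp
    qed
  qed
  moreover have "k \<in> D"
  proof -
    have "rep (C k) = k" using self[of k] by (simp add: rep_def)
    then show ?thesis unfolding D_def by (intro image_eqI[OF _ k]) simp
  qed
  ultimately show ?thesis by (rule that)
qed

text \<open>Division with remainder by \<open>A\<close>. The minus sign matches the index
  \<open>k - A *v m\<close> at which coefficients occur in inner products of packets with dilated
  functions.\<close>

lemma digit_set_bij:
  assumes D: "digit_set A D"
  shows "bij_betw (\<lambda>(k, m). k - A *v m) (D \<times> int_lattice) int_lattice"
proof (intro bij_betw_imageI inj_onI subset_antisym subsetI)
  have Dl: "D \<subseteq> int_lattice" using D unfolding digit_set_def by (rule conjunct1)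
  have ex1: "\<exists>!\<mu>. \<mu> \<in> D \<and> \<mu> \<in> {x + A *v m | m. m \<in> int_lattice}" if "x \<in> int_lattice" for x
    using conjunct2[OF D[unfolded digit_set_def]] that by (rule bspec)
  fix p q assume p: "p \<in> D \<times> int_lattice" and q: "q \<in> D \<times> int_lattice"
    and eq: "(case p of (k, m) \<Rightarrow> k - A *v m) = (case q of (k, m) \<Rightarrow> k - A *v m)"
  obtain k m where pk: "p = (k, m)" by (cases p)
  obtain k' m' where qk: "q = (k', m')" by (cases q)
  note pq = pk qk
  have mem: "k \<in> D" "m \<in> int_lattice" "k' \<in> D" "m' \<in> int_lattice" using p q pq by auto
  define x where "x = k - A *v m"
  have x: "x \<in> int_lattice" unfolding x_def using mem Dl by (intro int_lattice_diff lattice_A) auto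
  have "x = k' - A *v m'" using eq by (simp add: pq x_def)
  then have kk': "k' = x + A *v m'" by simp
  have kk: "k = x + A *v m" by (simp add: x_def)
  have in_coset: "k \<in> {x + A *v m | m. m \<in> int_lattice}" "k' \<in> {x + A *v m | m. m \<in> int_lattice}"
    using kk kk' mem by blast+
  have "k = k'"
    using the1_equality[OF ex1[OF x] conjI[OF mem(1) in_coset(1)]]
      the1_equality[OF ex1[OF x] conjI[OF mem(3) in_coset(2)]] by (rule trans[OF sym])
  moreover then have "m = m'" using kk kk' A_inj by simp
  ultimately show "p = q" by (simp add: pq)
next
  fix x assume "x \<in> (\<lambda>(k, m). k - A *v m) ` (D \<times> int_lattice)"
  moreover have "D \<subseteq> int_lattice" using D unfolding digit_set_def by (rule conjunct1)
  ultimately show "x \<in> int_lattice" by (auto intro!: int_lattice_diff lattice_A)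
next
  fix x :: "real ^ 'd" assume "x \<in> int_lattice"
  with conjunct2[OF D[unfolded digit_set_def]]
  have "\<exists>!\<mu>. \<mu> \<in> D \<and> \<mu> \<in> {x + A *v m | m. m \<in> int_lattice}" by (rule bspec)
  from ex1_implies_ex[OF this] obtain \<mu> m where "\<mu> \<in> D" "m \<in> int_lattice" "\<mu> = x + A *v m" by blast
  then show "x \<in> (\<lambda>(k, m). k - A *v m) ` (D \<times> int_lattice)"
    by (intro image_eqI[of _ _ "(\<mu>, m)"]) auto
qed

end


section \<open>Packet bases\<close>

locale packet_system = dilation A for A :: "real ^ 'd ^ 'd" +
  fixes K :: "(real ^ 'd) set"
    and V :: "int \<Rightarrow> (real ^ 'd \<Rightarrow> complex) set"
    and \<phi> :: "'l::finite \<Rightarrow> real ^ 'd \<Rightarrow> complex"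
    and h :: "nat \<Rightarrow> 'l \<Rightarrow> 'l \<Rightarrow> real ^ 'd \<Rightarrow> complex"
    and H :: "nat \<Rightarrow> real ^ 'd \<Rightarrow> complex ^ 'l ^ 'l"
    and f :: "nat \<Rightarrow> 'l \<Rightarrow> real ^ 'd \<Rightarrow> complex"
  assumes digits: "digit_set (transpose A) K"
    and mra: "MRA A V \<phi>"
    and filters: "packet_filters A K \<phi> h H"
    and packets: "basic_multiwavelet_packets A \<phi> h f"
begin

abbreviation a :: nat where "a \<equiv> dilation_index A"

definition packet :: "nat \<times> 'l \<times> (real ^ 'd) \<Rightarrow> real ^ 'd \<Rightarrow> complex" where
  "packet = (\<lambda>(n, l, k) x. f n l (x - k))"

definition dilated :: "nat \<Rightarrow> 'l \<Rightarrow> real ^ 'd \<Rightarrow> real ^ 'd \<Rightarrow> complex" where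
  "dilated r j k x = complex_of_real (sqrt (real a)) * f r j (A *v x - k)"

abbreviation packet_basis :: "nat set \<Rightarrow> int \<Rightarrow> bool" where
  "packet_basis N j \<equiv> orthonormal_basis lborel packet (N \<times> UNIV \<times> int_lattice) (V j)"

lemma V_closed: "L2_closed_subspace lborel (V j)"
  and V_Suc: "V j \<subseteq> V (j + 1)"
  and V_dense: "L2_dense lborel (\<Union>j. V j) (L2 lborel)"
  and V_Inter: "(\<Inter>j. V j) = {g \<in> L2 lborel. AE x in lborel. g x = 0}"
  and V_dilate: "g \<in> L2 lborel \<Longrightarrow> g \<in> V j \<longleftrightarrow> (\<lambda>x. g (A *v x)) \<in> V (j + 1)"
  and V_basis: "orthonormal_basis lborel (\<lambda>(l, k) x. \<phi> l (x - k)) (UNIV \<times> int_lattice) (V 0)"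
  using mra unfolding MRA_def by blast+

lemma V_L2: "V j \<subseteq> L2 lborel"
  by (rule L2_closed_subspaceD(1)[OF V_closed])

lemma V_mono: "i \<le> j \<Longrightarrow> V i \<subseteq> V j"
proof (induction j rule: int_ge_induct)
  case (step j)
  then show ?case using V_Suc[of j] by (rule_tac subset_trans)
qed simp

lemma sqrt_a: "complex_of_real (sqrt (real a)) \<noteq> 0" "complex_of_real (sqrt (real a)) * complex_of_real (sqrt (real a)) = complex_of_nat a"
  using index_pos by (simp_all flip: of_real_mult)

text \<open>The dilation by \<open>A\<close> with the factor \<open>sqrt a\<close> is unitary and
  maps \<open>V j\<close> onto \<open>V (j + 1)\<close>.\<close>

lemma orthonormal_basis_dilate:
  assumes e: "orthonormal_basis lborel e I (V j)"
  shows "orthonormal_basis lborel (\<lambda>i x. complex_of_real (sqrt (real a)) * e i (A *v x)) I (V (j + 1))"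
proof -
  define d where "d i x = complex_of_real (sqrt (real a)) * e i (A *v x)" for i x
  have eL: "e i \<in> L2 lborel" if "i \<in> I" for i using orthonormal_basisD(1)[OF e that] V_L2 by blast
  have dV: "d i \<in> V (j + 1)" if "i \<in> I" for i
    using orthonormal_basisD(1)[OF e that] V_dilate[OF eL[OF that]] L2_closed_subspaceD(4)[OF V_closed]
    unfolding d_def[abs_def] by blast
  have orth: "L2_inner lborel (d i) (d i') = (if i = i' then 1 else 0)" if "i \<in> I" "i' \<in> I" for i i'
  proof -
    have "L2_inner lborel (d i) (d i')
        = complex_of_nat a * L2_inner lborel (\<lambda>x. e i (A *v x)) (\<lambda>x. e i' (A *v x))"
    proof -
      have "d i x * cnj (d i' x) = complex_of_nat a * (e i (A *v x) * cnj (e i' (A *v x)))" for x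
        by (simp add: d_def sqrt_a(2)[symmetric] mult_ac)
      then show ?thesis by (simp add: L2_inner_def)
    qed
    also have "\<dots> = L2_inner lborel (e i) (e i')"
      using L2_inner_lborel_matrix[OF det_A eL[OF that(1)] eL[OF that(2)]] by (simp flip: index_A)
    finally show ?thesis using orthonormal_basisD(2)[OF e that] by simp
  qed
  have dense: "L2_dense lborel (L2_span d I) (V (j + 1))"
    unfolding L2_dense_def
  proof (intro conjI ballI allI impI)
    show "L2_span d I \<subseteq> V (j + 1)" by (rule L2_span_subset[OF V_closed dV])
    fix g and \<epsilon> :: real assume g: "g \<in> V (j + 1)" and \<epsilon>: "\<epsilon> > 0"
    \<comment> \<open>The pullback of \<open>g\<close> to scale \<open>j\<close>. Distances there
      are larger by \<open>sqrt a\<close>, hence the tolerance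
      \<open>\<epsilon> * sqrt (real a)\<close>.\<close>
    define g' where "g' x = g (matrix_inv A *v x)" for x
    have gA: "(\<lambda>x. g' (A *v x)) = g" by (simp add: g'_def matrix_inv_vec[OF det_A])
    have det': "det (matrix_inv A) \<noteq> 0" using det_A by (simp add: det_matrix_inv)
    have gL: "g' \<in> L2 lborel"
      unfolding g'_def[abs_def] using g V_L2 by (intro L2_lborel_matrix[OF det']) auto
    then have "g' \<in> V j" using V_dilate[of g' j] g gA by simp
    moreover have "\<epsilon> * sqrt (real a) > 0" using \<epsilon> index_pos by simp
    ultimately obtain u where u: "u \<in> L2_span e I" "L2_dist lborel g' u < \<epsilon> * sqrt (real a)"
      by (rule L2_denseD[OF orthonormal_basisD(3)[OF e]])
    from u(1) obtain F c where F: "finite F" "F \<subseteq> I" and ueq: "u = (\<lambda>x. \<Sum>i\<in>F. c i * e i x)"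
      by (auto simp: L2_span_def)
    have uL: "u \<in> L2 lborel" unfolding ueq using F eL by (intro L2_lincomb) auto
    have "L2_dist lborel g' u = sqrt (real a) * L2_dist lborel g (\<lambda>x. u (A *v x))"
      using L2_dist_lborel_matrix[OF det_A gL uL] by (simp add: gA index_A)
    then have "L2_dist lborel g (\<lambda>x. u (A *v x)) < \<epsilon>"
      using u(2) index_pos by (simp add: mult.commute)
    moreover have "(\<lambda>x. u (A *v x)) = (\<lambda>x. \<Sum>i\<in>F. c i / complex_of_real (sqrt (real a)) * d i x)"
      unfolding ueq d_def using sqrt_a(1) by simp
    then have "(\<lambda>x. u (A *v x)) \<in> L2_span d I" by (simp only: L2_spanI[OF F])
    ultimately show "\<exists>g'\<in>L2_span d I. L2_dist lborel g g' < \<epsilon>" by blast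
  qed
  show ?thesis
    using dV orth dense unfolding orthonormal_basis_def d_def[abs_def] by blast
qed

lemma dilated_basis:
  assumes "packet_basis N j"
  shows "orthonormal_basis lborel (\<lambda>(r, l, k). dilated r l k) (N \<times> UNIV \<times> int_lattice) (V (j + 1))"
proof -
  have "(\<lambda>i x. complex_of_real (sqrt (real a)) * packet i (A *v x)) = (\<lambda>(r, l, k). dilated r l k)"
    by (auto simp: packet_def dilated_def fun_eq_iff)
  then show ?thesis using orthonormal_basis_dilate[OF assms] by simp
qed

text \<open>Division by \<open>a\<close> splits \<open>n\<close> into the filter index and the index
  of the preceding packet. Replacing \<open>x\<close> by \<open>x - m\<close> in
  \<open>A *v x - k\<close> adds \<open>A *v m\<close> to the index \<open>k\<close>.\<close>

lemma packet_expansion: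
  "has_L2_sum lborel (\<lambda>(j, k) x. h (n mod a) l j k * dilated (n div a) j (k + A *v m) x)
     (UNIV \<times> int_lattice) (packet (n, l, m))"
proof -
  have "n mod a < a" using index_pos by simp
  then have "refines A (h (n mod a) l) (f (n div a)) (f (n mod a + a * (n div a)) l)"
    using packets unfolding basic_multiwavelet_packets_def by blast
  then have "has_L2_sum lborel
       (\<lambda>(j, k) x. h (n mod a) l j k * complex_of_real (sqrt (real a)) * f (n div a) j (A *v x - k))
       (UNIV \<times> int_lattice) (f n l)"
    unfolding refines_def by simp
  from has_L2_sum_translation[OF this, of m]
  have "has_L2_sum lborel
       (\<lambda>i x. (case i of (j, k) \<Rightarrow> \<lambda>x. h (n mod a) l j k * complex_of_real (sqrt (real a)) * f (n div a) j (A *v x - k)) (x - m))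
       (UNIV \<times> int_lattice) (packet (n, l, m))"
    by (simp add: packet_def)
  moreover have "(\<lambda>i x. (case i of (j, k) \<Rightarrow> \<lambda>x. h (n mod a) l j k * complex_of_real (sqrt (real a)) * f (n div a) j (A *v x - k)) (x - m))
      = (\<lambda>(j, k) x. h (n mod a) l j k * dilated (n div a) j (k + A *v m) x)"
    by (auto simp: fun_eq_iff dilated_def matrix_vector_mult_diff_distrib algebra_simps)
  ultimately show ?thesis by simp
qed

section \<open>One refinement step: inner products of packets\<close>

context
  fixes N :: "nat set" and j :: int
  assumes basis: "packet_basis N j"
begin

lemma dilated_L2: "r \<in> N \<Longrightarrow> k \<in> int_lattice \<Longrightarrow> dilated r l k \<in> L2 lborel"
  using orthonormal_basisD(1)[OF dilated_basis[OF basis], of "(r, l, k)"] V_L2 by auto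

lemma dilated_inner:
  assumes "r \<in> N" "k \<in> int_lattice" "r' \<in> N" "k' \<in> int_lattice"
  shows "L2_inner lborel (dilated r l k) (dilated r' l' k') = (if r = r' \<and> l = l' \<and> k = k' then 1 else 0)"
  using orthonormal_basisD(2)[OF dilated_basis[OF basis], of "(r, l, k)" "(r', l', k')"] assms by simp

lemma packet_in_V:
  assumes "n div a \<in> N" "m \<in> int_lattice"
  shows "packet (n, l, m) \<in> V (j + 1)"
proof (rule L2_closed_subspace_has_L2_sum[OF V_closed packet_expansion])
  fix i :: "'l \<times> (real ^ 'd)" assume "i \<in> UNIV \<times> int_lattice"
  then obtain l' k where i: "i = (l', k)" "k \<in> int_lattice" by auto
  then have "k + A *v m \<in> int_lattice" using assms by (intro int_lattice_add lattice_A)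
  then have "dilated (n div a) l' (k + A *v m) \<in> V (j + 1)"
    using orthonormal_basisD(1)[OF dilated_basis[OF basis], of "(n div a, l', k + A *v m)"] assms by simp
  then show "(case i of (l', k) \<Rightarrow> \<lambda>x. h (n mod a) l l' k * dilated (n div a) l' (k + A *v m) x) \<in> V (j + 1)"
    using L2_closed_subspaceD(4)[OF V_closed] by (simp add: i(1))
qed

lemma packet_L2: "n div a \<in> N \<Longrightarrow> m \<in> int_lattice \<Longrightarrow> packet (n, l, m) \<in> L2 lborel"
  using packet_in_V V_L2 by blast

text \<open>At most one term of the expansion survives, the one whose shifted index
  \<open>k1 + A *v m\<close> equals \<open>k\<close>; it exists for the component \<open>l'\<close>
  when the dilated function comes from the packet preceding \<open>n\<close>.\<close>

lemma packet_dilated_inner: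
  assumes n: "n div a \<in> N" and m: "m \<in> int_lattice" and r: "r \<in> N" and k: "k \<in> int_lattice"
  shows "L2_inner lborel (packet (n, l, m)) (dilated r l' k)
    = (if n div a = r then h (n mod a) l l' (k - A *v m) else 0)"
proof -
  have km: "k - A *v m \<in> int_lattice" using k m by (intro int_lattice_diff lattice_A)
  have "has_L2_sum lborel (\<lambda>i x. (case i of (l', k) \<Rightarrow> h (n mod a) l l' k) * (case i of (l', k) \<Rightarrow> dilated (n div a) l' (k + A *v m)) x)
     (UNIV \<times> int_lattice) (packet (n, l, m))"
    using packet_expansion[of n l m] by (simp add: case_prod_unfold)
  moreover have "L2_inner lborel (case i of (l', k) \<Rightarrow> dilated (n div a) l' (k + A *v m)) (dilated r l' k) =
      (if i = (l', k - A *v m) then if n div a = r then 1 else 0 else 0)" if i: "i \<in> UNIV \<times> int_lattice" for i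
  proof -
    obtain l1 k1 where i1: "i = (l1, k1)" "k1 \<in> int_lattice" using i by auto
    have "k1 + A *v m \<in> int_lattice" using i1 m by (intro int_lattice_add lattice_A)
    moreover have "k1 + A *v m = k \<longleftrightarrow> k1 = k - A *v m" by (auto simp: algebra_simps)
    ultimately show ?thesis using dilated_inner[OF n _ r k, of "k1 + A *v m" l1 l'] by (simp add: i1(1))
  qed
  ultimately have "L2_inner lborel (packet (n, l, m)) (dilated r l' k)
      = (if (l', k - A *v m) \<in> UNIV \<times> int_lattice
         then (if n div a = r then 1 else 0) * (case (l', k - A *v m) of (l', k) \<Rightarrow> h (n mod a) l l' k) else 0)"
    by (intro has_L2_sum_coeff[OF _ dilated_L2[OF r k]])
  then show ?thesis using km by simp
qed

text \<open>Only the first packet is expanded. Packets with different quotients by \<open>a\<close>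
  live on orthogonal parts of the dilated system; for equal quotients the series is the shifted
  product of two filter rows, with shift \<open>m - m'\<close>.\<close>

lemma packet_inner:
  assumes n: "n div a \<in> N" and m: "m \<in> int_lattice" and n': "n' div a \<in> N" and m': "m' \<in> int_lattice"
  shows "L2_inner lborel (packet (n, l, m)) (packet (n', l', m')) = (if (n, l, m) = (n', l', m') then 1 else 0)"
proof -
  let ?I = "L2_inner lborel (packet (n, l, m)) (packet (n', l', m'))"
  define c where "c l1 k1 = h (n mod a) l l1 k1 * (if n' div a = n div a then cnj (h (n' mod a) l' l1 (k1 + A *v (m - m'))) else 0)" for l1 k1
  have sum: "((\<lambda>(l1, k1). c l1 k1) has_sum ?I) (UNIV \<times> int_lattice)"
  proof -
    have eq: "L2_inner lborel (case i of (l1, k1) \<Rightarrow> \<lambda>x. h (n mod a) l l1 k1 * dilated (n div a) l1 (k1 + A *v m) x) (packet (n', l', m'))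
        = (case i of (l1, k1) \<Rightarrow> c l1 k1)" if i: "i \<in> UNIV \<times> int_lattice" for i
    proof -
      obtain l1 k1 where i1: "i = (l1, k1)" "k1 \<in> int_lattice" using i by auto
      have k1: "k1 + A *v m \<in> int_lattice" using i1 m by (intro int_lattice_add lattice_A)
      have "L2_inner lborel (dilated (n div a) l1 (k1 + A *v m)) (packet (n', l', m'))
          = cnj (if n' div a = n div a then h (n' mod a) l' l1 (k1 + A *v m - A *v m') else 0)"
        by (subst L2_inner_commute) (simp add: packet_dilated_inner[OF n' m' n k1])
      moreover have "k1 + A *v m - A *v m' = k1 + A *v (m - m')"
        by (simp add: matrix_vector_mult_diff_distrib)
      ultimately show ?thesis by (simp only: i1(1) c_def L2_inner_cmult_left prod.case if_distrib[of cnj] complex_cnj_zero)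
    qed
    show ?thesis
      using has_L2_sum_inner[OF packet_expansion[of n l m] packet_L2[OF n' m', of l']]
      by (subst (asm) has_sum_cong[OF eq]) auto
  qed
  show ?thesis
  proof (cases "n' div a = n div a")
    case False
    then have "((\<lambda>(l1, k1). c l1 k1) has_sum 0) (UNIV \<times> int_lattice)"
      by (intro has_sum_0) (auto simp: c_def)
    with sum have "?I = 0" by (rule has_sum_unique)
    then show ?thesis using False by auto
  next
    case True
    have mm: "m - m' \<in> int_lattice" using m m' by (rule int_lattice_diff)
    have na: "n mod a < a" "n' mod a < a" using index_pos by simp_all
    obtain S where S: "\<And>l1. ((\<lambda>k. h (n mod a) l l1 k * cnj (h (n' mod a) l' l1 (k + A *v (m - m')))) has_sum S l1) int_lattice"
      and S1: "(\<Sum>l1\<in>UNIV. S l1) = (if n mod a = n' mod a \<and> l = l' \<and> m - m' = 0 then 1 else 0)"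
      by (rule packet_filters_orthonormal[OF digits filters na mm, where l = l and l' = l']) (rule that)
    \<comment> \<open>Group the double series by component: the inner series have the sums
      \<open>S l1\<close>, and the finite outer sum is the one that the filter identity
      evaluates.\<close>
    have "(S has_sum ?I) UNIV"
      by (rule has_sum_SigmaD[OF sum]) (use S True in \<open>simp add: c_def\<close>)
    then have "?I = (\<Sum>l1\<in>UNIV. S l1)"
      by (rule has_sum_unique[OF _ has_sum_finite]) simp
    moreover have "n = n' \<longleftrightarrow> n mod a = n' mod a"
      using True by (metis div_mult_mod_eq)
    ultimately show ?thesis using S1 by simp
  qed
qed

end

end

section \<open>Completeness of one refinement step\<close>

context packet_system
begin

lemma coeff_summable: "s < a \<Longrightarrow> (\<lambda>k. (cmod (h s l j k))\<^sup>2) summable_on int_lattice"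
  using filters unfolding packet_filters_def by blast

text \<open>By \<open>packet_dilated_inner\<close> the terms are the squared inner products of
  \<open>dilated r j k\<close> with the translates of component \<open>l\<close> of the packet
  \<open>s + a * r\<close>. This is the share of the squared norm captured by one filter row, the
  same for every admissible \<open>r\<close>.\<close>

definition coset_energy :: "nat \<Rightarrow> 'l \<Rightarrow> 'l \<Rightarrow> real ^ 'd \<Rightarrow> real" where
  "coset_energy s l j k = (\<Sum>\<^sub>\<infinity>m\<in>int_lattice. (cmod (h s l j (k - A *v m)))\<^sup>2)"

lemma coset_energy_has_sum:
  assumes "s < a" "k \<in> int_lattice"
  shows "((\<lambda>m. (cmod (h s l j (k - A *v m)))\<^sup>2) has_sum coset_energy s l j k) int_lattice"
proof -
  have inj: "inj_on (\<lambda>m. k - A *v m) int_lattice" by (rule inj_onI) (simp add: A_inj)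
  have "(\<lambda>m. k - A *v m) ` int_lattice \<subseteq> int_lattice"
    using assms by (auto intro!: int_lattice_diff lattice_A)
  then have "(\<lambda>k. (cmod (h s l j k))\<^sup>2) summable_on (\<lambda>m. k - A *v m) ` int_lattice"
    by (rule summable_on_subset_banach[OF coeff_summable[OF assms(1)]])
  then have "(\<lambda>m. (cmod (h s l j (k - A *v m)))\<^sup>2) summable_on int_lattice"
    by (simp add: summable_on_reindex[OF inj] o_def)
  then show ?thesis unfolding coset_energy_def by (rule has_sum_infsum)
qed

lemma coset_energy_sum_has_sum:
  assumes "k \<in> int_lattice"
  shows "((\<lambda>m. \<Sum>s<a. \<Sum>l\<in>UNIV. (cmod (h s l j (k - A *v m)))\<^sup>2) has_sum (\<Sum>s<a. \<Sum>l\<in>UNIV. coset_energy s l j k)) int_lattice"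
proof -
  have fin: "((\<lambda>m. \<Sum>i\<in>I. g i m) has_sum (\<Sum>i\<in>I. S i)) B"
    if "finite I" "\<And>i. i \<in> I \<Longrightarrow> (g i has_sum S i) B"
    for g :: "'i \<Rightarrow> 'b \<Rightarrow> real" and S I B
    using that by (induction I) (simp_all add: has_sum_add)
  show ?thesis
    by (intro fin coset_energy_has_sum assms) auto
qed

text \<open>The diagonal case of \<open>packet_filters_orthonormal\<close>: for equal rows and shift
  0 the products are squared moduli.\<close>

lemma sum_coeff_norm:
  assumes s: "s < a"
  shows "(\<Sum>j\<in>UNIV. \<Sum>\<^sub>\<infinity>k\<in>int_lattice. (cmod (h s l j k))\<^sup>2) = 1"
proof -
  obtain S where S: "\<And>j. ((\<lambda>k. h s l j k * cnj (h s l j (k + A *v 0))) has_sum S j) int_lattice"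
    and S1: "(\<Sum>j\<in>UNIV. S j) = (if s = s \<and> l = l \<and> (0 :: real ^ 'd) = 0 then 1 else 0)"
    by (rule packet_filters_orthonormal[OF digits filters s s int_lattice_0, where l = l and l' = l]) (rule that)
  have "S j = complex_of_real (\<Sum>\<^sub>\<infinity>k\<in>int_lattice. (cmod (h s l j k))\<^sup>2)" for j
  proof (rule has_sum_unique)
    show "((\<lambda>k. complex_of_real ((cmod (h s l j k))\<^sup>2)) has_sum S j) int_lattice"
      using S[of j] by (simp add: complex_norm_square del: of_real_power)
    show "((\<lambda>k. complex_of_real ((cmod (h s l j k))\<^sup>2)) has_sum
        complex_of_real (\<Sum>\<^sub>\<infinity>k\<in>int_lattice. (cmod (h s l j k))\<^sup>2)) int_lattice"
      by (rule has_sum_of_real[OF has_sum_infsum[OF coeff_summable[OF s]]])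
  qed
  then have "complex_of_real (\<Sum>j\<in>UNIV. \<Sum>\<^sub>\<infinity>k\<in>int_lattice. (cmod (h s l j k))\<^sup>2) = 1"
    using S1 by simp
  then show ?thesis using of_real_eq_1_iff by blast
qed

text \<open>Regroups the lattice sum of one filter sequence by division with remainder.\<close>

lemma sum_coset_energy:
  assumes D: "digit_set A D" and s: "s < a"
  shows "(\<Sum>k\<in>D. coset_energy s l j k) = (\<Sum>\<^sub>\<infinity>k\<in>int_lattice. (cmod (h s l j k))\<^sup>2)"
proof -
  have fin: "finite D" using digit_set_A[OF D] by simp
  have Dl: "D \<subseteq> int_lattice" using D unfolding digit_set_def by (rule conjunct1)
  have "((\<lambda>(k, m). (cmod (h s l j (k - A *v m)))\<^sup>2) has_sum (\<Sum>\<^sub>\<infinity>k\<in>int_lattice. (cmod (h s l j k))\<^sup>2)) (D \<times> int_lattice)"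
    using has_sum_reindex_bij_betw[OF digit_set_bij[OF D], of "\<lambda>k. (cmod (h s l j k))\<^sup>2"]
      has_sum_infsum[OF coeff_summable[OF s, of l j]] by (simp add: case_prod_unfold)
  then have "(coset_energy s l j has_sum (\<Sum>\<^sub>\<infinity>k\<in>int_lattice. (cmod (h s l j k))\<^sup>2)) D"
    by (rule has_sum_SigmaD) (use coset_energy_has_sum[OF s] Dl in auto)
  then show ?thesis
    using has_sum_finite[OF fin] by (rule has_sum_unique[symmetric])
qed

text \<open>The packets generated from \<open>r\<close> are the only ones that can meet
  \<open>dilated r j k\<close>; restricting the translations to a finite \<open>G\<close> makes the
  finite forms of Bessel's inequality and of the projection formula applicable.\<close>

definition packet_block :: "nat \<Rightarrow> (real ^ 'd) set \<Rightarrow> (nat \<times> 'l \<times> (real ^ 'd)) set" where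
  "packet_block r G = (\<lambda>(m, s, l). (s + a * r, l, m)) ` (G \<times> {..<a} \<times> UNIV)"

lemma packet_block_subset:
  "r \<in> N \<Longrightarrow> G \<subseteq> int_lattice \<Longrightarrow> packet_block r G \<subseteq> {n. n div a \<in> N} \<times> UNIV \<times> int_lattice"
  using index_pos by (auto simp: packet_block_def)

lemma finite_packet_block: "finite G \<Longrightarrow> finite (packet_block r G)"
  by (simp add: packet_block_def)

lemma packet_block_coeff_sum:
  assumes basis: "packet_basis N i" and r: "r \<in> N" and k: "k \<in> int_lattice" and G: "finite G" "G \<subseteq> int_lattice"
  shows "(\<Sum>i\<in>packet_block r G. (cmod (L2_inner lborel (packet i) (dilated r j k)))\<^sup>2)
    = (\<Sum>m\<in>G. \<Sum>s<a. \<Sum>l\<in>UNIV. (cmod (h s l j (k - A *v m)))\<^sup>2)"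
proof -
  have inj: "inj_on (\<lambda>(m, s, l). (s + a * r, l, m)) (G \<times> {..<a} \<times> UNIV)"
    by (auto simp: inj_on_def)
  have "(\<Sum>i\<in>packet_block r G. (cmod (L2_inner lborel (packet i) (dilated r j k)))\<^sup>2)
      = (\<Sum>(m, s, l)\<in>G \<times> {..<a} \<times> UNIV. (cmod (h s l j (k - A *v m)))\<^sup>2)"
    unfolding packet_block_def sum.reindex[OF inj] o_def
  proof (rule sum.cong[OF refl])
    fix x assume "x \<in> G \<times> {..<a} \<times> (UNIV :: 'l set)"
    then obtain m s l where x: "x = (m, s, l)" "m \<in> G" "s < a" by auto
    have "(s + a * r) div a = r" "(s + a * r) mod a = s" using x(3) index_pos by simp_all
    then show "(cmod (L2_inner lborel (packet (case x of (m, s, l) \<Rightarrow> (s + a * r, l, m))) (dilated r j k)))\<^sup>2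
        = (case x of (m, s, l) \<Rightarrow> (cmod (h s l j (k - A *v m)))\<^sup>2)"
      using packet_dilated_inner[OF basis, of "s + a * r" m r k l j] x G r k by auto
  qed
  then show ?thesis
    by (simp add: sum.cartesian_product)
qed

lemma packet_block_orthonormal:
  assumes basis: "packet_basis N i" and r: "r \<in> N" and G: "G \<subseteq> int_lattice"
    and x: "x \<in> packet_block r G" and y: "y \<in> packet_block r G"
  shows "packet x \<in> L2 lborel" "L2_inner lborel (packet x) (packet y) = (if x = y then 1 else 0)"
proof -
  obtain n l m where x': "x = (n, l, m)" by (rule prod_cases3)
  obtain n' l' m' where y': "y = (n', l', m')" by (rule prod_cases3)
  note xy = x' y'
  have "n div a \<in> N" "m \<in> int_lattice" "n' div a \<in> N" "m' \<in> int_lattice"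
    using packet_block_subset[OF r G] x y xy by auto
  then show "packet x \<in> L2 lborel" "L2_inner lborel (packet x) (packet y) = (if x = y then 1 else 0)"
    unfolding xy using packet_inner[OF basis] packet_L2[OF basis] by auto
qed

lemma dilated_norm:
  assumes "packet_basis N i" "r \<in> N" "k \<in> int_lattice"
  shows "(L2_norm lborel (dilated r j k))\<^sup>2 = 1"
  using dilated_inner[OF assms(1), of r k r k j j] assms by (simp add: L2_norm_sq)

text \<open>Bessel's inequality on finite blocks suffices, since a sum of nonnegative terms is
  bounded as soon as its finite partial sums are.\<close>

lemma sum_coset_energy_le:
  assumes basis: "packet_basis N i" and r: "r \<in> N" and k: "k \<in> int_lattice"
  shows "(\<Sum>s<a. \<Sum>l\<in>UNIV. coset_energy s l j k) \<le> 1"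
proof (rule has_sum_le_finite_sums[OF coset_energy_sum_has_sum[OF k]])
  fix G :: "(real ^ 'd) set" assume G: "finite G" "G \<subseteq> int_lattice"
  have "(\<Sum>i\<in>packet_block r G. (cmod (L2_inner lborel (packet i) (dilated r j k)))\<^sup>2) \<le> (L2_norm lborel (dilated r j k))\<^sup>2"
    by (rule Bessel_finite[OF finite_packet_block[OF G(1)] _ dilated_L2[OF basis r k]])
       (use packet_block_orthonormal[OF basis r G(2)] in auto)
  then show "(\<Sum>m\<in>G. \<Sum>s<a. \<Sum>l\<in>UNIV. (cmod (h s l j (k - A *v m)))\<^sup>2) \<le> 1"
    using packet_block_coeff_sum[OF basis r k G] dilated_norm[OF basis r k] by simp
qed

text \<open>
  Completeness is a counting argument. Over a set of digits for \<open>A\<close> and all components, the energies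
  add up to the number \<open>a * CARD('l)\<close> of filter rows, which is also the number of summands; none of
  them exceeds 1 by Bessel's inequality, so all of them equal 1.
\<close>

lemma sum_coset_energy_eq_1:
  assumes basis: "packet_basis N i" and r: "r \<in> N" and k: "k \<in> int_lattice"
  shows "(\<Sum>s<a. \<Sum>l\<in>UNIV. coset_energy s l j k) = 1"
proof -
  obtain D where D: "digit_set A D" "k \<in> D" using digit_set_containing[OF k] .
  have cD: "finite D" "card D = a" using digit_set_A[OF D(1)] by simp_all
  have Dl: "D \<subseteq> int_lattice" using D(1) unfolding digit_set_def by (rule conjunct1)
  define E where "E p = (\<Sum>s<a. \<Sum>l\<in>UNIV. coset_energy s l (fst p) (snd p))" for p
  have le: "E p \<le> 1" if "p \<in> UNIV \<times> D" for p
    using that Dl sum_coset_energy_le[OF basis r] by (auto simp: E_def)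
  have "(\<Sum>p\<in>UNIV \<times> D. E p) = (\<Sum>j\<in>UNIV. \<Sum>k\<in>D. \<Sum>s<a. \<Sum>l\<in>UNIV. coset_energy s l j k)"
    unfolding E_def by (subst sum.cartesian_product) (simp add: case_prod_unfold)
  also have "\<dots> = (\<Sum>j\<in>UNIV. \<Sum>s<a. \<Sum>l\<in>UNIV. \<Sum>k\<in>D. coset_energy s l j k)"
    by (rule sum.cong[OF refl], subst sum.swap, rule sum.cong[OF refl], rule sum.swap)
  also have "\<dots> = (\<Sum>s<a. \<Sum>l\<in>UNIV. \<Sum>j\<in>UNIV. \<Sum>k\<in>D. coset_energy s l j k)"
    by (subst sum.swap, rule sum.cong[OF refl], rule sum.swap)
  also have "\<dots> = (\<Sum>s<a. \<Sum>l\<in>(UNIV :: 'l set). 1)"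
    by (intro sum.cong refl) (simp add: sum_coset_energy[OF D(1)] sum_coeff_norm)
  also have "\<dots> = (\<Sum>p\<in>(UNIV :: 'l set) \<times> D. 1)"
    using cD by (simp add: card_cartesian_product)
  finally have "(\<Sum>p\<in>UNIV \<times> D. 1 - E p) = 0" by (simp add: sum_subtractf)
  moreover have "0 \<le> 1 - E p" if "p \<in> UNIV \<times> D" for p using le[OF that] by simp
  ultimately have "\<forall>p\<in>UNIV \<times> D. 1 - E p = 0"
    using cD(1) by (subst (asm) sum_nonneg_eq_0_iff) auto
  then have "1 - E (j, k) = 0" using D(2) by blast
  then show ?thesis by (simp add: E_def)
qed

lemma packet_basis_step:
  assumes basis: "packet_basis N i"
  shows "packet_basis {n. n div a \<in> N} (i + 1)"
  unfolding orthonormal_basis_def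
proof (intro conjI ballI)
  let ?J = "{n. n div a \<in> N} \<times> (UNIV :: 'l set) \<times> (int_lattice :: (real ^ 'd) set)"
  show mem: "packet x \<in> V (i + 1)" if "x \<in> ?J" for x
    using that packet_in_V[OF basis] by auto
  show "L2_inner lborel (packet x) (packet y) = (if x = y then 1 else 0)" if "x \<in> ?J" "y \<in> ?J" for x y
    using that packet_inner[OF basis] by (auto split: if_splits)
  note dil = dilated_basis[OF basis]
  show "L2_dense lborel (L2_span packet ?J) (V (i + 1))"
  proof (rule L2_dense_span_trans[OF orthonormal_basisD(3)[OF dil] V_closed])
    show "packet x \<in> V (i + 1)" if "x \<in> ?J" for x using mem[OF that] .
    show "(\<lambda>(r, l, k). dilated r l k) x \<in> V (i + 1)" if "x \<in> N \<times> UNIV \<times> int_lattice" for x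
      using orthonormal_basisD(1)[OF dil that] .
    fix x and \<epsilon> :: real assume x: "x \<in> N \<times> (UNIV :: 'l set) \<times> (int_lattice :: (real ^ 'd) set)" and \<epsilon>: "\<epsilon> > 0"
    obtain r j k where rjk: "x = (r, j, k)" by (rule prod_cases3)
    have r: "r \<in> N" and k: "k \<in> int_lattice" using x rjk by auto
    \<comment> \<open>The squared distance from the unit vector \<open>dilated r j k\<close> to the
      span of a block is 1 minus the energy in that block, so a finite block with energy above
      \<open>1 - \<epsilon>\<^sup>2\<close> is good enough.\<close>
    have "((\<lambda>m. \<Sum>s<a. \<Sum>l\<in>UNIV. (cmod (h s l j (k - A *v m)))\<^sup>2) has_sum 1) int_lattice"
      using coset_energy_sum_has_sum[OF k, of j] sum_coset_energy_eq_1[OF basis r k] by simp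
    moreover have "1 - \<epsilon>\<^sup>2 < 1" using \<epsilon> by simp
    ultimately have "eventually (\<lambda>G. 1 - \<epsilon>\<^sup>2 < (\<Sum>m\<in>G. \<Sum>s<a. \<Sum>l\<in>UNIV. (cmod (h s l j (k - A *v m)))\<^sup>2))
        (finite_subsets_at_top int_lattice)"
      unfolding has_sum_def by (rule order_tendstoD(1))
    then obtain G where G: "finite G" "G \<subseteq> int_lattice"
      and big: "1 - \<epsilon>\<^sup>2 < (\<Sum>m\<in>G. \<Sum>s<a. \<Sum>l\<in>UNIV. (cmod (h s l j (k - A *v m)))\<^sup>2)"
      unfolding eventually_finite_subsets_at_top by blast
    let ?u = "\<lambda>x. \<Sum>i\<in>packet_block r G. cnj (L2_inner lborel (packet i) (dilated r j k)) * packet i x"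
    have "(L2_dist lborel (dilated r j k) ?u)\<^sup>2
        = (L2_norm lborel (dilated r j k))\<^sup>2 - (\<Sum>i\<in>packet_block r G. (cmod (L2_inner lborel (packet i) (dilated r j k)))\<^sup>2)"
      by (rule orthonormal_projection_dist[OF finite_packet_block[OF G(1)] _ dilated_L2[OF basis r k]])
         (use packet_block_orthonormal[OF basis r G(2)] in auto)
    also have "\<dots> < \<epsilon>\<^sup>2"
      using big packet_block_coeff_sum[OF basis r k G] dilated_norm[OF basis r k] by simp
    finally have "L2_dist lborel (dilated r j k) ?u < \<epsilon>"
      using \<epsilon> by (intro power_less_imp_less_base[of _ 2 \<epsilon>]) auto
    moreover have "?u \<in> L2_span packet ?J"
      by (rule L2_spanI[OF finite_packet_block[OF G(1)] packet_block_subset[OF r G(2)]])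
    ultimately show "\<exists>u\<in>L2_span packet ?J. L2_dist lborel ((\<lambda>(r, l, k). dilated r l k) x) u < \<epsilon>"
      unfolding rjk by auto
  qed
qed

section \<open>Induction over the scales and the three bases\<close>

lemma packet_basis_0: "packet_basis {0} 0"
proof -
  have f0: "f 0 = \<phi>" using packets by (simp add: basic_multiwavelet_packets_def)
  let ?I = "(UNIV :: 'l set) \<times> (int_lattice :: (real ^ 'd) set)" and ?e = "\<lambda>(l, k) x. \<phi> l (x - k)"
  have pe: "packet (0, i) = ?e i" for i
    by (cases i) (simp add: packet_def f0)
  have span: "L2_span ?e ?I \<subseteq> L2_span packet ({0} \<times> ?I)"
  proof
    fix u assume "u \<in> L2_span ?e ?I"
    then obtain F c where F: "finite F" "F \<subseteq> ?I" and u: "u = (\<lambda>x. \<Sum>i\<in>F. c i * ?e i x)"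
      by (auto simp: L2_span_def)
    have inj: "inj_on (Pair (0::nat)) F" by (simp add: inj_on_def)
    have u': "u = (\<lambda>x. \<Sum>i\<in>Pair 0 ` F. c (snd i) * packet i x)"
      unfolding u sum.reindex[OF inj] by (simp add: pe)
    show "u \<in> L2_span packet ({0} \<times> ?I)"
      unfolding u' by (rule L2_spanI) (use F in auto)
  qed
  have mem: "packet i \<in> V 0" if "i \<in> {0} \<times> ?I" for i
    using that orthonormal_basisD(1)[OF V_basis] pe by auto
  show ?thesis
    unfolding orthonormal_basis_def
  proof (intro conjI ballI)
    show "packet i \<in> V 0" if "i \<in> {0} \<times> ?I" for i using mem[OF that] .
    show "L2_inner lborel (packet i) (packet i') = (if i = i' then 1 else 0)"
      if "i \<in> {0} \<times> ?I" "i' \<in> {0} \<times> ?I" for i i'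
      using that orthonormal_basisD(2)[OF V_basis, of "snd i" "snd i'"] pe by (auto split: if_splits)
    show "L2_dense lborel (L2_span packet ({0} \<times> ?I)) (V 0)"
      unfolding L2_dense_def
    proof (intro conjI ballI allI impI)
      show "L2_span packet ({0} \<times> ?I) \<subseteq> V 0" by (rule L2_span_subset[OF V_closed mem])
      fix g and \<epsilon> :: real assume g: "g \<in> V 0" and \<epsilon>: "\<epsilon> > 0"
      obtain u where "u \<in> L2_span ?e ?I" "L2_dist lborel g u < \<epsilon>"
        by (rule L2_denseD[OF orthonormal_basisD(3)[OF V_basis] g \<epsilon>])
      with span show "\<exists>u\<in>L2_span packet ({0} \<times> ?I). L2_dist lborel g u < \<epsilon>" by auto
    qed
  qed
qed

text \<open>Each step appends a last digit in base \<open>a\<close>: the numbers whose quotient by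
  \<open>a\<close> is below \<open>a ^ j\<close> are those below \<open>a ^ Suc j\<close>.\<close>

lemma packet_basis_V: "packet_basis {..<a ^ j} (int j)"
proof (induction j)
  case 0
  have "{..<a ^ 0} = {0::nat}" by auto
  then show ?case using packet_basis_0 by simp
next
  case (Suc j)
  have "{n. n div a \<in> {..<a ^ j}} = {..<a ^ Suc j}"
    using index_pos by (auto simp: div_less_iff_less_mult mult.commute)
  then show ?case using packet_basis_step[OF Suc] by (simp add: add.commute)
qed

text \<open>For \<open>a = 1\<close> all spaces of the analysis would coincide, contradicting \<open>\<Inter>j. V j = {0}\<close>.\<close>

lemma index_ge_2: "a \<ge> 2"
proof (rule ccontr)
  assume "\<not> a \<ge> 2"
  then have a1: "a = 1" using index_pos by simp
  have V10: "V 1 \<subseteq> V 0"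
  proof
    fix g assume g: "g \<in> V 1"
    \<comment> \<open>All powers of \<open>a\<close> are 1, so the translates of the scaling
      functions alone would be a basis of \<open>V 1\<close> as well as of
      \<open>V 0\<close>.\<close>
    have b: "packet_basis {0} 1" and b0: "packet_basis {0} 0"
      using packet_basis_V[of 1] packet_basis_0 by (simp_all add: a1 lessThan_Suc)
    show "g \<in> V 0"
    proof (rule L2_closed_subspace_approx[OF V_closed])
      show "g \<in> L2 lborel" using g V_L2 by blast
      fix \<epsilon> :: real assume \<epsilon>: "\<epsilon> > 0"
      obtain u where u: "u \<in> L2_span packet ({0} \<times> UNIV \<times> int_lattice)" "L2_dist lborel g u < \<epsilon>"
        by (rule L2_denseD[OF orthonormal_basisD(3)[OF b] g \<epsilon>])
      moreover have "u \<in> V 0" using orthonormal_basisD(3)[OF b0] u(1) unfolding L2_dense_def by blast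
      ultimately show "\<exists>u\<in>V 0. L2_dist lborel g u < \<epsilon>" by blast
    qed
  qed
  \<comment> \<open>Dilation carries the inclusion of \<open>V 1\<close> in \<open>V 0\<close> to
    all negative scales; a scaling function, of norm 1, would then lie in every
    \<open>V j\<close>.\<close>
  have down: "V (1 - int n) \<subseteq> V (- int n)" for n
  proof (induction n)
    case (Suc n)
    show ?case
    proof
      fix g assume g: "g \<in> V (1 - int (Suc n))"
      then have gL: "g \<in> L2 lborel" using V_L2 by blast
      have "(\<lambda>x. g (A *v x)) \<in> V (1 - int n)" using V_dilate[OF gL, of "- int n"] g by (simp add: add.commute)
      then have "(\<lambda>x. g (A *v x)) \<in> V (- int n)" using Suc by blast
      then show "g \<in> V (- int (Suc n))" using V_dilate[OF gL, of "- int (Suc n)"] by simp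
    qed
  qed (use V10 in simp)
  have V0: "V 0 \<subseteq> V (- int n)" for n
  proof (induction n)
    case (Suc n)
    then show ?case using down[of "Suc n"] by simp
  qed simp
  obtain l :: 'l where True by blast
  define p where "p = packet (0, l, 0)"
  have p: "p \<in> V 0" using orthonormal_basisD(1)[OF packet_basis_0] by (simp add: p_def)
  have "p \<in> V j" for j
  proof (cases "j \<ge> 0")
    case True
    then show ?thesis using p V_mono by blast
  next
    case False
    then have "- int (nat (- j)) = j" by simp
    then show ?thesis using p V0[of "nat (- j)"] by auto
  qed
  then have "AE x in lborel. p x = 0" using V_Inter by blast
  then have "L2_inner lborel p p = 0"
    unfolding L2_inner_def by (intro integral_eq_zero_AE) auto
  moreover have "L2_inner lborel p p = 1"
    using orthonormal_basisD(2)[OF packet_basis_0, of "(0, l, 0)" "(0, l, 0)"] by (simp add: p_def)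
  ultimately show False by simp
qed

lemma packet_basis_wavelet_space:
  "orthonormal_basis lborel packet ({a ^ j..<a ^ (j + 1)} \<times> UNIV \<times> int_lattice) (wavelet_space V (int j))"
proof -
  have le: "a ^ j \<le> a ^ (j + 1)" using index_pos by simp
  have "{..<a ^ (j + 1)} \<times> UNIV \<times> int_lattice - {..<a ^ j} \<times> UNIV \<times> int_lattice
      = {a ^ j..<a ^ (j + 1)} \<times> (UNIV :: 'l set) \<times> (int_lattice :: (real ^ 'd) set)"
    by auto
  moreover have "int (j + 1) = int j + 1" by simp
  moreover have "orthonormal_basis lborel packet ({..<a ^ (j + 1)} \<times> UNIV \<times> int_lattice - {..<a ^ j} \<times> UNIV \<times> int_lattice)
      (L2_ominus lborel (V (int (j + 1))) (V (int j)))"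
    by (rule orthonormal_basis_complement[OF V_closed V_closed packet_basis_V packet_basis_V])
       (intro Sigma_mono subset_refl, simp only: lessThan_subset_iff le)
  ultimately show ?thesis by (simp only: wavelet_space_def)
qed

text \<open>As \<open>n < a ^ n\<close>, any two packets belong to the basis of a common
  \<open>V j\<close>, which gives orthonormality; density combines that of the union of the
  \<open>V j\<close> with that of the span in one \<open>V j\<close>.\<close>

lemma packet_basis_L2: "orthonormal_basis lborel packet (UNIV \<times> UNIV \<times> int_lattice) (L2 lborel)"
proof -
  have less: "n < a ^ n" for n
    using less_exp[of n] power_mono[OF index_ge_2, of n] by linarith
  have less': "n < a ^ m" if "n \<le> m" for n m
    using less[of n] power_increasing[OF that, of a] index_ge_2 by linarith
  show ?thesis
    unfolding orthonormal_basis_def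
  proof (intro conjI ballI)
    show mem: "packet i \<in> L2 lborel" if "i \<in> UNIV \<times> UNIV \<times> int_lattice" for i
    proof -
      obtain n l k where i: "i = (n, l, k)" by (rule prod_cases3)
      then have "i \<in> {..<a ^ n} \<times> UNIV \<times> int_lattice" using that less by auto
      then show ?thesis using orthonormal_basisD(1)[OF packet_basis_V[of n]] V_L2 by blast
    qed
    show "L2_inner lborel (packet i) (packet i') = (if i = i' then 1 else 0)"
      if "i \<in> UNIV \<times> UNIV \<times> int_lattice" "i' \<in> UNIV \<times> UNIV \<times> int_lattice" for i i'
    proof -
      obtain n l k where i: "i = (n, l, k)" by (rule prod_cases3)
      obtain n' l' k' where i': "i' = (n', l', k')" by (rule prod_cases3)
      have "i \<in> {..<a ^ (max n n')} \<times> UNIV \<times> int_lattice" "i' \<in> {..<a ^ (max n n')} \<times> UNIV \<times> int_lattice"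
        using that i i' less'[of n "max n n'"] less'[of n' "max n n'"] by auto
      then show ?thesis by (rule orthonormal_basisD(2)[OF packet_basis_V])
    qed
    show "L2_dense lborel (L2_span packet (UNIV \<times> UNIV \<times> int_lattice)) (L2 lborel)"
      unfolding L2_dense_def
    proof (intro conjI ballI allI impI)
      show sub: "L2_span packet (UNIV \<times> UNIV \<times> int_lattice) \<subseteq> L2 lborel"
      proof
        fix u assume "u \<in> L2_span packet (UNIV \<times> UNIV \<times> int_lattice)"
        then obtain F c where F: "F \<subseteq> UNIV \<times> UNIV \<times> int_lattice" and u: "u = (\<lambda>x. \<Sum>i\<in>F. c i * packet i x)"
          by (auto simp: L2_span_def)
        show "u \<in> L2 lborel" unfolding u by (rule L2_lincomb[OF mem]) (use F in auto)
      qed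
      fix g :: "real ^ 'd \<Rightarrow> complex" and \<epsilon> :: real assume g: "g \<in> L2 lborel" and \<epsilon>: "\<epsilon> > 0"
      then have \<epsilon>2: "\<epsilon> / 2 > 0" by simp
      obtain v where v: "v \<in> (\<Union>j. V j)" "L2_dist lborel g v < \<epsilon> / 2"
        by (rule L2_denseD[OF V_dense g \<epsilon>2])
      then obtain j where "v \<in> V j" by blast
      \<comment> \<open>For negative \<open>j\<close> this moves \<open>v\<close> up to
        \<open>V 0\<close>, since packet bases are available at nonnegative scales.\<close>
      then have vj: "v \<in> V (int (nat j))" using V_mono[of j "int (nat j)"] by auto
      obtain u where u: "u \<in> L2_span packet ({..<a ^ nat j} \<times> UNIV \<times> int_lattice)" "L2_dist lborel v u < \<epsilon> / 2"
        by (rule L2_denseD[OF orthonormal_basisD(3)[OF packet_basis_V] vj \<epsilon>2])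
      have u': "u \<in> L2_span packet (UNIV \<times> UNIV \<times> int_lattice)"
        using u(1) L2_span_mono[of "{..<a ^ nat j} \<times> UNIV \<times> int_lattice" "UNIV \<times> UNIV \<times> int_lattice" packet] by auto
      have "L2_dist lborel g u \<le> L2_dist lborel g v + L2_dist lborel v u"
        by (rule L2_dist_triangle) (use g vj V_L2 u' sub in auto)
      then have "L2_dist lborel g u < \<epsilon>" using u(2) v(2) by simp
      then show "\<exists>u\<in>L2_span packet (UNIV \<times> UNIV \<times> int_lattice). L2_dist lborel g u < \<epsilon>" using u' by blast
    qed
  qed
qed

end

theorem theorem3p2:
  fixes A :: "real ^ 'd ^ 'd"
    and K :: "(real ^ 'd) set"
    and V :: "int \<Rightarrow> (real ^ 'd \<Rightarrow> complex) set"
    and \<phi> :: "'l::finite \<Rightarrow> real ^ 'd \<Rightarrow> complex"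
    and h :: "nat \<Rightarrow> 'l \<Rightarrow> 'l \<Rightarrow> real ^ 'd \<Rightarrow> complex"
    and H :: "nat \<Rightarrow> real ^ 'd \<Rightarrow> complex ^ 'l ^ 'l"
    and f :: "nat \<Rightarrow> 'l \<Rightarrow> real ^ 'd \<Rightarrow> complex"
  assumes "dilation_matrix A"
    and "digit_set (transpose A) K"
    and "MRA A V \<phi>"
    and "packet_filters A K \<phi> h H"
    and "basic_multiwavelet_packets A \<phi> h f"
  shows "(\<forall>j::nat. orthonormal_basis lborel (\<lambda>(n, l, k) x. f n l (x - k))
            ({dilation_index A ^ j .. dilation_index A ^ (j + 1) - 1} \<times> UNIV \<times> int_lattice)
            (wavelet_space V (int j)))
       \<and> (\<forall>j::nat. orthonormal_basis lborel (\<lambda>(n, l, k) x. f n l (x - k))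
            ({0 .. dilation_index A ^ j - 1} \<times> UNIV \<times> int_lattice)
            (V (int j)))
       \<and> orthonormal_basis lborel (\<lambda>(n, l, k) x. f n l (x - k))
            (UNIV \<times> UNIV \<times> int_lattice)
            (L2 lborel)"
proof -
  interpret packet_system A K V \<phi> h H f
    using assms by unfold_locales
  have pos: "dilation_index A ^ j > 0" for j using index_pos by simp
  \<comment> \<open>Subtraction is truncated: for \<open>u = 0\<close> the closed interval from 0
    would contain 0, so positivity of the powers matters.\<close>
  have Icc: "{l..u - 1} = {l..<u}" if "u > 0" for l u :: nat using that by auto
  have sets: "{dilation_index A ^ j .. dilation_index A ^ (j + 1) - 1} = {dilation_index A ^ j ..< dilation_index A ^ (j + 1)}"
    "{0 .. dilation_index A ^ j - 1} = {..< dilation_index A ^ j}" for j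
    by (simp_all only: Icc[OF pos] atLeast0LessThan)
  show ?thesis
    unfolding sets using packet_basis_wavelet_space packet_basis_V packet_basis_L2 unfolding packet_def by blast
qed

end
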